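(* Let $q\in\mathbb{C}$ with $0<|q|<1$. Let $l\in\frac12\mathbb{N}$, $i,j\in I_l=\{-l,-l+1,\dots,l\}$ and $k\in\mathbb{Z}$. In $\mathcal{O}(U_q(2))$, with $c=-\bar qDb^*$, the matrix coefficient $t^l_{ij}D^k$ is expressed in terms of little $q$-Jacobi polynomials as follows: (i) if $i+j\le0$ and $i\ge j$, $$t^l_{ij}D^k=a^{-(i+j)}c^{\,i-j}\,(\bar q)^{(j-i)(l+j)}\,\frac{\binom{2l}{l+j}_{|q|^2}^{1/2}}{\binom{2l}{l+i}_{|q|^2}^{1/2}}\binom{l-j}{i-j}_{|q|^2}\mathcal{P}_{l+j}^{(i-j,\,-i-j)}(bb^*;|q|^2)\,D^{l+j+k};$$ (ii) if $i+j\le0$ and $i\le j$, $$t^l_{ij}D^k=a^{-(i+j)}b^{\,j-i}\,q^{(i-j)(l+i)}\,\frac{\binom{2l}{l+j}_{|q|^2}^{1/2}}{\binom{2l}{l+i}_{|q|^2}^{1/2}}\binom{l+j}{j-i}_{|q|^2}\mathcal{P}_{l+i}^{(j-i,\,-i-j)}(bb^*;|q|^2)\,D^{l+i+k};$$ (iii) if $i+j\ge0$ and $i\le j$, $$t^l_{ij}D^k=q^{(i-j)(l+i)}\,\frac{\binom{2l}{l+j}_{|q|^2}^{1/2}}{\binom{2l}{l+i}_{|q|^2}^{1/2}}\binom{l+j}{j-i}_{|q|^2}\mathcal{P}_{l-j}^{(j-i,\,i+j)}(bb^*;|q|^2)\,(a^* )^{i+j}b^{\,j-i}D^{l+i+k};$$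 (iv) if $i+j\ge0$ and $i\ge j$, $$t^l_{ij}D^k=(\bar q)^{(j-i)(l+j)}\,\frac{\binom{2l}{l+j}_{|q|^2}^{1/2}}{\binom{2l}{l+i}_{|q|^2}^{1/2}}\binom{l-j}{i-j}_{|q|^2}\mathcal{P}_{l-i}^{(i-j,\,i+j)}(bb^*;|q|^2)\,(a^* )^{i+j}c^{\,i-j}D^{l+j+k}.$$
   Context: $\mathbb{N}=\{0,1,2,\dots\}$. For $q\in\mathbb{C}\setminus\{0\}$, $C(U_q(2))$ is the universal unital $C^*$-algebra generated by $a,b,D$ subject to $$ba=qab,\quad a^*b=qba^*,\quad bb^*=b^*b,\quad aa^*+bb^*=1,\quad aD=Da,\quad bD=q^2|q|^{-2}Db,\quad DD^*=D^*D=1,\quad a^*a+|q|^2b^*b=1,$$ with comultiplication $\Delta(a)=a\otimes a-\bar q\,b\otimes Db^*$, $\Delta(b)=a\otimes b+b\otimes Da^*$, $\Delta(D)=D\otimes D$. $\mathcal{A}_q=\mathcal{O}(U_q(2))$ is the $*$-subalgebra generated by $a,b,D$. For $n\in\mathbb{N}$ and $s,\alpha\in\mathbb{C}$ put $(\alpha;s)_n=\prod_{r=0}^{n-1}(1-\alpha s^r)$ and $\binom{n}{m}_{s}=\frac{(s;s)_n}{(s;s)_m(s;s)_{n-m}}$. For $l\in\frac12\mathbb{N}$ and $j\in I_l$ let $f^l_j=\binom{2l}{l+j}_{|q|^2}^{1/2}a^{l-j}b^{l+j}$ and $V_l^R=\bigoplus_{j\in I_l}\mathbb{C}f^l_j\subset\mathcal{A}_q$.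 The comultiplication restricts to a right corepresentation $T_l^R=\Delta|_{V_l^R}:V_l^R\to V_l^R\otimes\mathcal{A}_q$, and $t^l_{ij}\in\mathcal{A}_q$ are its matrix coefficients: $\Delta(f^l_j)=\sum_{i\in I_l}f^l_i\otimes t^l_{ij}$. The little $q$-Jacobi polynomials (with base $p$) are $$\mathcal{P}_n^{(\alpha,\beta)}(z;p)=\sum_{r\ge0}\frac{(p^{-n};p)_r\,(p^{\alpha+\beta+n+1};p)_r}{(p;p)_r\,(p^{\alpha+1};p)_r}(pz)^r ,$$ a finite sum since $(p^{-n};p)_r=0$ for $r>n$. *)

theory Defs
  imports "HOL-Analysis.Analysis" "HOL-Library.Poly_Mapping" "HOL.Hull"
begin

section \<open>Complex *-algebras and C*-algebras\<close>

class complex_star_algebra = ring + monoid_mult +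
  fixes scaleC :: "complex \<Rightarrow> 'a \<Rightarrow> 'a" (infixr "*\<^sub>C" 75)
    and star :: "'a \<Rightarrow> 'a" ("_\<^sup>\<star>" [1000] 1000)
  assumes scaleC_add_right: "c *\<^sub>C (x + y) = c *\<^sub>C x + c *\<^sub>C y"
    and scaleC_add_left: "(c + d) *\<^sub>C x = c *\<^sub>C x + d *\<^sub>C x"
    and scaleC_scaleC: "c *\<^sub>C d *\<^sub>C x = (c * d) *\<^sub>C x"
    and scaleC_one: "1 *\<^sub>C x = x"
    and scaleC_mult_left: "(c *\<^sub>C x) * y = c *\<^sub>C (x * y)"
    and scaleC_mult_right: "x * (c *\<^sub>C y) = c *\<^sub>C (x * y)"
    and star_add: "(x + y)\<^sup>\<star> = x\<^sup>\<star> + y\<^sup>\<star>"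
    and star_scaleC: "(c *\<^sub>C x)\<^sup>\<star> = cnj c *\<^sub>C x\<^sup>\<star>"
    and star_mult: "(x * y)\<^sup>\<star> = y\<^sup>\<star> * x\<^sup>\<star>"
    and star_star: "x\<^sup>\<star>\<^sup>\<star> = x"

class cstar_algebra = complex_star_algebra + real_normed_algebra_1 + banach +
  assumes scaleR_scaleC: "r *\<^sub>R x = complex_of_real r *\<^sub>C x"
    and norm_scaleC: "norm (c *\<^sub>C x) = cmod c * norm x"
    and cstar_identity: "norm (x\<^sup>\<star> * x) = (norm x)\<^sup>2"

global_interpretation complex_vector: vector_space "scaleC :: complex \<Rightarrow> 'a \<Rightarrow> 'a::complex_star_algebra"
  by unfold_locales
    (simp_all add: scaleC_add_right scaleC_add_left scaleC_scaleC scaleC_one)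

lemma star_zero [simp]: "(0::'a::complex_star_algebra)\<^sup>\<star> = 0"
  using star_add[of "0::'a" 0] by simp

lemma star_one [simp]: "(1::'a::complex_star_algebra)\<^sup>\<star> = 1"
  by (metis mult.left_neutral mult.right_neutral star_mult star_star)

lemma star_minus: "(- x)\<^sup>\<star> = - (x::'a::complex_star_algebra)\<^sup>\<star>"
  by (metis add.right_inverse add_eq_0_iff star_add star_zero)

lemma star_diff: "(x - y)\<^sup>\<star> = x\<^sup>\<star> - (y::'a::complex_star_algebra)\<^sup>\<star>"
  by (metis star_add star_minus diff_conv_add_uminus)

text \<open>Meant for unitary u, where the adjoint is the inverse.\<close>

definition upow :: "'a::complex_star_algebra \<Rightarrow> int \<Rightarrow> 'a" where
  "upow u k = (if 0 \<le> k then u ^ nat k else (u\<^sup>\<star>) ^ nat (- k))"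

definition star_subalgebra :: "'a::complex_star_algebra set \<Rightarrow> bool" where
  "star_subalgebra S \<longleftrightarrow> 1 \<in> S \<and> (\<forall>x\<in>S. \<forall>y\<in>S. x + y \<in> S \<and> x * y \<in> S) \<and>
     (\<forall>c. \<forall>x\<in>S. c *\<^sub>C x \<in> S) \<and> (\<forall>x\<in>S. x\<^sup>\<star> \<in> S)"

definition star_hom_on ::
  "'a::complex_star_algebra set \<Rightarrow> ('a \<Rightarrow> 'b::complex_star_algebra) \<Rightarrow> bool" where
  "star_hom_on S f \<longleftrightarrow> f 1 = 1 \<and>
     (\<forall>x\<in>S. \<forall>y\<in>S. f (x + y) = f x + f y \<and> f (x * y) = f x * f y) \<and>
     (\<forall>c. \<forall>x\<in>S. f (c *\<^sub>C x) = c *\<^sub>C f x) \<and> (\<forall>x\<in>S. f (x\<^sup>\<star>) = (f x)\<^sup>\<star>)"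

definition cstar_seminorm :: "('a::complex_star_algebra \<Rightarrow> real) \<Rightarrow> bool" where
  "cstar_seminorm p \<longleftrightarrow> (\<forall>x. 0 \<le> p x) \<and> (\<forall>x y. p (x + y) \<le> p x + p y) \<and>
     (\<forall>c x. p (c *\<^sub>C x) = cmod c * p x) \<and> (\<forall>x y. p (x * y) \<le> p x * p y) \<and>
     (\<forall>x. p (x\<^sup>\<star> * x) = (p x)\<^sup>2)"


section \<open>The complex *-algebra of a monoid with involution\<close>

text \<open>
  Monoids are written additively here because multiplication of \<^typ>\<open>'k \<Rightarrow>\<^sub>0 complex\<close> is
  convolution with respect to \<^term>\<open>(+)\<close> on the index type.
\<close>

class star_monoid = monoid_add +
  fixes kstar :: "'a \<Rightarrow> 'a"
  assumes kstar_kstar [simp]: "kstar (kstar k) = k"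
    and kstar_add: "kstar (k + m) = kstar m + kstar k"

typedef (overloaded) 'k monoid_alg = "UNIV :: ('k::star_monoid \<Rightarrow>\<^sub>0 complex) set"
  by simp

setup_lifting type_definition_monoid_alg

lift_definition pm_star :: "('k::star_monoid \<Rightarrow>\<^sub>0 complex) \<Rightarrow> ('k \<Rightarrow>\<^sub>0 complex)"
  is "\<lambda>f k. cnj (f (kstar k))"
proof -
  fix f :: "'k \<Rightarrow> complex" assume "finite {k. f k \<noteq> 0}"
  moreover have "{k. cnj (f (kstar k)) \<noteq> 0} \<subseteq> kstar ` {k. f k \<noteq> 0}"
    by (auto intro!: image_eqI[of _ _ "kstar _"])
  ultimately show "finite {k. cnj (f (kstar k)) \<noteq> 0}"
    using finite_surj by blast
qed

lemma pm_star_add: "pm_star (x + y) = pm_star x + pm_star y"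
  by transfer (simp add: fun_eq_iff)

lemma pm_star_zero: "pm_star 0 = 0"
  by transfer simp

lemma pm_star_pm_star: "pm_star (pm_star x) = x"
  by transfer simp

lemma pm_star_single: "pm_star (Poly_Mapping.single k c) = Poly_Mapping.single (kstar k) (cnj c)"
  by (rule poly_mapping_eqI)
     (auto simp: pm_star.rep_eq lookup_single when_def)

lemma pm_induct [case_names zero add]:
  fixes x :: "'k \<Rightarrow>\<^sub>0 complex"
  assumes "P 0" and "\<And>k c x. P x \<Longrightarrow> P (Poly_Mapping.single k c + x)"
  shows "P x"
proof (induction x rule: update_induct)
  case const
  then show ?case by (simp add: assms(1))
next
  case (update f k c)
  have "Poly_Mapping.update k c f = Poly_Mapping.single k c + f"
    using update(1) by (intro poly_mapping_eqI)
      (auto simp: lookup_update lookup_add lookup_single when_def in_keys_iff)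
  then show ?case using assms(2) update(3) by simp
qed

lemma pm_star_mult: "pm_star (x * y) = pm_star y * pm_star x"
proof (induction x rule: pm_induct)
  case zero
  then show ?case by (simp add: pm_star_zero)
next
  case (add k c x)
  have "pm_star (Poly_Mapping.single k c * y) = pm_star y * pm_star (Poly_Mapping.single k c)"
    by (induction y rule: pm_induct)
       (simp_all add: pm_star_zero pm_star_add distrib_left distrib_right mult_single
          pm_star_single kstar_add mult.commute)
  with add show ?case
    by (simp add: distrib_left distrib_right pm_star_add)
qed

instantiation monoid_alg :: (star_monoid) complex_star_algebra
begin

lift_definition zero_monoid_alg :: "'a monoid_alg" is 0 .
lift_definition one_monoid_alg :: "'a monoid_alg" is 1 .
lift_definition plus_monoid_alg :: "'a monoid_alg \<Rightarrow> 'a monoid_alg \<Rightarrow> 'a monoid_alg" is "(+)" .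
lift_definition minus_monoid_alg :: "'a monoid_alg \<Rightarrow> 'a monoid_alg \<Rightarrow> 'a monoid_alg" is "(-)" .
lift_definition uminus_monoid_alg :: "'a monoid_alg \<Rightarrow> 'a monoid_alg" is uminus .
lift_definition times_monoid_alg :: "'a monoid_alg \<Rightarrow> 'a monoid_alg \<Rightarrow> 'a monoid_alg" is "(*)" .
lift_definition scaleC_monoid_alg :: "complex \<Rightarrow> 'a monoid_alg \<Rightarrow> 'a monoid_alg"
  is "\<lambda>c x. Poly_Mapping.single 0 c * x" .
lift_definition star_monoid_alg :: "'a monoid_alg \<Rightarrow> 'a monoid_alg" is pm_star .

instance
proof
  have kstar_0: "kstar (0::'a) = 0"
    by (metis add.left_neutral add.right_neutral kstar_add kstar_kstar)
  have comm: "x * Poly_Mapping.single 0 c = Poly_Mapping.single 0 c * x"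
    for x :: "'a \<Rightarrow>\<^sub>0 complex" and c
    by (induction x rule: pm_induct)
       (simp_all add: distrib_left distrib_right mult_single mult.commute)
  fix x y z :: "'a monoid_alg" and c d :: complex
  show "x + y + z = x + (y + z)" by transfer (simp add: add.assoc)
  show "x + y = y + x" by transfer (simp add: add.commute)
  show "0 + x = x" by transfer simp
  show "- x + x = 0" by transfer simp
  show "x - y = x + - y" by transfer simp
  show "x * y * z = x * (y * z)" by transfer (simp add: mult.assoc)
  show "(x + y) * z = x * z + y * z" by transfer (simp add: distrib_right)
  show "x * (y + z) = x * y + x * z" by transfer (simp add: distrib_left)
  show "1 * x = x" by transfer simp
  show "x * 1 = x" by transfer simp
  show "c *\<^sub>C (x + y) = c *\<^sub>C x + c *\<^sub>C y" by transfer (simp add: distrib_left)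
  show "(c + d) *\<^sub>C x = c *\<^sub>C x + d *\<^sub>C x" by transfer (simp add: single_add distrib_right)
  show "c *\<^sub>C d *\<^sub>C x = (c * d) *\<^sub>C x" by transfer (simp add: mult_single flip: mult.assoc)
  show "1 *\<^sub>C x = x" by transfer simp
  show "(c *\<^sub>C x) * y = c *\<^sub>C (x * y)" by transfer (simp add: mult.assoc)
  show "x * (c *\<^sub>C y) = c *\<^sub>C (x * y)" by transfer (metis comm mult.assoc)
  show "(x + y)\<^sup>\<star> = x\<^sup>\<star> + y\<^sup>\<star>" by transfer (rule pm_star_add)
  show "(c *\<^sub>C x)\<^sup>\<star> = cnj c *\<^sub>C x\<^sup>\<star>"
    by transfer (simp add: pm_star_mult pm_star_single kstar_0 comm)
  show "(x * y)\<^sup>\<star> = y\<^sup>\<star> * x\<^sup>\<star>" by transfer (rule pm_star_mult)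
  show "x\<^sup>\<star>\<^sup>\<star> = x" by transfer (rule pm_star_pm_star)
qed

end

lift_definition mon :: "'k::star_monoid \<Rightarrow> 'k monoid_alg" is "\<lambda>k. Poly_Mapping.single k 1" .

lift_definition coeff_at :: "'k::star_monoid monoid_alg \<Rightarrow> 'k \<Rightarrow> complex" is Poly_Mapping.lookup .

lift_definition supp :: "'k::star_monoid monoid_alg \<Rightarrow> 'k set" is Poly_Mapping.keys .

lemma mon_mult: "mon k * mon m = mon (k + m)"
  by transfer (simp add: mult_single)

lemma mon_zero: "mon 0 = 1"
  by transfer simp

lemma star_mon: "(mon k)\<^sup>\<star> = mon (kstar k)"
  by transfer (simp add: pm_star_single)

lemma monoid_alg_induct [case_names zero add]:
  assumes "P 0" and "\<And>k c x. P x \<Longrightarrow> P (c *\<^sub>C mon k + x)"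
  shows "P x"
proof -
  have "P (Abs_monoid_alg y)" for y
  proof (induction y rule: pm_induct)
    case zero
    then show ?case using assms(1) by (simp add: zero_monoid_alg_def)
  next
    case (add k c y)
    have "Abs_monoid_alg (Poly_Mapping.single k c + y) = c *\<^sub>C mon k + Abs_monoid_alg y"
      by (simp add: plus_monoid_alg.abs_eq scaleC_monoid_alg.abs_eq mon.abs_eq mult_single
            eq_onp_same_args)
    then show ?case using assms(2)[OF add] by simp
  qed
  then show ?thesis by (metis Rep_monoid_alg_inverse)
qed


section \<open>Algebraic tensor product over the complex numbers\<close>

text \<open>
  The free vector space on pairs modulo the span of the bilinearity relations.  The pairs form
  a monoid under componentwise multiplication (written additively, as above), which makes the
  free vector space a *-algebra and the span a *-ideal.
\<close>

datatype ('a, 'b) tpair = TPair 'a 'b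

instantiation tpair :: (complex_star_algebra, complex_star_algebra) star_monoid
begin

definition zero_tpair :: "('a, 'b) tpair" where "zero_tpair = TPair 1 1"

fun plus_tpair :: "('a, 'b) tpair \<Rightarrow> ('a, 'b) tpair \<Rightarrow> ('a, 'b) tpair" where
  "plus_tpair (TPair x y) (TPair x' y') = TPair (x * x') (y * y')"

fun kstar_tpair :: "('a, 'b) tpair \<Rightarrow> ('a, 'b) tpair" where
  "kstar_tpair (TPair x y) = TPair (x\<^sup>\<star>) (y\<^sup>\<star>)"

instance
proof
  fix k m n :: "('a, 'b) tpair"
  show "k + m + n = k + (m + n)" by (cases k; cases m; cases n) (simp add: mult.assoc)
  show "0 + k = k" "k + 0 = k" by (cases k; simp add: zero_tpair_def)+
  show "kstar (kstar k) = k" by (cases k) (simp add: star_star)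
  show "kstar (k + m) = kstar m + kstar k" by (cases k; cases m) (simp add: star_mult)
qed

end

inductive_set bilinear_rels ::
  "('a::complex_star_algebra, 'b::complex_star_algebra) tpair monoid_alg set" where
  add_left: "mon (TPair (x + x') y) - (mon (TPair x y) + mon (TPair x' y)) \<in> bilinear_rels"
| add_right: "mon (TPair x (y + y')) - (mon (TPair x y) + mon (TPair x y')) \<in> bilinear_rels"
| scale_left: "mon (TPair (c *\<^sub>C x) y) - c *\<^sub>C mon (TPair x y) \<in> bilinear_rels"
| scale_right: "mon (TPair x (c *\<^sub>C y)) - c *\<^sub>C mon (TPair x y) \<in> bilinear_rels"

abbreviation tensor_null ::
  "('a::complex_star_algebra, 'b::complex_star_algebra) tpair monoid_alg set" where
  "tensor_null \<equiv> complex_vector.span bilinear_rels"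

lemma bilinear_rels_mon:
  assumes "g \<in> bilinear_rels"
  shows "g * mon k \<in> bilinear_rels" "mon k * g \<in> bilinear_rels"
proof -
  obtain u v where k: "k = TPair u v" by (cases k)
  show "g * mon k \<in> bilinear_rels"
    using assms
    by cases
      (simp_all add: k left_diff_distrib distrib_right scaleC_mult_left mon_mult bilinear_rels.intros)
  show "mon k * g \<in> bilinear_rels"
    using assms
    by cases
      (simp_all add: k right_diff_distrib distrib_left scaleC_mult_right mon_mult bilinear_rels.intros)
qed

lemma bilinear_rels_star:
  assumes "g \<in> bilinear_rels"
  shows "g\<^sup>\<star> \<in> bilinear_rels"
  using assms
  by cases (simp_all add: star_mon star_diff star_add star_scaleC bilinear_rels.intros)

lemma tensor_null_mult:
  assumes "g \<in> tensor_null"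
  shows "g * x \<in> tensor_null" "x * g \<in> tensor_null"
proof -
  have "g * mon k \<in> tensor_null \<and> mon k * g \<in> tensor_null" for k
    using assms
  proof (induction rule: complex_vector.span_induct_alt)
    case base
    show ?case by (simp add: complex_vector.span_zero)
  next
    case (step c h g)
    then show ?case
      by (simp add: distrib_left distrib_right scaleC_mult_left scaleC_mult_right bilinear_rels_mon
            complex_vector.span_add complex_vector.span_scale complex_vector.span_base)
  qed
  then show "g * x \<in> tensor_null" "x * g \<in> tensor_null"
    by (induction x rule: monoid_alg_induct)
       (simp_all add: distrib_left distrib_right scaleC_mult_left scaleC_mult_right
          complex_vector.span_zero complex_vector.span_add complex_vector.span_scale)
qed

lemma tensor_null_star:
  assumes "g \<in> tensor_null"
  shows "g\<^sup>\<star> \<in> tensor_null"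
  using assms
proof (induction rule: complex_vector.span_induct_alt)
  case base
  show ?case by (simp add: complex_vector.span_zero)
next
  case (step c h g)
  then show ?case
    by (simp add: star_add star_scaleC bilinear_rels_star
          complex_vector.span_add complex_vector.span_scale complex_vector.span_base)
qed

definition tensor_rel ::
  "('a::complex_star_algebra, 'b::complex_star_algebra) tpair monoid_alg \<Rightarrow>
   ('a, 'b) tpair monoid_alg \<Rightarrow> bool" where
  "tensor_rel x y \<longleftrightarrow> x - y \<in> tensor_null"

lemma equivp_tensor_rel: "equivp tensor_rel"
proof (rule equivpI)
  show "reflp tensor_rel"
    by (simp add: reflp_def tensor_rel_def complex_vector.span_zero)
  show "symp tensor_rel"
    unfolding symp_def tensor_rel_def by (metis complex_vector.span_neg minus_diff_eq)
  show "transp tensor_rel"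
    unfolding transp_def tensor_rel_def
    using complex_vector.span_add by fastforce
qed

quotient_type (overloaded) ('a, 'b) tensor =
  "('a::complex_star_algebra, 'b::complex_star_algebra) tpair monoid_alg" / tensor_rel
  by (rule equivp_tensor_rel)

instantiation tensor :: (complex_star_algebra, complex_star_algebra) complex_star_algebra
begin

lift_definition zero_tensor :: "('a, 'b) tensor" is 0 .
lift_definition one_tensor :: "('a, 'b) tensor" is 1 .
lift_definition plus_tensor :: "('a, 'b) tensor \<Rightarrow> ('a, 'b) tensor \<Rightarrow> ('a, 'b) tensor" is "(+)"
  unfolding tensor_rel_def by (drule (1) complex_vector.span_add) (simp add: algebra_simps)
lift_definition minus_tensor :: "('a, 'b) tensor \<Rightarrow> ('a, 'b) tensor \<Rightarrow> ('a, 'b) tensor" is "(-)"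
  unfolding tensor_rel_def by (drule (1) complex_vector.span_diff) (simp add: algebra_simps)
lift_definition uminus_tensor :: "('a, 'b) tensor \<Rightarrow> ('a, 'b) tensor" is uminus
  unfolding tensor_rel_def by (drule complex_vector.span_neg) simp
lift_definition times_tensor :: "('a, 'b) tensor \<Rightarrow> ('a, 'b) tensor \<Rightarrow> ('a, 'b) tensor" is "(*)"
  unfolding tensor_rel_def
proof -
  fix x x' y y' :: "('a, 'b) tpair monoid_alg"
  assume "x - x' \<in> tensor_null" "y - y' \<in> tensor_null"
  then have "(x - x') * y + x' * (y - y') \<in> tensor_null"
    by (intro complex_vector.span_add tensor_null_mult)
  then show "x * y - x' * y' \<in> tensor_null"
    by (simp add: algebra_simps)
qed
lift_definition scaleC_tensor :: "complex \<Rightarrow> ('a, 'b) tensor \<Rightarrow> ('a, 'b) tensor" is "scaleC"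
  unfolding tensor_rel_def
  by (simp add: complex_vector.span_scale flip: complex_vector.scale_right_diff_distrib)
lift_definition star_tensor :: "('a, 'b) tensor \<Rightarrow> ('a, 'b) tensor" is star
  unfolding tensor_rel_def by (simp add: tensor_null_star flip: star_diff)

instance
proof
  have eq: "tensor_rel x y" if "x = y" for x y :: "('a, 'b) tpair monoid_alg"
    using that by (simp add: tensor_rel_def complex_vector.span_zero)
  fix x y z :: "('a, 'b) tensor" and c d :: complex
  show "x + y + z = x + (y + z)" by transfer (rule eq, simp add: add.assoc)
  show "x + y = y + x" by transfer (rule eq, simp add: add.commute)
  show "0 + x = x" by transfer (rule eq, simp)
  show "- x + x = 0" by transfer (rule eq, simp)
  show "x - y = x + - y" by transfer (rule eq, simp)
  show "x * y * z = x * (y * z)" by transfer (rule eq, simp add: mult.assoc)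
  show "(x + y) * z = x * z + y * z" by transfer (rule eq, simp add: distrib_right)
  show "x * (y + z) = x * y + x * z" by transfer (rule eq, simp add: distrib_left)
  show "1 * x = x" by transfer (rule eq, simp)
  show "x * 1 = x" by transfer (rule eq, simp)
  show "c *\<^sub>C (x + y) = c *\<^sub>C x + c *\<^sub>C y" by transfer (rule eq, simp add: scaleC_add_right)
  show "(c + d) *\<^sub>C x = c *\<^sub>C x + d *\<^sub>C x" by transfer (rule eq, simp add: scaleC_add_left)
  show "c *\<^sub>C d *\<^sub>C x = (c * d) *\<^sub>C x" by transfer (rule eq, simp add: scaleC_scaleC)
  show "1 *\<^sub>C x = x" by transfer (rule eq, simp add: scaleC_one)
  show "(c *\<^sub>C x) * y = c *\<^sub>C (x * y)" by transfer (rule eq, simp add: scaleC_mult_left)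
  show "x * (c *\<^sub>C y) = c *\<^sub>C (x * y)" by transfer (rule eq, simp add: scaleC_mult_right)
  show "(x + y)\<^sup>\<star> = x\<^sup>\<star> + y\<^sup>\<star>" by transfer (rule eq, simp add: star_add)
  show "(c *\<^sub>C x)\<^sup>\<star> = cnj c *\<^sub>C x\<^sup>\<star>" by transfer (rule eq, simp add: star_scaleC)
  show "(x * y)\<^sup>\<star> = y\<^sup>\<star> * x\<^sup>\<star>" by transfer (rule eq, simp add: star_mult)
  show "x\<^sup>\<star>\<^sup>\<star> = x" by transfer (rule eq, simp add: star_star)
qed

end

lift_definition tensor_of ::
  "'a::complex_star_algebra \<Rightarrow> 'b::complex_star_algebra \<Rightarrow> ('a, 'b) tensor" (infixr "\<otimes>" 72)
  is "\<lambda>x y. mon (TPair x y)" .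

lemma tensor_of_add_left: "(x + x') \<otimes> y = x \<otimes> y + x' \<otimes> y"
  by transfer
     (unfold tensor_rel_def, rule complex_vector.span_base, rule bilinear_rels.intros)

lemma tensor_of_add_right: "x \<otimes> (y + y') = x \<otimes> y + x \<otimes> y'"
  by transfer
     (unfold tensor_rel_def, rule complex_vector.span_base, rule bilinear_rels.intros)

lemma tensor_of_scaleC_left: "(c *\<^sub>C x) \<otimes> y = c *\<^sub>C (x \<otimes> y)"
  by transfer
     (unfold tensor_rel_def, rule complex_vector.span_base, rule bilinear_rels.intros)

lemma tensor_of_scaleC_right: "x \<otimes> (c *\<^sub>C y) = c *\<^sub>C (x \<otimes> y)"
  by transfer
     (unfold tensor_rel_def, rule complex_vector.span_base, rule bilinear_rels.intros)

lemma tensor_of_mult: "(x \<otimes> y) * (x' \<otimes> y') = (x * x') \<otimes> (y * y')"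
  by transfer (simp add: tensor_rel_def mon_mult complex_vector.span_zero)

lemma tensor_of_star: "(x \<otimes> y)\<^sup>\<star> = x\<^sup>\<star> \<otimes> y\<^sup>\<star>"
  by transfer (simp add: tensor_rel_def star_mon complex_vector.span_zero)

lemma tensor_of_one: "1 \<otimes> 1 = 1"
  by transfer
     (simp add: tensor_rel_def complex_vector.span_zero flip: mon_zero zero_tpair_def)


section \<open>The free *-algebra on three generators\<close>

datatype gen = Ga | Gb | GD

text \<open>The letter (g, True) stands for the formal adjoint of (g, False).\<close>

datatype word = Word (letters: "(gen \<times> bool) list")

instantiation word :: star_monoid
begin

definition zero_word :: word where "zero_word = Word []"

definition plus_word :: "word \<Rightarrow> word \<Rightarrow> word" where
  "plus_word v w = Word (letters v @ letters w)"

definition kstar_word :: "word \<Rightarrow> word" where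
  "kstar_word w = Word (rev (map (apsnd Not) (letters w)))"

instance
proof
  fix u v w :: word
  show "u + v + w = u + (v + w)" "0 + w = w" "w + 0 = w"
    by (simp_all add: zero_word_def plus_word_def)
  have "apsnd Not \<circ> apsnd Not = (id :: gen \<times> bool \<Rightarrow> _)"
    by (auto simp: fun_eq_iff)
  then show "kstar (kstar w) = w"
    by (cases w) (simp add: kstar_word_def rev_map)
  show "kstar (v + w) = kstar w + kstar v"
    by (simp add: plus_word_def kstar_word_def)
qed

end

type_synonym free_star_alg = "word monoid_alg"

definition gen_elem :: "gen \<Rightarrow> free_star_alg" where
  "gen_elem g = mon (Word [(g, False)])"

fun eval_letter :: "'a::complex_star_algebra \<Rightarrow> 'a \<Rightarrow> 'a \<Rightarrow> gen \<times> bool \<Rightarrow> 'a" where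
  "eval_letter a b D (g, s) =
     (let x = (case g of Ga \<Rightarrow> a | Gb \<Rightarrow> b | GD \<Rightarrow> D) in if s then x\<^sup>\<star> else x)"

definition eval_word :: "'a::complex_star_algebra \<Rightarrow> 'a \<Rightarrow> 'a \<Rightarrow> word \<Rightarrow> 'a" where
  "eval_word a b D w = prod_list (map (eval_letter a b D) (letters w))"

definition free_eval :: "'a::complex_star_algebra \<Rightarrow> 'a \<Rightarrow> 'a \<Rightarrow> free_star_alg \<Rightarrow> 'a" where
  "free_eval a b D x = (\<Sum>w\<in>supp x. coeff_at x w *\<^sub>C eval_word a b D w)"


lemma free_eval_superset:
  assumes "finite S" "supp x \<subseteq> S"
  shows "free_eval a b D x = (\<Sum>w\<in>S. coeff_at x w *\<^sub>C eval_word a b D w)"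
  unfolding free_eval_def using assms
  by (intro sum.mono_neutral_left) (auto simp: supp.rep_eq coeff_at.rep_eq in_keys_iff)

lemma finite_supp: "finite (supp x)"
  by (simp add: supp.rep_eq)

lemma free_eval_zero: "free_eval a b D 0 = 0"
  by (simp add: free_eval_def supp.rep_eq zero_monoid_alg.rep_eq)

lemma free_eval_add: "free_eval a b D (x + y) = free_eval a b D x + free_eval a b D y"
proof -
  let ?S = "supp x \<union> supp y"
  have "supp (x + y) \<subseteq> ?S"
    by transfer (rule Poly_Mapping.keys_add)
  moreover have "coeff_at (x + y) w = coeff_at x w + coeff_at y w" for w
    by transfer (rule lookup_add)
  ultimately show ?thesis
    by (simp add: free_eval_superset[where S = ?S] finite_supp scaleC_add_left sum.distrib)
qed

lemma free_eval_scaleC: "free_eval a b D (c *\<^sub>C x) = c *\<^sub>C free_eval a b D x"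
proof -
  have lookup: "Poly_Mapping.lookup (Poly_Mapping.single 0 c * y) w = c * Poly_Mapping.lookup y w"
    for y :: "word \<Rightarrow>\<^sub>0 complex" and c w
  proof (induction y rule: pm_induct)
    case (add k d y)
    then show ?case
      by (simp only: distrib_left mult_single lookup_add add_0 lookup_single mult_when)
  qed simp
  have coeff: "coeff_at (c *\<^sub>C x) w = c * coeff_at x w" for w
    by transfer (rule lookup)
  have "supp (c *\<^sub>C x) \<subseteq> supp x"
    by transfer (auto simp: in_keys_iff lookup)
  then show ?thesis
    by (simp add: free_eval_superset[OF finite_supp] coeff complex_vector.scale_sum_right
          free_eval_def[of a b D x])
qed

lemma free_eval_mon: "free_eval a b D (mon w) = eval_word a b D w"
  by (simp add: free_eval_def supp.rep_eq coeff_at.rep_eq mon.rep_eq scaleC_one)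

lemma eval_word_add: "eval_word a b D (v + w) = eval_word a b D v * eval_word a b D w"
  by (simp add: eval_word_def plus_word_def)

lemma eval_word_kstar: "eval_word a b D (kstar w) = (eval_word a b D w)\<^sup>\<star>"
proof -
  have letter: "eval_letter a b D (apsnd Not x) = (eval_letter a b D x)\<^sup>\<star>" for x
    by (cases x) (auto simp: Let_def star_star)
  have "prod_list (map (eval_letter a b D) (rev (map (apsnd Not) xs))) =
        (prod_list (map (eval_letter a b D) xs))\<^sup>\<star>" for xs
    by (induction xs) (simp_all add: letter star_mult del: eval_letter.simps)
  then show ?thesis by (simp add: eval_word_def kstar_word_def)
qed

lemma free_eval_mult: "free_eval a b D (x * y) = free_eval a b D x * free_eval a b D y"
proof (induction x rule: monoid_alg_induct)
  case zero
  then show ?case by (simp add: free_eval_zero)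
next
  case (add k c x)
  have "free_eval a b D (mon k * y) = eval_word a b D k * free_eval a b D y"
    by (induction y rule: monoid_alg_induct)
       (simp_all add: free_eval_zero free_eval_add free_eval_scaleC distrib_left mon_mult
          scaleC_mult_right free_eval_mon eval_word_add)
  with add show ?case
    by (simp add: distrib_right free_eval_add free_eval_scaleC scaleC_mult_left free_eval_mon)
qed

lemma free_eval_star: "free_eval a b D (x\<^sup>\<star>) = (free_eval a b D x)\<^sup>\<star>"
  by (induction x rule: monoid_alg_induct)
     (simp_all add: free_eval_zero star_add star_scaleC star_mon free_eval_add free_eval_scaleC
        free_eval_mon eval_word_kstar)

lemma free_eval_one: "free_eval a b D 1 = 1"
  by (simp add: free_eval_mon eval_word_def zero_word_def flip: mon_zero)

lemma free_eval_diff: "free_eval a b D (x - y) = free_eval a b D x - free_eval a b D y"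
  by (metis add_diff_cancel_right' diff_add_cancel free_eval_add)

lemma free_eval_gen:
  "free_eval a b D (gen_elem Ga) = a" "free_eval a b D (gen_elem Gb) = b"
  "free_eval a b D (gen_elem GD) = D"
  by (simp_all add: gen_elem_def free_eval_mon eval_word_def)

lemmas free_eval_simps =
  free_eval_zero free_eval_one free_eval_add free_eval_diff free_eval_mult free_eval_scaleC
  free_eval_star free_eval_gen

lemma cstar_seminorm_free_eval:
  fixes a b D :: "'a::cstar_algebra"
  shows "cstar_seminorm (\<lambda>x. norm (free_eval a b D x))"
  by (simp add: cstar_seminorm_def free_eval_simps norm_triangle_ineq norm_scaleC
        norm_mult_ineq cstar_identity)


section \<open>The quantum group U_q(2)\<close>

definition Uq2_relators ::
  "complex \<Rightarrow> 'a::complex_star_algebra \<Rightarrow> 'a \<Rightarrow> 'a \<Rightarrow> 'a set" where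
  "Uq2_relators q a b D =
     {b * a - q *\<^sub>C (a * b),
      a\<^sup>\<star> * b - q *\<^sub>C (b * a\<^sup>\<star>),
      b * b\<^sup>\<star> - b\<^sup>\<star> * b,
      a * a\<^sup>\<star> + b * b\<^sup>\<star> - 1,
      a * D - D * a,
      b * D - (q\<^sup>2 / (complex_of_real (cmod q))\<^sup>2) *\<^sub>C (D * b),
      D * D\<^sup>\<star> - 1,
      D\<^sup>\<star> * D - 1,
      a\<^sup>\<star> * a + (complex_of_real (cmod q))\<^sup>2 *\<^sub>C (b\<^sup>\<star> * b) - 1}"

definition O_Uq2 :: "'a::complex_star_algebra \<Rightarrow> 'a \<Rightarrow> 'a \<Rightarrow> 'a set" where
  "O_Uq2 a b D = star_subalgebra hull {a, b, D}"

text \<open>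
  The C*-algebra \<^typ>\<open>'a\<close> with the elements a, b, D is the completion of the free unital
  *-algebra in the largest C*-seminorm that annihilates the relators.  The universal property
  is derived in universal_Uq2_hom below; it cannot serve as the definition because a formula
  cannot quantify over all types of class cstar_algebra.
\<close>

definition universal_Uq2 :: "complex \<Rightarrow> 'a::cstar_algebra \<Rightarrow> 'a \<Rightarrow> 'a \<Rightarrow> bool" where
  "universal_Uq2 q a b D \<longleftrightarrow>
     (\<forall>r\<in>Uq2_relators q a b D. r = 0) \<and>
     closure (O_Uq2 a b D) = UNIV \<and>
     (\<forall>p. cstar_seminorm p \<and>
          (\<forall>r\<in>Uq2_relators q (gen_elem Ga) (gen_elem Gb) (gen_elem GD). p r = 0) \<longrightarrow>
          (\<forall>x. p x \<le> norm (free_eval a b D x)))"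

lemma range_free_eval: "range (free_eval a b D) = O_Uq2 a b D"
proof
  let ?ev = "free_eval a b D"
  have "1 \<in> range ?ev"
    by (metis free_eval_one rangeI)
  then have "star_subalgebra (range ?ev)"
    unfolding star_subalgebra_def
    by (auto simp flip: free_eval_add free_eval_mult free_eval_scaleC free_eval_star)
  moreover have "{a, b, D} \<subseteq> range ?ev"
    by (metis empty_subsetI free_eval_gen insert_subset rangeI)
  ultimately show "O_Uq2 a b D \<subseteq> range ?ev"
    unfolding O_Uq2_def by (intro hull_minimal)
next
  have "x \<in> S" if S: "star_subalgebra S" "{a, b, D} \<subseteq> S" and x: "x \<in> range (free_eval a b D)" for S x
  proof -
    have "eval_letter a b D u \<in> S" for u
      using S unfolding star_subalgebra_def by (cases u) (auto simp: Let_def split: gen.split)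
    then have "prod_list (map (eval_letter a b D) us) \<in> S" for us
      using S by (induction us) (auto simp: star_subalgebra_def)
    then have word: "eval_word a b D w \<in> S" for w
      by (simp add: eval_word_def)
    have "0 \<in> S"
      using S(1) unfolding star_subalgebra_def by (metis complex_vector.scale_zero_left)
    then have "free_eval a b D y \<in> S" for y
      using S(1) word unfolding star_subalgebra_def
      by (induction y rule: monoid_alg_induct)
         (simp_all add: free_eval_zero free_eval_add free_eval_scaleC free_eval_mon)
    with x show ?thesis by auto
  qed
  then show "range (free_eval a b D) \<subseteq> O_Uq2 a b D"
    unfolding O_Uq2_def hull_def by blast
qed

lemma norm_star: "norm (x\<^sup>\<star>) = norm (x::'a::cstar_algebra)"
proof -
  have *: "norm x \<le> norm (x\<^sup>\<star>)" for x :: 'a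
  proof (cases "x = 0")
    case False
    have "norm x * norm x \<le> norm (x\<^sup>\<star>) * norm x"
      using norm_mult_ineq[of "x\<^sup>\<star>" x] by (simp add: cstar_identity power2_eq_square)
    with False show ?thesis by simp
  qed simp
  show ?thesis using *[of x] *[of "x\<^sup>\<star>"] by (simp add: star_star)
qed

lemma continuous_on_star: "continuous_on S (star :: 'a::cstar_algebra \<Rightarrow> 'a)"
  unfolding continuous_on_iff by (metis dist_norm norm_star star_diff)

lemma continuous_on_scaleC: "continuous_on S ((*\<^sub>C) c :: 'a::cstar_algebra \<Rightarrow> 'a)"
proof -
  have "bounded_linear ((*\<^sub>C) c :: 'a \<Rightarrow> 'a)"
    by (rule bounded_linear_intro[of _ "cmod c"])
       (simp_all add: scaleC_add_right scaleR_scaleC scaleC_scaleC norm_scaleC mult.commute)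
  then show ?thesis by (rule linear_continuous_on)
qed

lemma universal_Uq2_hom:
  fixes a b D :: "'a::cstar_algebra" and a' b' D' :: "'b::cstar_algebra"
  assumes U: "universal_Uq2 q a b D" and R: "\<forall>r\<in>Uq2_relators q a' b' D'. r = 0"
  shows "\<exists>!\<phi>. star_hom_on UNIV \<phi> \<and> continuous_on UNIV \<phi> \<and> \<phi> a = a' \<and> \<phi> b = b' \<and> \<phi> D = D'"
proof (rule ex_ex1I)
  let ?ev = "free_eval a b D" and ?ev' = "free_eval a' b' D'" and ?S = "O_Uq2 a b D"
  have dense: "closure ?S = UNIV"
    using U by (simp add: universal_Uq2_def)
  have "?ev' r \<in> Uq2_relators q a' b' D'"
    if "r \<in> Uq2_relators q (gen_elem Ga) (gen_elem Gb) (gen_elem GD)" for r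
    using that unfolding Uq2_relators_def by (auto simp: free_eval_simps)
  then have "\<forall>r\<in>Uq2_relators q (gen_elem Ga) (gen_elem Gb) (gen_elem GD). norm (?ev' r) = 0"
    using R by simp
  then have le: "norm (?ev' x) \<le> norm (?ev x)" for x
    using U cstar_seminorm_free_eval[of a' b' D'] unfolding universal_Uq2_def by blast
  have dist_le: "dist (?ev' x) (?ev' y) \<le> dist (?ev x) (?ev y)" for x y
    using le[of "x - y"] by (simp add: dist_norm free_eval_diff)
  define \<psi> where "\<psi> y = ?ev' (SOME x. ?ev x = y)" for y
  have \<psi>: "\<psi> (?ev x) = ?ev' x" for x
  proof -
    have "?ev (SOME z. ?ev z = ?ev x) = ?ev x"
      by (rule someI_ex) blast
    with dist_le[of "SOME z. ?ev z = ?ev x" x] show ?thesis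
      by (simp add: \<psi>_def)
  qed
  have "uniformly_continuous_on ?S \<psi>"
    unfolding uniformly_continuous_on_def range_free_eval[symmetric]
  proof (intro allI impI)
    fix e :: real assume "0 < e"
    then show "\<exists>d>0. \<forall>x\<in>range ?ev. \<forall>x'\<in>range ?ev. dist x' x < d \<longrightarrow> dist (\<psi> x') (\<psi> x) < e"
      using dist_le by (intro exI[of _ e]) (auto simp: \<psi> intro: le_less_trans)
  qed
  then obtain \<phi> where \<phi>: "uniformly_continuous_on (closure ?S) \<phi>"
      and "\<And>x. x \<in> ?S \<Longrightarrow> \<psi> x = \<phi> x"
    using uniformly_continuous_on_extension_on_closure[of ?S \<psi>] by metis
  then have ev: "\<phi> (?ev x) = ?ev' x" for x
    using \<psi> range_free_eval[of a b D] by (metis rangeI)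
  have cont: "continuous_on UNIV \<phi>"
    using \<phi> dense by (metis uniformly_continuous_imp_continuous)
  have cont2: "continuous_on T (\<lambda>x. \<phi> (f x))" if "continuous_on T f" for f and T :: "'c::topological_space set"
    by (rule continuous_on_compose2[OF cont that]) simp
  have dense1: "f x = g x" if "continuous_on UNIV f" "continuous_on UNIV g"
      and "\<And>y. f (?ev y) = g (?ev y)" for f g :: "'a \<Rightarrow> 'b" and x
  proof -
    have "closure ?S \<subseteq> {x. f x = g x}"
      using that by (intro closure_minimal closed_Collect_eq) (auto simp flip: range_free_eval)
    with dense show ?thesis by auto
  qed
  have dense2: "f (x, x') = g (x, x')" if "continuous_on UNIV f" "continuous_on UNIV g"
      and "\<And>y z. f (?ev y, ?ev z) = g (?ev y, ?ev z)" for f g :: "'a \<times> 'a \<Rightarrow> 'b" and x x'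
  proof -
    have "closure (?S \<times> ?S) \<subseteq> {x. f x = g x}"
      using that by (intro closure_minimal closed_Collect_eq) (auto simp flip: range_free_eval)
    then show ?thesis by (auto simp: closure_Times dense)
  qed
  have "\<phi> (x + y) = \<phi> x + \<phi> y" for x y
    using dense2[of "\<lambda>z. \<phi> (fst z + snd z)" "\<lambda>z. \<phi> (fst z) + \<phi> (snd z)" x y]
    by (simp add: cont2 continuous_intros ev flip: free_eval_add)
  moreover have "\<phi> (x * y) = \<phi> x * \<phi> y" for x y
    using dense2[of "\<lambda>z. \<phi> (fst z * snd z)" "\<lambda>z. \<phi> (fst z) * \<phi> (snd z)" x y]
    by (simp add: cont2 continuous_intros ev flip: free_eval_mult)
  moreover have "\<phi> (c *\<^sub>C x) = c *\<^sub>C \<phi> x" for c x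
    using dense1[of "\<lambda>z. \<phi> (c *\<^sub>C z)" "\<lambda>z. c *\<^sub>C \<phi> z" x]
      continuous_on_compose2[OF continuous_on_scaleC[of UNIV c] cont]
    by (simp add: cont2 continuous_on_scaleC ev flip: free_eval_scaleC)
  moreover have "\<phi> (x\<^sup>\<star>) = (\<phi> x)\<^sup>\<star>" for x
    using dense1[of "\<lambda>z. \<phi> (z\<^sup>\<star>)" "\<lambda>z. (\<phi> z)\<^sup>\<star>" x]
      continuous_on_compose2[OF continuous_on_star[of UNIV] cont]
    by (simp add: cont2 continuous_on_star ev flip: free_eval_star)
  moreover have "\<phi> 1 = 1" "\<phi> a = a'" "\<phi> b = b'" "\<phi> D = D'"
    using ev by (metis free_eval_one, metis free_eval_gen(1), metis free_eval_gen(2), metis free_eval_gen(3))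
  ultimately show "\<exists>\<phi>. star_hom_on UNIV \<phi> \<and> continuous_on UNIV \<phi> \<and> \<phi> a = a' \<and> \<phi> b = b' \<and> \<phi> D = D'"
    using cont by (auto simp: star_hom_on_def)
  fix f g :: "'a \<Rightarrow> 'b"
  assume f: "star_hom_on UNIV f \<and> continuous_on UNIV f \<and> f a = a' \<and> f b = b' \<and> f D = D'"
    and g: "star_hom_on UNIV g \<and> continuous_on UNIV g \<and> g a = a' \<and> g b = b' \<and> g D = D'"
  have "star_subalgebra {x. f x = g x}"
    using f g by (simp add: star_subalgebra_def star_hom_on_def)
  then have "?S \<subseteq> {x. f x = g x}"
    unfolding O_Uq2_def using f g by (intro hull_minimal) simp_all
  then have "f (?ev y) = g (?ev y)" for y
    using range_free_eval[of a b D] by blast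
  then have "f x = g x" for x
    using dense1[of f g x] f g by blast
  then show "f = g" by blast
qed

text \<open>
  This is the comultiplication of O(U_q(2)), which takes values in the algebraic tensor
  product; the values of \<^term>\<open>\<Delta>\<close> outside O(U_q(2)) are irrelevant.
\<close>

definition is_comultiplication ::
  "complex \<Rightarrow> 'a::complex_star_algebra \<Rightarrow> 'a \<Rightarrow> 'a \<Rightarrow> ('a \<Rightarrow> ('a, 'a) tensor) \<Rightarrow> bool" where
  "is_comultiplication q a b D \<Delta> \<longleftrightarrow>
     star_hom_on (O_Uq2 a b D) \<Delta> \<and>
     \<Delta> a = a \<otimes> a - cnj q *\<^sub>C (b \<otimes> (D * b\<^sup>\<star>)) \<and>
     \<Delta> b = a \<otimes> b + b \<otimes> (D * a\<^sup>\<star>) \<and>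
     \<Delta> D = D \<otimes> D"


section \<open>q-analogues, little q-Jacobi polynomials and matrix coefficients\<close>

definition qpoch :: "'a::field \<Rightarrow> 'a \<Rightarrow> nat \<Rightarrow> 'a" where
  "qpoch \<alpha> s n = (\<Prod>r<n. 1 - \<alpha> * s ^ r)"

definition qbinom :: "nat \<Rightarrow> nat \<Rightarrow> 'a::field \<Rightarrow> 'a" where
  "qbinom n m s = qpoch s s n / (qpoch s s m * qpoch s s (n - m))"

text \<open>
  The basic hypergeometric series terminates: for 0 < p < 1 the terms with r > n vanish.  The
  argument may be an element of any real algebra.
\<close>

definition little_qJacobi :: "nat \<Rightarrow> real \<Rightarrow> real \<Rightarrow> real \<Rightarrow> 'a::real_algebra_1 \<Rightarrow> 'a" where
  "little_qJacobi n \<alpha> \<beta> p z =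
     (\<Sum>r\<le>n. (qpoch (p powr (- real n)) p r * qpoch (p powr (\<alpha> + \<beta> + real n + 1)) p r /
             (qpoch p p r * qpoch (p powr (\<alpha> + 1)) p r)) *\<^sub>R (p *\<^sub>R z) ^ r)"

definition half_nats :: "real set" where
  "half_nats = {l. \<exists>n::nat. l = real n / 2}"

definition I_set :: "real \<Rightarrow> real set" where
  "I_set l = {- l + real m | m. real m \<le> 2 * l}"

text \<open>
  Half-integers are modelled as reals; this conversion is applied only to reals that are natural
  numbers, such as l + j for j in I_l, so that nothing is rounded.
\<close>

abbreviation nat_of :: "real \<Rightarrow> nat" where
  "nat_of x \<equiv> nat \<lfloor>x\<rfloor>"

definition sqrt_binom :: "complex \<Rightarrow> real \<Rightarrow> real \<Rightarrow> real" where
  "sqrt_binom q l j = sqrt (qbinom (nat_of (2 * l)) (nat_of (l + j)) ((cmod q)\<^sup>2))"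

definition V_basis ::
  "complex \<Rightarrow> 'a::complex_star_algebra \<Rightarrow> 'a \<Rightarrow> real \<Rightarrow> real \<Rightarrow> 'a" where
  "V_basis q a b l j =
     complex_of_real (sqrt_binom q l j) *\<^sub>C
     (a ^ nat_of (l - j) * b ^ nat_of (l + j))"

definition is_matrix_coeffs ::
  "complex \<Rightarrow> 'a::complex_star_algebra \<Rightarrow> 'a \<Rightarrow> 'a \<Rightarrow> ('a \<Rightarrow> ('a, 'a) tensor) \<Rightarrow>
   real \<Rightarrow> (real \<Rightarrow> real \<Rightarrow> 'a) \<Rightarrow> bool" where
  "is_matrix_coeffs q a b D \<Delta> l t \<longleftrightarrow>
     (\<forall>i\<in>I_set l. \<forall>j\<in>I_set l. t i j \<in> O_Uq2 a b D) \<and>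
     (\<forall>j\<in>I_set l. \<Delta> (V_basis q a b l j) = (\<Sum>i\<in>I_set l. V_basis q a b l i \<otimes> t i j))"

end

theory Submission
  imports Defs
begin

text \<open>
  With d = D a* the comultiplication reads a |-> a (x) a + b (x) c and b |-> a (x) b + b (x) d. In both
  sums the two terms p-commute for p = |q|^2, so the q-binomial theorem writes the coefficient of
  a^(2l-R) b^R in the image of a^N b^M as a sum of monomials a^(N-r) c^r b^(M-R+r) d^(R-r).
  Reordering each monomial leaves a fixed monomial times x^r a^e (a*)^e with x = b b*, and a^e (a*)^e
  is an explicit polynomial in x. Comparing coefficients of x^k with those of the little q-Jacobi
  polynomial is exactly the q-Vandermonde identity.

  Reading off the coefficients requires the monomials a^(n-m) b^m to be linearly independent. This is
  seen in a representation by weighted shifts on finitely supported functions of (k,s), where a raises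
  k, b is diagonal and D shifts s: it sends e(0,0) under a^(n-m) b^m to a nonzero multiple of e(n-m,0).
  The operator norm of this representation is one of the C*-seminorms that bound the universal norm
  from below.
\<close>

text \<open>With N = l-j, M = l+j and R = l+i, each of the four sign cases is re-expressed through
  naturals n, f = |i-j|, g = |i+j|, where n is the degree of the polynomial. The four coefficients
  then reduce to only two sums, one with surplus b^f (i <= j) and one with surplus c^f (i >= j). Two
  cases match these sums directly, the other two up to a ratio that is free of the summation index.

  Every reordering costs powers of q and of cnj q separately. They balance because 2(0+...+r) = r^2
  + r, and apart from a sign all but q^(-fn) or cnj q^(-fn) collapses to powers of p.

  The finitely supported vectors form an incomplete space, so a bounded operator need not have an
  adjoint there and the operators form no C*-algebra: \<open>universal_Uq2_hom\<close> cannot be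
  applied to them. The seminorm clause of \<open>universal_Uq2\<close> asks only for a C*-seminorm
  on the free algebra, and operators stored with their adjoints provide one. The coordinate s is
  there because b D = (q/cnj q) D b makes b pick up a phase whenever D acts.\<close>

section \<open>Gaussian binomial coefficients\<close>

text \<open>Unlike \<^const>\<open>qbinom\<close>, this vanishes for m > n.\<close>

fun gauss :: "'a::field \<Rightarrow> nat \<Rightarrow> nat \<Rightarrow> 'a" where
  "gauss p n 0 = 1"
| "gauss p 0 (Suc m) = 0"
| "gauss p (Suc n) (Suc m) = gauss p n m + p ^ Suc m * gauss p n (Suc m)"

lemma gauss_eq_0: "n < m \<Longrightarrow> gauss p n m = 0"
  by (induction p n m rule: gauss.induct) auto

lemma gauss_self: "gauss p n n = 1"
  by (induction n) (auto simp: gauss_eq_0)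

lemma qpoch_Suc: "qpoch \<alpha> s (Suc n) = qpoch \<alpha> s n * (1 - \<alpha> * s ^ n)"
  by (simp add: qpoch_def)

lemma qpoch_pos:
  fixes p :: real
  assumes "0 < p" "p < 1" "0 \<le> \<alpha>" "\<alpha> < 1"
  shows "0 < qpoch \<alpha> p n"
  unfolding qpoch_def
proof (rule prod_pos, safe)
  fix r
  have "\<alpha> * p ^ r \<le> \<alpha> * 1"
    using assms by (intro mult_left_mono) (auto simp: power_le_one)
  then show "0 < 1 - \<alpha> * p ^ r" using assms by simp
qed

lemma qpoch_add: "qpoch \<alpha> s (m + n) = qpoch \<alpha> s m * qpoch (\<alpha> * s ^ m) s n"
  by (induction n) (simp_all add: qpoch_Suc power_add mult.assoc, simp add: qpoch_def)

text \<open>The quotient formula for Gaussian coefficients with denominators cleared, so that it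
  holds for every p. Pascal's rule closes the induction because 1 - p^(m+n) = (1 - p^m) + p^m (1 -
  p^n).\<close>

lemma gauss_qpoch: "gauss p (m + n) m * (qpoch p p m * qpoch p p n) = qpoch p p (m + n)"
proof (induction "m + n" arbitrary: m n)
  case 0
  then show ?case by (simp add: qpoch_def)
next
  case (Suc k)
  show ?case
  proof (cases m)
    case 0
    then show ?thesis by (simp add: qpoch_def)
  next
    case m: (Suc m')
    show ?thesis
    proof (cases n)
      case 0
      then show ?thesis using m gauss_self[of p m] by (simp add: qpoch_def)
    next
      case n: (Suc n')
      have *: "gauss p (m' + n) m' * (qpoch p p m' * qpoch p p n) = qpoch p p (m' + n)"
        using Suc.hyps(1)[of m' n] Suc.hyps(2) m n by simp
      have **: "gauss p (m + n') m * (qpoch p p m * qpoch p p n') = qpoch p p (m + n')"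
        using Suc.hyps(1)[of m n'] Suc.hyps(2) m n by simp
      have "gauss p (m + n) m * (qpoch p p m * qpoch p p n)
          = (1 - p ^ Suc m') * (gauss p (m' + n) m' * (qpoch p p m' * qpoch p p n))
          + p ^ Suc m' * (1 - p ^ n) * (gauss p (m + n') m * (qpoch p p m * qpoch p p n'))"
        using m n by (simp add: qpoch_Suc algebra_simps)
      also have "\<dots> = (1 - p ^ (m + n)) * qpoch p p (m + n')"
        unfolding * ** using m n by (simp add: power_add algebra_simps)
      also have "\<dots> = qpoch p p (m + n)"
        using n by (simp add: qpoch_Suc)
      finally show ?thesis .
    qed
  qed
qed

lemma gauss_eq_qbinom:
  fixes p :: real
  assumes "0 < p" "p < 1" "m \<le> n"
  shows "gauss p n m = qbinom n m p"
proof -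
  have "qpoch p p k \<noteq> 0" for k
    using qpoch_pos[of p p k] assms by simp
  then show ?thesis
    using gauss_qpoch[of p m "n - m"] assms by (simp add: qbinom_def field_simps)
qed

lemma gauss_pos:
  fixes p :: real
  assumes "0 < p" "p < 1" "m \<le> n"
  shows "0 < gauss p n m"
  unfolding gauss_eq_qbinom[OF assms] qbinom_def using assms by (simp add: qpoch_pos)

lemma gauss_symmetric:
  fixes p :: real
  assumes "0 < p" "p < 1" "m \<le> n"
  shows "gauss p n (n - m) = gauss p n m"
  using assms by (simp add: gauss_eq_qbinom qbinom_def mult.commute)

text \<open>Induction on m, applying Pascal's rule to the factor with upper index m. The truncated
  exponent is harmless: for k - r > m the factor \<open>gauss p m (k - r)\<close> is 0.\<close>

lemma q_Vandermonde:
  "(\<Sum>r\<le>k. gauss p n r * gauss p m (k - r) * p ^ (r * (m - (k - r)))) = gauss p (m + n) k"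
proof (induction m arbitrary: k)
  case 0
  have "(\<Sum>r\<le>k. gauss p n r * gauss p 0 (k - r) * p ^ (r * (0 - (k - r))))
      = (\<Sum>r\<in>{k}. gauss p n r)"
    by (rule sum.mono_neutral_cong_right) (auto simp: gauss_eq_0)
  then show ?case by simp
next
  case (Suc m)
  show ?case
  proof (cases k)
    case 0
    then show ?thesis by simp
  next
    case k: (Suc j)
    have split: "gauss p n r * gauss p (Suc m) (k - r) * p ^ (r * (Suc m - (k - r)))
        = gauss p n r * gauss p m (j - r) * p ^ (r * (m - (j - r)))
        + p ^ k * (gauss p n r * gauss p m (k - r) * p ^ (r * (m - (k - r))))"
      if "r \<le> j" for r
    proof -
      have kr: "k - r = Suc (j - r)" using that k by simp
      show ?thesis
      proof (cases "k - r \<le> m")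
        case True
        obtain w where "m = (k - r) + w" using True le_Suc_ex by blast
        moreover obtain v where "k = r + v" using le_Suc_ex[of r k] \<open>r \<le> j\<close> k by (metis le_SucI)
        ultimately have "k + r * (m - (k - r)) = (k - r) + r * (Suc m - (k - r))"
          by (simp add: Suc_diff_le)
        then have "p ^ k * p ^ (r * (m - (k - r))) = p ^ (k - r) * p ^ (r * (Suc m - (k - r)))"
          by (simp flip: power_add)
        then show ?thesis
          using True unfolding kr by (simp add: Suc_diff_le algebra_simps)
      qed (simp add: kr gauss_eq_0)
    qed
    have "(\<Sum>r\<le>k. gauss p n r * gauss p (Suc m) (k - r) * p ^ (r * (Suc m - (k - r))))
        = (\<Sum>r\<le>j. gauss p n r * gauss p m (j - r) * p ^ (r * (m - (j - r))))
        + p ^ k * (\<Sum>r\<le>k. gauss p n r * gauss p m (k - r) * p ^ (r * (m - (k - r))))"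
    proof -
      have "(\<Sum>r\<le>j. gauss p n r * gauss p (Suc m) (k - r) * p ^ (r * (Suc m - (k - r))))
        = (\<Sum>r\<le>j. gauss p n r * gauss p m (j - r) * p ^ (r * (m - (j - r)))
        + p ^ k * (gauss p n r * gauss p m (k - r) * p ^ (r * (m - (k - r)))))"
        by (intro sum.cong refl split) simp
      then have "(\<Sum>r\<le>j. gauss p n r * gauss p (Suc m) (k - r) * p ^ (r * (Suc m - (k - r))))
        = (\<Sum>r\<le>j. gauss p n r * gauss p m (j - r) * p ^ (r * (m - (j - r))))
        + p ^ k * (\<Sum>r\<le>j. gauss p n r * gauss p m (k - r) * p ^ (r * (m - (k - r))))"
        by (simp only: sum.distrib sum_distrib_left)
      \<comment> \<open>The term r = k, outside the range of \<open>split\<close>, has second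
        Gaussian factor 1 on both sides, and p^(k (m+1)) = p^k p^(k m).\<close>
      then show ?thesis
        unfolding k sum.atMost_Suc distrib_left by (simp add: power_add)
    qed
    also have "\<dots> = gauss p (m + n) j + p ^ k * gauss p (m + n) k"
      by (simp only: Suc.IH)
    finally show ?thesis using k by simp
  qed
qed

text \<open>This is (p^(-n);p)_k = (-1)^k p^(k(k-1)/2 - n k) (p;p)_n / (p;p)_(n-k) with denominators
  cleared. \<open>\<Sum>{..k}\<close> is k(k+1)/2, whence the extra p^k on the left.\<close>

lemma qpoch_powr_minus:
  assumes "0 < p" "k \<le> n"
  shows "qpoch (p powr - real n) p k * qpoch p p (n - k) * p ^ (k * n) * p ^ k
    = (- 1) ^ k * p ^ (\<Sum>{..k}) * qpoch p p n"
  using \<open>k \<le> n\<close>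
proof (induction k)
  case 0
  then show ?case by (simp add: qpoch_def)
next
  case (Suc k)
  have n: "n - k = Suc (n - Suc k)" using Suc.prems by simp
  have np: "p powr - real n * p ^ n = 1"
    using assms(1) by (simp add: powr_minus powr_realpow)
  have "p ^ n = p ^ k * p ^ (n - k)"
    using Suc.prems by (simp flip: power_add)
  then have "(1 - p powr - real n * p ^ k) * p ^ n = - (p ^ k) * (1 - p ^ (n - k))"
    using np by (simp add: algebra_simps)
  then have 1: "(1 - p powr - real n * p ^ k) * p ^ n = - (p ^ k) * (1 - p ^ Suc (n - Suc k))"
    by (simp only: n)
  have "qpoch (p powr - real n) p (Suc k) * qpoch p p (n - Suc k) * p ^ (Suc k * n) * p ^ Suc k
     = qpoch (p powr - real n) p k * ((1 - p powr - real n * p ^ k) * p ^ n)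
       * qpoch p p (n - Suc k) * p ^ (k * n) * p ^ k * p"
    by (simp add: qpoch_Suc power_add mult_ac)
  also have "\<dots> = - (p ^ Suc k) * (qpoch (p powr - real n) p k
       * (qpoch p p (n - Suc k) * (1 - p ^ Suc (n - Suc k))) * p ^ (k * n) * p ^ k)"
    unfolding 1 by (simp add: mult_ac)
  also have "qpoch p p (n - Suc k) * (1 - p ^ Suc (n - Suc k)) = qpoch p p (n - k)"
    unfolding n by (simp add: qpoch_Suc)
  finally show ?case using Suc by (simp add: power_add mult_ac)
qed

section \<open>Coefficients of the little q-Jacobi polynomials\<close>

text \<open>The coefficient of x^k in a^e (a*)^e, where x = b b*.\<close>

definition aastar_coeff :: "real \<Rightarrow> nat \<Rightarrow> nat \<Rightarrow> real" where
  "aastar_coeff p e k = (- 1) ^ k * gauss p e k * p ^ (\<Sum>{..k}) / p ^ (k * e)"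

text \<open>
  Up to the factor q^(-fn), the scalar picked up when q^(r(f+r)) a^(n-r) c^r b^(f+r) d^(n-r) is
  reordered to b^f x^r a^(n-r) (a*)^(n-r) D^n.
\<close>

definition reorder_coeff :: "real \<Rightarrow> nat \<Rightarrow> nat \<Rightarrow> nat \<Rightarrow> real" where
  "reorder_coeff p n f r = (- 1) ^ r * p ^ (r * f + r * r + \<Sum>{..r}) / p ^ (n * r)"

text \<open>The coefficient of z^k in the little q-Jacobi polynomial of degree n with parameters f
  and g; the last factor comes from the argument p z of the series.\<close>

definition qJacobi_coeff :: "real \<Rightarrow> nat \<Rightarrow> nat \<Rightarrow> nat \<Rightarrow> nat \<Rightarrow> real" where
  "qJacobi_coeff p n f g k = qpoch (p powr (- real n)) p k *
     qpoch (p powr (real f + real g + real n + 1)) p k /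
     (qpoch p p k * qpoch (p powr (real f + 1)) p k) * p ^ k"

lemma sum_atMost_add: "(\<Sum>{..r + t}) = (\<Sum>{..r}) + (\<Sum>{..t}) + r * t" for r t :: nat
  by (induction t) auto

text \<open>Both sides are the q-multinomial coefficient with lower entries f + r, k - r and n - k.
  On the right r occurs in the second factor only, as q-Vandermonde requires.\<close>

lemma gauss_multinomial:
  fixes p :: real
  assumes "0 < p" "p < 1" "r \<le> k" "k \<le> n"
  shows "gauss p (n + f) (f + r) * gauss p (n - r) (k - r)
    = gauss p (n + f) (n - k) * gauss p (f + k) (k - r)"
proof -
  have "qpoch p p k \<noteq> 0" for k
    using qpoch_pos[of p p k] assms by simp
  moreover have "n + f - (f + r) = n - r" "n - r - (k - r) = n - k"
    "n + f - (n - k) = f + k" "f + k - (k - r) = f + r"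
    using assms by auto
  ultimately show ?thesis
    using assms by (simp add: gauss_eq_qbinom qbinom_def field_simps)
qed

text \<open>The r-th summand contributes to x^k through the coefficient of index k - r in
  \<open>a ^ (n - r) * (a\<^sup>\<star>) ^ (n - r)\<close>. After \<open>gauss_multinomial\<close>
  everything free of r goes into \<open>?C\<close>, and q-Vandermonde with upper indices n + g and f
  + k sums the rest to a single Gaussian coefficient.\<close>

lemma qJacobi_coeff_expansion:
  fixes p :: real
  assumes p: "0 < p" "p < 1" and k: "k \<le> n"
  shows "(\<Sum>r\<le>k. gauss p (n + g) r * gauss p (n + f) (f + r) * reorder_coeff p n f r *
            aastar_coeff p (n - r) (k - r))
    = gauss p (n + f) f * qJacobi_coeff p n f g k"
proof -
  have nz: "qpoch p p k \<noteq> 0" for k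
    using qpoch_pos[of p p k] p by simp
  have nz': "qpoch (p ^ Suc m) p k \<noteq> 0" for m k
    using qpoch_pos[of p "p ^ Suc m" k] p power_Suc_less_one[of p m] by simp
  let ?C = "gauss p (n + f) (n - k) * (- 1) ^ k * p ^ (\<Sum>{..k}) / p ^ (k * n)"
  have "gauss p (n + g) r * gauss p (n + f) (f + r) * reorder_coeff p n f r * aastar_coeff p (n - r) (k - r)
      = ?C * (gauss p (n + g) r * gauss p (f + k) (k - r) * p ^ (r * (f + k - (k - r))))"
    if r: "r \<le> k" for r
  proof -
    obtain t where t: "k = r + t" using r le_Suc_ex by blast
    obtain w where w: "n = r + t + w" using k t le_Suc_ex by blast
    \<comment> \<open>With k = r + t and n = k + w no subtraction truncates. On the right the only
      exponent that depends on r is r (f + r), the Vandermonde exponent for upper index f +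
      k.\<close>
    have pw: "p ^ (r * f + r * r + \<Sum>{..r}) / p ^ (n * r) * (p ^ (\<Sum>{..t}) / p ^ (t * (n - r)))
        = p ^ (\<Sum>{..k}) / p ^ (k * n) * p ^ (r * (f + r))"
      using p unfolding t w
      by (simp add: divide_simps sum_atMost_add flip: power_add) (simp add: algebra_simps)
    have sg: "(- 1 :: real) ^ r * (- 1) ^ t = (- 1) ^ k"
      by (simp add: t power_add)
    have "gauss p (n + g) r * gauss p (n + f) (f + r) * reorder_coeff p n f r * aastar_coeff p (n - r) (k - r)
      = gauss p (n + g) r * (gauss p (n + f) (f + r) * gauss p (n - r) (k - r)) * ((- 1) ^ r * (- 1) ^ t)
        * (p ^ (r * f + r * r + \<Sum>{..r}) / p ^ (n * r) * (p ^ (\<Sum>{..t}) / p ^ (t * (n - r))))"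
      by (simp add: reorder_coeff_def aastar_coeff_def t)
    also have "\<dots> = ?C * (gauss p (n + g) r * gauss p (f + k) (k - r) * p ^ (r * (f + k - (k - r))))"
      unfolding pw sg gauss_multinomial[OF p r k] using r by simp
    finally show ?thesis .
  qed
  then have "(\<Sum>r\<le>k. gauss p (n + g) r * gauss p (n + f) (f + r) * reorder_coeff p n f r *
            aastar_coeff p (n - r) (k - r))
    = ?C * (\<Sum>r\<le>k. gauss p (n + g) r * gauss p (f + k) (k - r) * p ^ (r * (f + k - (k - r))))"
    by (simp add: sum_distrib_left)
  also have "\<dots> = ?C * gauss p (f + k + (n + g)) k"
    by (simp only: q_Vandermonde)
  also have "\<dots> = gauss p (n + f) f * qJacobi_coeff p n f g k"
  proof -
    \<comment> \<open>Origin of the Pochhammer factors: \<open>2\<close> yields the numerator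
      (p^(f+g+n+1);p)_k, \<open>3\<close> the denominator (p^(f+1);p)_k, and \<open>4\<close> turns
      the sign and the powers of p in \<open>?C\<close> into (p^(-n);p)_k.\<close>
    have 1: "p powr (real f + real g + real n + 1) = p * p ^ (f + (n + g))"
      "p powr (real f + 1) = p * p ^ f"
      using p by (simp_all add: powr_realpow powr_add power_add mult_ac)
    have 2: "qpoch p p (f + k + (n + g)) = qpoch p p (f + (n + g)) * qpoch (p * p ^ (f + (n + g))) p k"
      using qpoch_add[of p p "f + (n + g)" k] by (simp add: add_ac)
    have 3: "qpoch p p (f + k) = qpoch p p f * qpoch (p * p ^ f) p k"
      by (rule qpoch_add)
    have 4: "(- 1) ^ k * p ^ (\<Sum>{..k}) / p ^ (k * n)
        = qpoch (p powr - real n) p k * qpoch p p (n - k) * p ^ k / qpoch p p n"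
      using qpoch_powr_minus[OF p(1) k] p nz by (simp add: field_simps)
    have 5: "gauss p (n + f) (n - k) = qpoch p p (n + f) / (qpoch p p (n - k) * qpoch p p (f + k))"
      "gauss p (n + f) f = qpoch p p (n + f) / (qpoch p p f * qpoch p p n)"
      "gauss p (f + k + (n + g)) k
        = qpoch p p (f + k + (n + g)) / (qpoch p p k * qpoch p p (f + (n + g)))"
      using p k by (simp_all add: gauss_eq_qbinom qbinom_def add_ac)
    have "?C * gauss p (f + k + (n + g)) k
      = gauss p (n + f) (n - k) * ((- 1) ^ k * p ^ (\<Sum>{..k}) / p ^ (k * n)) * gauss p (f + k + (n + g)) k"
      by simp
    also have "\<dots> = gauss p (n + f) f * qJacobi_coeff p n f g k"
      unfolding 4 5 2 3 qJacobi_coeff_def 1 using nz nz' by (simp add: field_simps)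
    finally show ?thesis .
  qed
  finally show ?thesis .
qed

section \<open>Quasi-commuting elements\<close>

lemma scaleC_power: "(s *\<^sub>C (x::'a::complex_star_algebra)) ^ n = s ^ n *\<^sub>C x ^ n"
  by (induction n) (simp_all add: scaleC_one scaleC_mult_left scaleC_mult_right scaleC_scaleC mult_ac)

lemma quasi_commute_power_right:
  fixes x y :: "'a::complex_star_algebra"
  assumes "y * x = s *\<^sub>C (x * y)"
  shows "y * x ^ n = s ^ n *\<^sub>C (x ^ n * y)"
proof (induction n)
  case (Suc n)
  have "y * x ^ Suc n = (y * x) * x ^ n" by (simp add: mult.assoc)
  also have "\<dots> = s *\<^sub>C (x * (y * x ^ n))"
    by (simp add: assms scaleC_mult_left mult.assoc)
  finally show ?case
    by (simp add: Suc scaleC_mult_right scaleC_scaleC mult.assoc)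
qed (simp add: scaleC_one)

lemma quasi_commute_power:
  fixes x y :: "'a::complex_star_algebra"
  assumes "y * x = s *\<^sub>C (x * y)"
  shows "y ^ m * x ^ n = s ^ (m * n) *\<^sub>C (x ^ n * y ^ m)"
proof (induction m)
  case (Suc m)
  have "y ^ Suc m * x ^ n = y * (y ^ m * x ^ n)" by (simp add: mult.assoc)
  also have "\<dots> = s ^ (m * n) *\<^sub>C ((y * x ^ n) * y ^ m)"
    by (simp add: Suc scaleC_mult_right mult.assoc)
  also have "\<dots> = s ^ (Suc m * n) *\<^sub>C (x ^ n * y ^ Suc m)"
    by (simp add: quasi_commute_power_right[OF assms] scaleC_mult_left scaleC_scaleC power_add
        mult.assoc mult.commute)
  finally show ?case .
qed (simp add: scaleC_one)

lemma quasi_commute_swap: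
  fixes x y :: "'a::complex_star_algebra"
  assumes "y * x = s *\<^sub>C (x * y)" "s \<noteq> 0"
  shows "x * y = inverse s *\<^sub>C (y * x)"
  by (simp add: assms scaleC_scaleC scaleC_one)

lemma commute_power:
  fixes x y :: "'a::monoid_mult"
  assumes "y * x = x * y"
  shows "y ^ m * x ^ n = x ^ n * y ^ m"
proof -
  have *: "u * v ^ n = v ^ n * u" if "u * v = v * u" for u v :: 'a and n
    using power_commuting_commutes[OF that[symmetric], of n] by simp
  show ?thesis
    using *[of "y ^ m" x n] *[of x y m] assms by metis
qed

text \<open>In (X + Y)^n (X + Y) the last X must pass Y^r at the cost p^r, so the coefficients obey
  exactly the recursion that defines \<open>gauss\<close>.\<close>

lemma q_binomial_theorem:
  fixes X Y :: "'a::complex_star_algebra"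
  assumes "Y * X = p *\<^sub>C (X * Y)"
  shows "(X + Y) ^ n = (\<Sum>r\<le>n. gauss p n r *\<^sub>C (X ^ (n - r) * Y ^ r))"
proof (induction n)
  case 0
  then show ?case by (simp add: scaleC_one)
next
  case (Suc n)
  have X: "(gauss p n r *\<^sub>C (X ^ (n - r) * Y ^ r)) * X
      = (p ^ r * gauss p n r) *\<^sub>C (X ^ (Suc n - r) * Y ^ r)" if "r \<le> n" for r
  proof -
    have "Y ^ r * X = p ^ r *\<^sub>C (X * Y ^ r)"
      using quasi_commute_power[OF assms, of r 1] by simp
    then have "(X ^ (n - r) * Y ^ r) * X = p ^ r *\<^sub>C (X ^ (n - r) * X * Y ^ r)"
      by (simp add: mult.assoc scaleC_mult_right)
    then show ?thesis
      using that
      by (simp add: scaleC_mult_left scaleC_scaleC Suc_diff_le power_commutes mult.commute)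
  qed
  have Y: "(gauss p n r *\<^sub>C (X ^ (n - r) * Y ^ r)) * Y
      = gauss p n r *\<^sub>C (X ^ (n - r) * Y ^ Suc r)" for r
    by (simp add: scaleC_mult_left mult.assoc power_commutes)
  have "(X + Y) ^ Suc n = (X + Y) ^ n * (X + Y)" by (simp add: power_commutes)
  also have "\<dots> = (\<Sum>r\<le>n. (p ^ r * gauss p n r) *\<^sub>C (X ^ (Suc n - r) * Y ^ r))
      + (\<Sum>r\<le>n. gauss p n r *\<^sub>C (X ^ (n - r) * Y ^ Suc r))"
    by (simp add: Suc distrib_left sum_distrib_right X Y)
  \<comment> \<open>\<open>gauss p n (Suc n) = 0\<close> lets this sum run to n + 1; splitting off r
    = 0 then aligns it with the other sum.\<close>
  also have "(\<Sum>r\<le>n. (p ^ r * gauss p n r) *\<^sub>C (X ^ (Suc n - r) * Y ^ r))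
      = (\<Sum>r\<le>Suc n. (p ^ r * gauss p n r) *\<^sub>C (X ^ (Suc n - r) * Y ^ r))"
    by (simp add: gauss_eq_0)
  also have "\<dots> = X ^ Suc n
      + (\<Sum>r\<le>n. (p ^ Suc r * gauss p n (Suc r)) *\<^sub>C (X ^ (n - r) * Y ^ Suc r))"
    by (subst sum.atMost_Suc_shift) (simp add: scaleC_one)
  also have "\<dots> + (\<Sum>r\<le>n. gauss p n r *\<^sub>C (X ^ (n - r) * Y ^ Suc r))
      = X ^ Suc n + (\<Sum>r\<le>n. gauss p (Suc n) (Suc r) *\<^sub>C (X ^ (n - r) * Y ^ Suc r))"
    by (simp add: scaleC_add_left sum.distrib add_ac)
  also have "\<dots> = (\<Sum>r\<le>Suc n. gauss p (Suc n) r *\<^sub>C (X ^ (Suc n - r) * Y ^ r))"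
    by (subst sum.atMost_Suc_shift) (simp add: scaleC_one)
  finally show ?case .
qed

lemma of_real_gauss: "gauss (complex_of_real p) n m = complex_of_real (gauss p n m)"
  by (induction p n m rule: gauss.induct) auto

section \<open>Monomials in the matrix entries\<close>

lemma sum_atMost_double: "2 * (\<Sum>{..r}) = r * r + r" for r :: nat
  by (induction r) auto

text \<open>For s = cnj q and n = r + e the left side collects all scalars of the reordering in
  \<open>monomial_b\<close>. Once q^(2(0 + ... + r)) is replaced by q^(r^2 + r), everything but the
  sign and q^(-f n) is a power of p = q s.\<close>

lemma reorder_scalar_b:
  fixes q s :: complex
  assumes "q \<noteq> 0" "s \<noteq> 0"
  shows "q ^ (r * (f + r)) * (inverse s ^ (e * r) * inverse q ^ (e * (f + r))) *
       ((s / q) ^ (r * f) * ((- q) ^ r * (s / q) ^ (\<Sum>{..r})))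
    = (- 1) ^ r * (q * s) ^ (r * f + r * r + \<Sum>{..r}) / (q * s) ^ ((r + e) * r) / q ^ (f * (r + e))"
proof -
  have "q ^ (2 * (\<Sum>{..r})) = q ^ (r * r + r)"
    by (simp only: sum_atMost_double)
  then have "q ^ (\<Sum>{..r}) * q ^ (\<Sum>{..r}) = q ^ (r * r) * q ^ r"
    by (simp add: power_add mult_2)
  then show ?thesis
    using assms
    by (simp add: power_minus[of q r] power_mult_distrib power_divide power_add power_inverse
        distrib_left distrib_right divide_simps) (simp add: mult_ac power_commutes)
qed

text \<open>The same bookkeeping for \<open>monomial_c\<close>. There f sits in the exponent of c,
  so the factor left over is a power of s = cnj q.\<close>

lemma reorder_scalar_c:
  fixes q s :: complex
  assumes "q \<noteq> 0" "s \<noteq> 0"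
  shows "q ^ (r * (f + r)) * (inverse s ^ (e * (f + r)) * inverse q ^ (e * r)) *
       ((- q) ^ r * (s / q) ^ (\<Sum>{..r}))
    = (- 1) ^ r * (q * s) ^ (r * f + r * r + \<Sum>{..r}) / (q * s) ^ ((r + e) * r) / s ^ (f * (r + e))"
proof -
  have "q ^ (2 * (\<Sum>{..r})) = q ^ (r * r + r)"
    by (simp only: sum_atMost_double)
  then have "q ^ (\<Sum>{..r}) * q ^ (\<Sum>{..r}) = q ^ (r * r) * q ^ r"
    by (simp add: power_add mult_2)
  then show ?thesis
    using assms
    by (simp add: power_minus[of q r] power_mult_distrib power_divide power_add power_inverse
        distrib_left distrib_right divide_simps) (simp add: mult_ac power_commutes)
qed

lemma of_real_reorder_coeff: "complex_of_real (reorder_coeff s n f r)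
    = (- 1) ^ r * complex_of_real s ^ (r * f + r * r + \<Sum>{..r}) / complex_of_real s ^ (n * r)"
  by (simp add: reorder_coeff_def)

locale Uq2_relations =
  fixes q :: complex and a b D :: "'a::complex_star_algebra"
  assumes q_nz: "q \<noteq> 0"
    and relators: "\<forall>r\<in>Uq2_relators q a b D. r = 0"
begin

abbreviation p :: real where "p \<equiv> (cmod q)\<^sup>2"

definition c :: 'a where "c = - (cnj q *\<^sub>C (D * b\<^sup>\<star>))"
definition d :: 'a where "d = D * a\<^sup>\<star>"
definition x :: 'a where "x = b * b\<^sup>\<star>"

lemma p_eq: "complex_of_real p = q * cnj q"
  by (rule complex_norm_square)

lemma cnj_q_nz: "cnj q \<noteq> 0"
  using q_nz by simp

lemma b_a: "b * a = q *\<^sub>C (a * b)"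
  and astar_b: "a\<^sup>\<star> * b = q *\<^sub>C (b * a\<^sup>\<star>)"
  and b_bstar: "b\<^sup>\<star> * b = x"
  and a_astar: "a * a\<^sup>\<star> = 1 - x"
  and D_a: "D * a = a * D"
  and b_D: "b * D = (q / cnj q) *\<^sub>C (D * b)"
  and D_Dstar: "D * D\<^sup>\<star> = 1" "D\<^sup>\<star> * D = 1"
proof -
  have "q\<^sup>2 / (complex_of_real (cmod q))\<^sup>2 = q / cnj q"
    using q_nz p_eq by (simp add: power2_eq_square)
  then show "b * a = q *\<^sub>C (a * b)" "a\<^sup>\<star> * b = q *\<^sub>C (b * a\<^sup>\<star>)" "b\<^sup>\<star> * b = x"
    "a * a\<^sup>\<star> = 1 - x" "D * a = a * D" "b * D = (q / cnj q) *\<^sub>C (D * b)"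
    "D * D\<^sup>\<star> = 1" "D\<^sup>\<star> * D = 1"
    using relators by (auto simp: Uq2_relators_def x_def algebra_simps)
qed

lemma bstar_a: "b\<^sup>\<star> * a = cnj q *\<^sub>C (a * b\<^sup>\<star>)"
  using arg_cong[OF astar_b, of star] by (simp add: star_mult star_star star_scaleC)

lemma astar_bstar: "a\<^sup>\<star> * b\<^sup>\<star> = cnj q *\<^sub>C (b\<^sup>\<star> * a\<^sup>\<star>)"
  using arg_cong[OF b_a, of star] by (simp add: star_mult star_scaleC)

text \<open>D is unitary, so an element that commutes with D also commutes with its adjoint; taking
  adjoints gives the claim.\<close>

lemma D_astar: "D * a\<^sup>\<star> = a\<^sup>\<star> * D"
proof -
  have "D\<^sup>\<star> * (D * a) * D\<^sup>\<star> = D\<^sup>\<star> * (a * D) * D\<^sup>\<star>" by (simp only: D_a)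
  then have "a * D\<^sup>\<star> = D\<^sup>\<star> * a"
    by (metis D_Dstar mult.assoc mult.left_neutral mult.right_neutral)
  from arg_cong[OF this, of star] show ?thesis by (simp add: star_mult star_star)
qed

lemma D_b: "D * b = (cnj q / q) *\<^sub>C (b * D)"
  using quasi_commute_swap[OF b_D] q_nz by simp

lemma bstar_D: "b\<^sup>\<star> * D = (cnj q / q) *\<^sub>C (D * b\<^sup>\<star>)"
proof -
  have "D\<^sup>\<star> * b\<^sup>\<star> = (cnj q / q) *\<^sub>C (b\<^sup>\<star> * D\<^sup>\<star>)"
    using arg_cong[OF b_D, of star] by (simp add: star_mult star_scaleC)
  then have "D * (D\<^sup>\<star> * b\<^sup>\<star>) * D = (cnj q / q) *\<^sub>C (D * (b\<^sup>\<star> * D\<^sup>\<star>) * D)"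
    by (simp add: scaleC_mult_left scaleC_mult_right)
  then show ?thesis
    by (metis D_Dstar mult.assoc mult.left_neutral mult.right_neutral)
qed

lemma x_D: "x * D = D * x"
  using q_nz unfolding x_def mult.assoc bstar_D scaleC_mult_right
  by (simp add: b_D scaleC_mult_left scaleC_scaleC flip: mult.assoc)

lemma x_b: "x * b = b * x"
  by (metis b_bstar mult.assoc x_def)

lemma a_x: "a * x = inverse (complex_of_real p) *\<^sub>C (x * a)"
proof -
  have "x * a = (q * cnj q) *\<^sub>C (a * x)"
    unfolding x_def by (simp add: bstar_a scaleC_mult_right mult.assoc)
      (simp add: b_a scaleC_mult_left scaleC_scaleC mult.commute flip: mult.assoc)
  from quasi_commute_swap[OF this] show ?thesis
    using q_nz unfolding p_eq by simp
qed

lemma a_b: "a * b = inverse q *\<^sub>C (b * a)"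
  using quasi_commute_swap[OF b_a q_nz] .

lemma c_a: "c * a = cnj q *\<^sub>C (a * c)"
proof -
  have "D * b\<^sup>\<star> * a = cnj q *\<^sub>C (a * (D * b\<^sup>\<star>))"
    by (simp add: mult.assoc bstar_a scaleC_mult_right) (simp add: D_a flip: mult.assoc)
  then show ?thesis
    by (simp add: c_def scaleC_mult_left scaleC_mult_right scaleC_scaleC)
qed

lemma a_c: "a * c = inverse (cnj q) *\<^sub>C (c * a)"
  using quasi_commute_swap[OF c_a cnj_q_nz] .

lemma c_astar: "c * a\<^sup>\<star> = inverse (cnj q) *\<^sub>C (a\<^sup>\<star> * c)"
proof -
  have "a\<^sup>\<star> * (D * b\<^sup>\<star>) = cnj q *\<^sub>C (D * b\<^sup>\<star> * a\<^sup>\<star>)"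
    by (simp add: D_astar[symmetric] flip: mult.assoc)
      (simp add: astar_bstar scaleC_mult_right mult.assoc)
  then show ?thesis
    using q_nz by (simp add: c_def scaleC_mult_left scaleC_mult_right scaleC_scaleC)
qed

lemma b_astar: "b * a\<^sup>\<star> = inverse q *\<^sub>C (a\<^sup>\<star> * b)"
  using quasi_commute_swap[OF astar_b q_nz] .

lemma c_b: "c * b = (cnj q / q) *\<^sub>C (b * c)"
proof -
  have "D * b\<^sup>\<star> * b = D * b * b\<^sup>\<star>"
    by (simp add: mult.assoc b_bstar) (simp add: x_def)
  then have "D * b\<^sup>\<star> * b = (cnj q / q) *\<^sub>C (b * (D * b\<^sup>\<star>))"
    by (simp add: D_b scaleC_mult_left mult.assoc)
  then show ?thesis
    by (simp add: c_def scaleC_mult_left scaleC_mult_right scaleC_scaleC mult_ac)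
qed

lemma c_b_x: "c * b = - cnj q *\<^sub>C (x * D)"
  by (simp add: c_def scaleC_mult_left mult.assoc b_bstar x_D)

lemma d_b: "d * b = cnj q *\<^sub>C (b * d)"
proof -
  have "d * b = q *\<^sub>C (D * b * a\<^sup>\<star>)"
    by (simp add: d_def mult.assoc astar_b scaleC_mult_right)
  then show ?thesis
    using q_nz by (simp add: D_b d_def scaleC_mult_left scaleC_scaleC mult.assoc)
qed

lemma d_power: "d ^ e = D ^ e * (a\<^sup>\<star>) ^ e" "d ^ e = (a\<^sup>\<star>) ^ e * D ^ e"
proof -
  show *: "d ^ e = D ^ e * (a\<^sup>\<star>) ^ e" for e
  proof (induction e)
    case (Suc e)
    have "d ^ Suc e = d * (D ^ e * (a\<^sup>\<star>) ^ e)"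
      by (simp add: Suc)
    also have "\<dots> = D * (a\<^sup>\<star> * D ^ e) * (a\<^sup>\<star>) ^ e"
      by (simp add: d_def mult.assoc)
    also have "a\<^sup>\<star> * D ^ e = D ^ e * a\<^sup>\<star>"
      using commute_power[of "a\<^sup>\<star>" D 1 e] D_astar by simp
    finally show ?case by (simp add: mult.assoc)
  qed simp
  show "d ^ e = (a\<^sup>\<star>) ^ e * D ^ e"
    using * commute_power[of D "a\<^sup>\<star>" e e] D_astar by simp
qed

text \<open>The innermost \<open>a * a\<^sup>\<star>\<close> is 1 - x, and moving x to the left
  through a^e costs p^(-e). So the left side is the product of 1 - p^(-i) x over i < e, and the
  right side is its q-binomial expansion.\<close>

lemma a_astar_power:
  "a ^ e * (a\<^sup>\<star>) ^ e = (\<Sum>k\<le>e. complex_of_real (aastar_coeff p e k) *\<^sub>C x ^ k)"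
proof (induction e)
  case 0
  then show ?case by (simp add: aastar_coeff_def scaleC_one)
next
  case (Suc e)
  have p_nz: "p \<noteq> 0" using q_nz by simp
  have coeff: "aastar_coeff p (Suc e) (Suc k)
      = aastar_coeff p e (Suc k) - inverse p ^ e * aastar_coeff p e k" for k
    using p_nz by (simp add: aastar_coeff_def field_simps power_add)
  have "a ^ e * x = inverse (complex_of_real p) ^ e *\<^sub>C (x * a ^ e)"
    using quasi_commute_power[OF a_x, of e 1] by simp
  then have "a ^ Suc e * (a\<^sup>\<star>) ^ Suc e
    = a ^ e * (a\<^sup>\<star>) ^ e - inverse (complex_of_real p) ^ e *\<^sub>C (x * (a ^ e * (a\<^sup>\<star>) ^ e))"
  proof -
    have "a ^ Suc e * (a\<^sup>\<star>) ^ Suc e = a ^ e * (a * a\<^sup>\<star>) * (a\<^sup>\<star>) ^ e"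
      by (simp add: mult.assoc power_commutes[of a, symmetric])
    also have "\<dots> = a ^ e * (a\<^sup>\<star>) ^ e - (a ^ e * x) * (a\<^sup>\<star>) ^ e"
      by (simp add: a_astar algebra_simps)
    finally show ?thesis
      by (simp add: \<open>a ^ e * x = _\<close> scaleC_mult_left mult.assoc)
  qed
  also have "inverse (complex_of_real p) ^ e *\<^sub>C (x * (a ^ e * (a\<^sup>\<star>) ^ e))
    = (\<Sum>k\<le>e. complex_of_real (inverse p ^ e * aastar_coeff p e k) *\<^sub>C x ^ Suc k)"
    by (simp add: Suc sum_distrib_left complex_vector.scale_sum_right scaleC_mult_right scaleC_scaleC)
  also have "a ^ e * (a\<^sup>\<star>) ^ e = (\<Sum>k\<le>Suc e. complex_of_real (aastar_coeff p e k) *\<^sub>C x ^ k)"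
    using Suc by (simp add: aastar_coeff_def gauss_eq_0)
  also have "\<dots> = 1 + (\<Sum>k\<le>e. complex_of_real (aastar_coeff p e (Suc k)) *\<^sub>C x ^ Suc k)"
    by (subst sum.atMost_Suc_shift) (simp add: aastar_coeff_def scaleC_one)
  also have "\<dots> - (\<Sum>k\<le>e. complex_of_real (inverse p ^ e * aastar_coeff p e k) *\<^sub>C x ^ Suc k)
    = 1 + (\<Sum>k\<le>e. complex_of_real (aastar_coeff p (Suc e) (Suc k)) *\<^sub>C x ^ Suc k)"
    by (simp only: coeff of_real_diff complex_vector.scale_left_diff_distrib sum_subtractf) simp
  also have "\<dots> = (\<Sum>k\<le>Suc e. complex_of_real (aastar_coeff p (Suc e) k) *\<^sub>C x ^ k)"
    by (subst sum.atMost_Suc_shift) (simp add: aastar_coeff_def scaleC_one)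
  finally show ?case .
qed

text \<open>The innermost c b is -cnj q x D, and D passes b^r at the cost (cnj q / q)^r. Since -cnj
  q = (-q)(cnj q / q), the step from r to r + 1 adds r + 1 to the exponent of cnj q / q.\<close>

lemma c_power_b_power:
  "c ^ r * b ^ r = ((- q) ^ r * (cnj q / q) ^ (\<Sum>{..r})) *\<^sub>C (x ^ r * D ^ r)"
proof (induction r)
  case 0
  then show ?case by (simp add: scaleC_one)
next
  case (Suc r)
  have D: "D * b ^ r = (cnj q / q) ^ r *\<^sub>C (b ^ r * D)"
    by (rule quasi_commute_power_right[OF D_b])
  have X: "x * b ^ r = b ^ r * x"
    using commute_power[OF x_b, of 1 r] by simp
  have "c ^ Suc r * b ^ Suc r = c ^ r * (c * b) * b ^ r"
    by (simp add: mult.assoc power_commutes[of c, symmetric])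
  also have "\<dots> = - cnj q *\<^sub>C (c ^ r * (x * (D * b ^ r)))"
    by (simp only: c_b_x) (simp add: scaleC_mult_left scaleC_mult_right mult.assoc)
  also have "x * (D * b ^ r) = (cnj q / q) ^ r *\<^sub>C (b ^ r * (x * D))"
    by (simp add: D scaleC_mult_right X flip: mult.assoc)
  also have "- cnj q *\<^sub>C (c ^ r * (cnj q / q) ^ r *\<^sub>C (b ^ r * (x * D)))
    = (- cnj q * (cnj q / q) ^ r) *\<^sub>C (c ^ r * b ^ r * (x * D))"
    by (simp add: scaleC_mult_right scaleC_scaleC mult.assoc)
  also have "\<dots> = (- cnj q * (cnj q / q) ^ r * ((- q) ^ r * (cnj q / q) ^ (\<Sum>{..r})))
      *\<^sub>C (x ^ r * (D ^ r * x) * D)"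
    by (simp add: Suc scaleC_mult_left scaleC_scaleC mult.assoc)
  also have "D ^ r * x = x * D ^ r"
    using commute_power[OF x_D[symmetric], of r 1] by simp
  also have "x ^ r * (x * D ^ r) * D = x ^ Suc r * D ^ Suc r"
    by (simp add: mult.assoc power_commutes)
      (simp add: mult.assoc[symmetric] power_commutes)
  also have "- cnj q * (cnj q / q) ^ r * ((- q) ^ r * (cnj q / q) ^ (\<Sum>{..r}))
    = (- q) ^ Suc r * (cnj q / q) ^ (\<Sum>{..Suc r})"
    using q_nz by (simp add: power_add)
  finally show ?case .
qed

text \<open>The little q-Jacobi polynomial at x, written with complex scalars because
  \<open>little_qJacobi\<close> expects a real algebra and the locale has only a complex one;
  \<open>little_qJacobi_eq_sum\<close> makes the link.\<close>

definition jacobi :: "nat \<Rightarrow> nat \<Rightarrow> nat \<Rightarrow> 'a" where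
  "jacobi n f g = (\<Sum>k\<le>n. complex_of_real (qJacobi_coeff p n f g k) *\<^sub>C x ^ k)"

lemma D_power_commute:
  "D ^ r * (a ^ e * (a\<^sup>\<star>) ^ e * D ^ e) = a ^ e * (a\<^sup>\<star>) ^ e * D ^ (r + e)"
proof -
  have "D ^ r * (a ^ e * (a\<^sup>\<star>) ^ e * D ^ e) = (D ^ r * a ^ e) * ((a\<^sup>\<star>) ^ e * D ^ e)"
    by (simp only: mult.assoc)
  also have "D ^ r * a ^ e = a ^ e * D ^ r"
    by (rule commute_power[OF D_a])
  also have "a ^ e * D ^ r * ((a\<^sup>\<star>) ^ e * D ^ e) = a ^ e * (D ^ r * (a\<^sup>\<star>) ^ e) * D ^ e"
    by (simp only: mult.assoc)
  also have "D ^ r * (a\<^sup>\<star>) ^ e = (a\<^sup>\<star>) ^ e * D ^ r"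
    by (rule commute_power[OF D_astar])
  finally show ?thesis
    by (simp only: mult.assoc power_add)
qed

text \<open>The powers of a move right until they meet the adjoint powers inside d; c^r passes b^f
  to meet b^r, where \<open>c_power_b_power\<close> applies; D commutes with a and its adjoint and
  goes to the far right. The scalar on the left is the one that occurs in
  \<open>coeff_sum\<close>.\<close>

lemma monomial_b:
  assumes "r \<le> n"
  shows "q ^ (r * (f + r)) *\<^sub>C (a ^ (n - r) * c ^ r * b ^ (f + r) * d ^ (n - r))
    = (complex_of_real (reorder_coeff p n f r) / q ^ (f * n)) *\<^sub>C
      (b ^ f * (x ^ r * (a ^ (n - r) * (a\<^sup>\<star>) ^ (n - r))) * D ^ n)"
proof -
  obtain e where n: "n = r + e" using assms le_Suc_ex by blast
  have 1: "c ^ r * b ^ f = (cnj q / q) ^ (r * f) *\<^sub>C (b ^ f * c ^ r)"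
    by (rule quasi_commute_power[OF c_b])
  have 2: "c ^ r * b ^ (f + r)
    = ((cnj q / q) ^ (r * f) * ((- q) ^ r * (cnj q / q) ^ (\<Sum>{..r}))) *\<^sub>C (b ^ f * (x ^ r * D ^ r))"
    by (simp add: power_add mult.assoc[symmetric] 1 scaleC_mult_left)
      (simp add: mult.assoc c_power_b_power scaleC_mult_right scaleC_scaleC)
  have 3: "a ^ e * c ^ r = inverse (cnj q) ^ (e * r) *\<^sub>C (c ^ r * a ^ e)"
    by (rule quasi_commute_power[OF a_c])
  have 4: "a ^ e * b ^ (f + r) = inverse q ^ (e * (f + r)) *\<^sub>C (b ^ (f + r) * a ^ e)"
    by (rule quasi_commute_power[OF a_b])
  have 5: "D ^ r * (a ^ e * (a\<^sup>\<star>) ^ e * D ^ e) = a ^ e * (a\<^sup>\<star>) ^ e * D ^ n"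
    unfolding n by (rule D_power_commute)
  have "a ^ e * c ^ r * b ^ (f + r) * d ^ e
    = (inverse (cnj q) ^ (e * r) * inverse q ^ (e * (f + r))) *\<^sub>C (c ^ r * b ^ (f + r) * (a ^ e * (a\<^sup>\<star>) ^ e * D ^ e))"
  proof -
    have "a ^ e * c ^ r * b ^ (f + r) * d ^ e
      = inverse (cnj q) ^ (e * r) *\<^sub>C (c ^ r * (a ^ e * b ^ (f + r)) * d ^ e)"
      by (simp add: 3 scaleC_mult_left mult.assoc)
    then show ?thesis
      by (simp add: 4 scaleC_mult_left scaleC_mult_right scaleC_scaleC mult.assoc d_power(2))
  qed
  also have "c ^ r * b ^ (f + r) * (a ^ e * (a\<^sup>\<star>) ^ e * D ^ e)
    = ((cnj q / q) ^ (r * f) * ((- q) ^ r * (cnj q / q) ^ (\<Sum>{..r}))) *\<^sub>C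
      (b ^ f * (x ^ r * (a ^ e * (a\<^sup>\<star>) ^ e)) * D ^ n)"
    unfolding 2 scaleC_mult_left mult.assoc by (simp only: 5[unfolded mult.assoc])
  finally have *: "q ^ (r * (f + r)) *\<^sub>C (a ^ e * c ^ r * b ^ (f + r) * d ^ e)
    = (q ^ (r * (f + r)) * (inverse (cnj q) ^ (e * r) * inverse q ^ (e * (f + r))) *
       ((cnj q / q) ^ (r * f) * ((- q) ^ r * (cnj q / q) ^ (\<Sum>{..r})))) *\<^sub>C
      (b ^ f * (x ^ r * (a ^ e * (a\<^sup>\<star>) ^ e)) * D ^ n)"
    by (simp add: scaleC_scaleC mult.assoc)
  have "q ^ (r * (f + r)) * (inverse (cnj q) ^ (e * r) * inverse q ^ (e * (f + r))) *
       ((cnj q / q) ^ (r * f) * ((- q) ^ r * (cnj q / q) ^ (\<Sum>{..r})))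
    = complex_of_real (reorder_coeff p n f r) / q ^ (f * n)"
    using reorder_scalar_b[OF q_nz cnj_q_nz, of r f e] by (simp only: n of_real_reorder_coeff p_eq)
  with * show ?thesis by (simp add: n)
qed

text \<open>The surplus f sits on c, which already stands to the left of b, so c^r meets b^r without
  an interchange of c and b.\<close>

lemma monomial_c:
  assumes "r \<le> n"
  shows "q ^ (r * (f + r)) *\<^sub>C (a ^ (n - r) * c ^ (f + r) * b ^ r * d ^ (n - r))
    = (complex_of_real (reorder_coeff p n f r) / cnj q ^ (f * n)) *\<^sub>C
      (c ^ f * (x ^ r * (a ^ (n - r) * (a\<^sup>\<star>) ^ (n - r))) * D ^ n)"
proof -
  obtain e where n: "n = r + e" using assms le_Suc_ex by blast
  have 2: "c ^ (f + r) * b ^ r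
    = ((- q) ^ r * (cnj q / q) ^ (\<Sum>{..r})) *\<^sub>C (c ^ f * (x ^ r * D ^ r))"
    by (simp add: power_add mult.assoc c_power_b_power scaleC_mult_right)
  have 3: "a ^ e * c ^ (f + r) = inverse (cnj q) ^ (e * (f + r)) *\<^sub>C (c ^ (f + r) * a ^ e)"
    by (rule quasi_commute_power[OF a_c])
  have 4: "a ^ e * b ^ r = inverse q ^ (e * r) *\<^sub>C (b ^ r * a ^ e)"
    by (rule quasi_commute_power[OF a_b])
  have 5: "D ^ r * (a ^ e * (a\<^sup>\<star>) ^ e * D ^ e) = a ^ e * (a\<^sup>\<star>) ^ e * D ^ n"
    unfolding n by (rule D_power_commute)
  have "a ^ e * c ^ (f + r) * b ^ r * d ^ e
    = (inverse (cnj q) ^ (e * (f + r)) * inverse q ^ (e * r)) *\<^sub>C (c ^ (f + r) * b ^ r * (a ^ e * (a\<^sup>\<star>) ^ e * D ^ e))"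
  proof -
    have "a ^ e * c ^ (f + r) * b ^ r * d ^ e
      = inverse (cnj q) ^ (e * (f + r)) *\<^sub>C (c ^ (f + r) * (a ^ e * b ^ r) * d ^ e)"
      by (simp add: 3 scaleC_mult_left mult.assoc)
    then show ?thesis
      by (simp add: 4 scaleC_mult_left scaleC_mult_right scaleC_scaleC mult.assoc d_power(2))
  qed
  also have "c ^ (f + r) * b ^ r * (a ^ e * (a\<^sup>\<star>) ^ e * D ^ e)
    = ((- q) ^ r * (cnj q / q) ^ (\<Sum>{..r})) *\<^sub>C
      (c ^ f * (x ^ r * (a ^ e * (a\<^sup>\<star>) ^ e)) * D ^ n)"
    unfolding 2 scaleC_mult_left mult.assoc by (simp only: 5[unfolded mult.assoc])
  finally have *: "q ^ (r * (f + r)) *\<^sub>C (a ^ e * c ^ (f + r) * b ^ r * d ^ e)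
    = (q ^ (r * (f + r)) * (inverse (cnj q) ^ (e * (f + r)) * inverse q ^ (e * r)) *
       ((- q) ^ r * (cnj q / q) ^ (\<Sum>{..r}))) *\<^sub>C
      (c ^ f * (x ^ r * (a ^ e * (a\<^sup>\<star>) ^ e)) * D ^ n)"
    by (simp add: scaleC_scaleC mult.assoc)
  have "q ^ (r * (f + r)) * (inverse (cnj q) ^ (e * (f + r)) * inverse q ^ (e * r)) *
       ((- q) ^ r * (cnj q / q) ^ (\<Sum>{..r}))
    = complex_of_real (reorder_coeff p n f r) / cnj q ^ (f * n)"
    using reorder_scalar_c[OF q_nz cnj_q_nz, of r f e] by (simp only: n of_real_reorder_coeff p_eq)
  with * show ?thesis by (simp add: n)
qed

text \<open>Expanding each \<open>a ^ (n - r) * (a\<^sup>\<star>) ^ (n - r)\<close> in powers of x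
  and regrouping by the total exponent k makes the coefficient of x^k the sum in
  \<open>qJacobi_coeff_expansion\<close>.\<close>

lemma sum_qJacobi:
  assumes "cmod q < 1"
  shows "(\<Sum>r\<le>n. complex_of_real (gauss p (n + g) r * gauss p (n + f) (f + r) * reorder_coeff p n f r) *\<^sub>C
      (x ^ r * (a ^ (n - r) * (a\<^sup>\<star>) ^ (n - r)))) = complex_of_real (gauss p (n + f) f) *\<^sub>C jacobi n f g"
proof -
  define w where "w r = gauss p (n + g) r * gauss p (n + f) (f + r) * reorder_coeff p n f r" for r
  have p: "0 < p" "p < 1"
    using q_nz assms by (simp_all add: abs_square_less_1)
  have inner: "x ^ r * (a ^ (n - r) * (a\<^sup>\<star>) ^ (n - r))
      = (\<Sum>k\<le>n - r. complex_of_real (aastar_coeff p (n - r) k) *\<^sub>C x ^ (r + k))" for r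
    by (simp add: a_astar_power sum_distrib_left scaleC_mult_right power_add)
  have "(\<Sum>r\<le>n. complex_of_real (w r) *\<^sub>C (x ^ r * (a ^ (n - r) * (a\<^sup>\<star>) ^ (n - r))))
    = (\<Sum>r\<le>n. \<Sum>k\<le>n - r. complex_of_real (w r * aastar_coeff p (n - r) (r + k - r)) *\<^sub>C x ^ (r + k))"
    by (simp add: inner complex_vector.scale_sum_right scaleC_scaleC)
  also have "\<dots> = (\<Sum>(r, k)\<in>{(r, k). r + k \<le> n}. complex_of_real (w r * aastar_coeff p (n - r) (r + k - r)) *\<^sub>C x ^ (r + k))"
    by (subst sum.Sigma) (auto intro!: sum.cong)
  also have "\<dots> = (\<Sum>k\<le>n. \<Sum>r\<le>k. complex_of_real (w r * aastar_coeff p (n - r) (k - r)) *\<^sub>C x ^ k)"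
    by (subst sum.triangle_reindex_eq) simp
  also have "\<dots> = (\<Sum>k\<le>n. complex_of_real (\<Sum>r\<le>k. w r * aastar_coeff p (n - r) (k - r)) *\<^sub>C x ^ k)"
    by (simp add: complex_vector.scale_sum_left)
  also have "\<dots> = (\<Sum>k\<le>n. complex_of_real (gauss p (n + f) f * qJacobi_coeff p n f g k) *\<^sub>C x ^ k)"
    unfolding w_def by (intro sum.cong refl) (simp only: qJacobi_coeff_expansion[OF p] atMost_iff)
  finally show ?thesis
    by (simp add: w_def jacobi_def complex_vector.scale_sum_right scaleC_scaleC)
qed

text \<open>Normal form of both cases with i <= j: n is the degree, f = j - i the surplus exponent
  of b, and g = |i + j| enters only through one Gaussian coefficient and the second parameter of the
  polynomial.\<close>

lemma sum_b:
  assumes "cmod q < 1"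
  shows "(\<Sum>r\<le>n. complex_of_real (gauss p (n + g) r * gauss p (n + f) (f + r)) *\<^sub>C q ^ (r * (f + r)) *\<^sub>C
      (a ^ (n - r) * c ^ r * b ^ (f + r) * d ^ (n - r)))
    = (complex_of_real (gauss p (n + f) f) / q ^ (f * n)) *\<^sub>C (b ^ f * jacobi n f g * D ^ n)"
proof -
  have "(\<Sum>r\<le>n. complex_of_real (gauss p (n + g) r * gauss p (n + f) (f + r)) *\<^sub>C q ^ (r * (f + r)) *\<^sub>C
      (a ^ (n - r) * c ^ r * b ^ (f + r) * d ^ (n - r)))
    = inverse (q ^ (f * n)) *\<^sub>C (b ^ f * (\<Sum>r\<le>n. complex_of_real (gauss p (n + g) r * gauss p (n + f) (f + r) * reorder_coeff p n f r) *\<^sub>C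
      (x ^ r * (a ^ (n - r) * (a\<^sup>\<star>) ^ (n - r)))) * D ^ n)"
    unfolding sum_distrib_left sum_distrib_right complex_vector.scale_sum_right
    by (intro sum.cong refl, simp only: atMost_iff monomial_b scaleC_mult_left scaleC_mult_right
        scaleC_scaleC of_real_mult divide_inverse) (simp only: mult_ac)
  then show ?thesis
    unfolding sum_qJacobi[OF assms]
    by (simp add: scaleC_mult_left scaleC_mult_right scaleC_scaleC divide_inverse mult.commute)
qed

text \<open>Normal form of both cases with i >= j, where f = i - j is the surplus exponent of
  c.\<close>

lemma sum_c:
  assumes "cmod q < 1"
  shows "(\<Sum>r\<le>n. complex_of_real (gauss p (n + g) r * gauss p (n + f) (f + r)) *\<^sub>C q ^ (r * (f + r)) *\<^sub>C
      (a ^ (n - r) * c ^ (f + r) * b ^ r * d ^ (n - r)))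
    = (complex_of_real (gauss p (n + f) f) / cnj q ^ (f * n)) *\<^sub>C (c ^ f * jacobi n f g * D ^ n)"
proof -
  have "(\<Sum>r\<le>n. complex_of_real (gauss p (n + g) r * gauss p (n + f) (f + r)) *\<^sub>C q ^ (r * (f + r)) *\<^sub>C
      (a ^ (n - r) * c ^ (f + r) * b ^ r * d ^ (n - r)))
    = inverse (cnj q ^ (f * n)) *\<^sub>C (c ^ f * (\<Sum>r\<le>n. complex_of_real (gauss p (n + g) r * gauss p (n + f) (f + r) * reorder_coeff p n f r) *\<^sub>C
      (x ^ r * (a ^ (n - r) * (a\<^sup>\<star>) ^ (n - r)))) * D ^ n)"
    unfolding sum_distrib_left sum_distrib_right complex_vector.scale_sum_right
    by (intro sum.cong refl, simp only: atMost_iff monomial_c scaleC_mult_left scaleC_mult_right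
        scaleC_scaleC of_real_mult divide_inverse) (simp only: mult_ac)
  then show ?thesis
    unfolding sum_qJacobi[OF assms]
    by (simp add: scaleC_mult_left scaleC_mult_right scaleC_scaleC divide_inverse mult.commute)
qed

end

section \<open>Slice maps on the algebraic tensor product\<close>

lemma lookup_scale:
  fixes y :: "'k::star_monoid \<Rightarrow>\<^sub>0 complex"
  shows "Poly_Mapping.lookup (Poly_Mapping.single 0 c * y) w = c * Poly_Mapping.lookup y w"
proof (induction y rule: pm_induct)
  case (add k d y)
  then show ?case
    by (simp only: distrib_left mult_single lookup_add add_0 lookup_single mult_when)
qed simp

text \<open>Linear extension from the basis \<open>mon\<close>. \<open>free_eval\<close> is the
  multiplicative instance \<open>h = eval_word a b D\<close>; slice maps need an h that is not
  multiplicative.\<close>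

definition linear_ext :: "('k::star_monoid \<Rightarrow> 'a::complex_star_algebra) \<Rightarrow> 'k monoid_alg \<Rightarrow> 'a" where
  "linear_ext h z = (\<Sum>w\<in>supp z. coeff_at z w *\<^sub>C h w)"

lemma linear_ext_superset:
  assumes "finite S" "supp z \<subseteq> S"
  shows "linear_ext h z = (\<Sum>w\<in>S. coeff_at z w *\<^sub>C h w)"
  unfolding linear_ext_def using assms
  by (intro sum.mono_neutral_left) (auto simp: supp.rep_eq coeff_at.rep_eq in_keys_iff)

lemma linear_ext_add: "linear_ext h (y + z) = linear_ext h y + linear_ext h z"
proof -
  have "supp (y + z) \<subseteq> supp y \<union> supp z"
    by transfer (rule Poly_Mapping.keys_add)
  moreover have "coeff_at (y + z) w = coeff_at y w + coeff_at z w" for w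
    by transfer (rule lookup_add)
  ultimately show ?thesis
    by (simp add: linear_ext_superset[where S = "supp y \<union> supp z"] finite_supp scaleC_add_left sum.distrib)
qed

lemma linear_ext_scaleC: "linear_ext h (c *\<^sub>C z) = c *\<^sub>C linear_ext h z"
proof -
  have coeff: "coeff_at (c *\<^sub>C z) w = c * coeff_at z w" for w
    by transfer (rule lookup_scale)
  have "supp (c *\<^sub>C z) \<subseteq> supp z"
    by transfer (auto simp: in_keys_iff lookup_scale)
  then show ?thesis
    by (simp add: linear_ext_superset[OF finite_supp] coeff complex_vector.scale_sum_right
          scaleC_scaleC linear_ext_def[of h z])
qed

lemma linear_ext_mon: "linear_ext h (mon w) = h w"
  by (simp add: linear_ext_def supp.rep_eq coeff_at.rep_eq mon.rep_eq scaleC_one)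

lemma linear_ext_diff: "linear_ext h (y - z) = linear_ext h y - linear_ext h z"
  by (metis add_diff_cancel_right' diff_add_cancel linear_ext_add)

text \<open>The slice map, \<phi> on the first leg and the identity on the second. It passes to the
  quotient because the induced map on formal pairs kills every bilinearity relation.\<close>

lemma tensor_slice:
  fixes \<phi> :: "'a::complex_star_algebra \<Rightarrow> complex"
  assumes add: "\<And>u v. \<phi> (u + v) = \<phi> u + \<phi> v" and scale: "\<And>r u. \<phi> (r *\<^sub>C u) = r * \<phi> u"
  obtains L :: "('a, 'b::complex_star_algebra) tensor \<Rightarrow> 'b"
  where "\<And>S T. L (S + T) = L S + L T" "\<And>u v. L (u \<otimes> v) = \<phi> u *\<^sub>C v"
proof -
  define h :: "('a, 'b) tpair \<Rightarrow> 'b" where "h w = (case w of TPair u v \<Rightarrow> \<phi> u *\<^sub>C v)" for w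
  have null: "linear_ext h z = 0" if "z \<in> tensor_null" for z
    using that
  proof (induction rule: complex_vector.span_induct_alt)
    case base
    show ?case using linear_ext_diff[of h 0 0] by simp
  next
    case (step r g z)
    have "linear_ext h g = 0"
      using \<open>g \<in> bilinear_rels\<close>
      by cases
        (simp_all add: linear_ext_diff linear_ext_add linear_ext_scaleC linear_ext_mon h_def add scale
          scaleC_add_left scaleC_add_right scaleC_scaleC mult.commute)
    with step show ?case by (simp add: linear_ext_add linear_ext_scaleC)
  qed
  define L where "L T = linear_ext h (rep_tensor T)" for T
  have L_abs: "L (abs_tensor z) = linear_ext h z" for z
  proof -
    have "tensor_rel (rep_tensor (abs_tensor z)) z"
      by (rule Quotient3_rep_abs[OF Quotient3_tensor equivp_reflp[OF equivp_tensor_rel]])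
    then have "linear_ext h (rep_tensor (abs_tensor z) - z) = 0"
      by (simp add: tensor_rel_def null)
    then show ?thesis by (simp add: L_def linear_ext_diff)
  qed
  show ?thesis
  proof
    show "L (S + T) = L S + L T" for S T
      by (induction S rule: tensor.abs_induct; induction T rule: tensor.abs_induct)
        (simp add: plus_tensor.abs_eq L_abs linear_ext_add)
    show "L (u \<otimes> v) = \<phi> u *\<^sub>C v" for u v
      by (simp add: tensor_of.abs_eq L_abs linear_ext_mon h_def)
  qed
qed

lemma tensor_of_zero_right: "u \<otimes> (0::'b::complex_star_algebra) = 0"
  using tensor_of_add_right[of u 0 "0::'b"] by simp

text \<open>Slicing with a functional that is 1 at \<open>f j\<close> and 0 at every other
  \<open>f i\<close> extracts the coefficient of \<open>f j\<close>. The functional exists because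
  values prescribed on an independent set extend linearly to the whole space.\<close>

lemma tensor_coeffs_unique:
  fixes f :: "'i \<Rightarrow> 'a::complex_star_algebra" and t t' :: "'i \<Rightarrow> 'b::complex_star_algebra"
  assumes "finite I"
    and indep: "\<And>\<gamma>. (\<Sum>i\<in>I. \<gamma> i *\<^sub>C f i) = 0 \<Longrightarrow> \<forall>i\<in>I. \<gamma> i = 0"
    and eq: "(\<Sum>i\<in>I. f i \<otimes> t i) = (\<Sum>i\<in>I. f i \<otimes> t' i)" and j: "j \<in> I"
  shows "t j = t' j"
proof -
  interpret vs: vector_space_pair "scaleC :: complex \<Rightarrow> 'a \<Rightarrow> 'a" "(*) :: complex \<Rightarrow> complex \<Rightarrow> complex"
    by unfold_locales (simp_all add: algebra_simps)
  \<comment> \<open>\<open>independent\<close> refers to the image set, so repetitions in the family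
    are excluded first: coefficients 1 and -1 at a repeated vector would contradict
    \<open>indep\<close>.\<close>
  have inj: "inj_on f I"
  proof (rule inj_onI)
    fix i k assume ik: "i \<in> I" "k \<in> I" "f i = f k"
    show "i = k"
    proof (rule ccontr)
      assume "i \<noteq> k"
      let ?\<gamma> = "\<lambda>m. if m = i then 1 else if m = k then - 1 else (0::complex)"
      have "(\<Sum>m\<in>I. ?\<gamma> m *\<^sub>C f m) = (\<Sum>m\<in>{i, k}. ?\<gamma> m *\<^sub>C f m)"
        using ik \<open>finite I\<close> by (intro sum.mono_neutral_right) auto
      also have "\<dots> = 0" using \<open>i \<noteq> k\<close> ik(3) by (simp add: scaleC_one)
      finally show False using indep[of ?\<gamma>] ik by auto
    qed
  qed
  have "complex_vector.independent (f ` I)"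
    unfolding complex_vector.independent_explicit_module
  proof (intro allI impI)
    fix s u v
    assume s: "finite s" "s \<subseteq> f ` I" and 0: "(\<Sum>v\<in>s. u v *\<^sub>C v) = 0" and v: "v \<in> s"
    obtain J where J: "J \<subseteq> I" "s = f ` J"
      using s subset_image_iff by metis
    have "(\<Sum>i\<in>I. (if i \<in> J then u (f i) else 0) *\<^sub>C f i) = (\<Sum>i\<in>J. u (f i) *\<^sub>C f i)"
      using J \<open>finite I\<close> by (intro sum.mono_neutral_cong_right) auto
    also have "\<dots> = 0"
      using 0 J inj by (simp add: sum.reindex inj_on_subset)
    finally have "\<forall>i\<in>I. (if i \<in> J then u (f i) else 0) = 0" by (rule indep)
    moreover obtain i where "i \<in> J" "v = f i" using v J by blast
    ultimately show "u v = 0" using J by (metis subsetD)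
  qed
  then obtain \<phi> where lin: "Vector_Spaces.linear scaleC (*) \<phi>"
    and \<phi>: "\<forall>v\<in>f ` I. \<phi> v = (if v = f j then 1 else 0)"
    using vs.linear_independent_extend[of "f ` I" "\<lambda>v. if v = f j then 1 else 0"] by blast
  obtain L :: "('a, 'b) tensor \<Rightarrow> 'b"
    where L: "\<And>S T. L (S + T) = L S + L T" "\<And>u v. L (u \<otimes> v) = \<phi> u *\<^sub>C v"
    using tensor_slice[of \<phi>, OF vs.linear_add[OF lin] vs.linear_scale[OF lin]] by blast
  have L0: "L 0 = 0" using L(1)[of 0 0] by simp
  have L_sum: "L (\<Sum>i\<in>I. g i) = (\<Sum>i\<in>I. L (g i))" for g
    using \<open>finite I\<close> by (induction I) (simp_all add: L0 L(1))
  have "L (\<Sum>i\<in>I. f i \<otimes> s i) = s j" for s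
  proof -
    have "L (\<Sum>i\<in>I. f i \<otimes> s i) = (\<Sum>i\<in>I. (if i = j then s i else 0))"
      unfolding L_sum L(2) using \<phi> inj j
      by (intro sum.cong refl) (auto simp: inj_on_eq_iff scaleC_one)
    also have "\<dots> = s j" using j \<open>finite I\<close> by simp
    finally show ?thesis .
  qed
  with eq show ?thesis by metis
qed

section \<open>Comultiplication of monomials\<close>

lemma tensor_of_power: "(u \<otimes> v) ^ n = u ^ n \<otimes> v ^ n"
  by (induction n) (simp_all add: tensor_of_one tensor_of_mult)

lemma tensor_of_sum_right:
  "u \<otimes> (\<Sum>i\<in>I. g i) = (\<Sum>i\<in>I. u \<otimes> (g i :: 'b::complex_star_algebra))"
  by (induction I rule: infinite_finite_induct)
    (simp_all add: tensor_of_zero_right tensor_of_add_right)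

text \<open>Meant for sums whose terms vanish outside the window from f to f + n because a Gaussian
  coefficient does.\<close>

lemma sum_atMost_shift_support:
  fixes h :: "nat \<Rightarrow> 'a::comm_monoid_add"
  assumes "f + n \<le> R" and "\<And>r. r \<le> R \<Longrightarrow> r < f \<or> f + n < r \<Longrightarrow> h r = 0"
  shows "(\<Sum>r\<le>R. h r) = (\<Sum>r\<le>n. h (f + r))"
proof -
  have "(\<Sum>r\<le>R. h r) = (\<Sum>r\<in>{f..f + n}. h r)"
    using assms by (intro sum.mono_neutral_right) auto
  also have "\<dots> = (\<Sum>r\<le>n. h (f + r))"
    by (rule sum.reindex_bij_witness[of _ "\<lambda>r. f + r" "\<lambda>r. r - f"]) auto
  finally show ?thesis .
qed

text \<open>Clear once written in q-factorials. It shows that in two of the four cases the Gaussian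
  weights are those of \<open>sum_b\<close> or \<open>sum_c\<close> times
  \<open>gauss p (n + f + g) f / gauss p (n + f) f\<close>, which is independent of r.\<close>

lemma gauss_product_ratio:
  fixes p :: real
  assumes "0 < p" "p < 1" "r \<le> n"
  shows "gauss p n r * gauss p (n + f + g) (f + r) * gauss p (n + f) f
    = gauss p (n + f + g) f * (gauss p (n + g) r * gauss p (n + f) (f + r))"
proof -
  have "qpoch p p k \<noteq> 0" for k
    using qpoch_pos[of p p k] assms by simp
  moreover have "n + f + g - (f + r) = n + g - r" "n + f - (f + r) = n - r" "n + f + g - f = n + g"
    "n + f - f = n"
    using assms by auto
  ultimately show ?thesis
    using assms by (simp add: gauss_eq_qbinom qbinom_def field_simps)
qed

context Uq2_relations
begin

text \<open>Up to the normalisation of the basis this is t^l_ij for N = l - j, M = l + j, R = l + i.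
  The index r counts the factors \<open>b \<otimes> c\<close> taken from the N-th power, R - r the
  factors \<open>b \<otimes> d\<close> from the M-th; an exponent truncates only where a Gaussian
  coefficient is 0.\<close>

definition coeff_sum :: "nat \<Rightarrow> nat \<Rightarrow> nat \<Rightarrow> 'a" where
  "coeff_sum N M R = (\<Sum>r\<le>R. complex_of_real (gauss p N r * gauss p M (R - r)) *\<^sub>C q ^ (r * (M - (R - r))) *\<^sub>C
      (a ^ (N - r) * c ^ r * b ^ (M - (R - r)) * d ^ (R - r)))"

lemma comult_monomial:
  "(a \<otimes> a + b \<otimes> c) ^ N * (a \<otimes> b + b \<otimes> d) ^ M
    = (\<Sum>R\<le>N + M. (a ^ (N + M - R) * b ^ R) \<otimes> coeff_sum N M R)"
proof -
  define h where "h r s = complex_of_real (gauss p N r * gauss p M s) *\<^sub>C q ^ (r * (M - s)) *\<^sub>C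
    ((a ^ (N + M - (r + s)) * b ^ (r + s)) \<otimes> (a ^ (N - r) * c ^ r * b ^ (M - s) * d ^ s))" for r s
  \<comment> \<open>p = q cnj q splits over the two legs: b a = q a b in the first, c a = cnj q a c
    in the second. In \<open>2\<close> the second leg uses d b = cnj q b d instead.\<close>
  have 1: "(b \<otimes> c) * (a \<otimes> a) = complex_of_real p *\<^sub>C ((a \<otimes> a) * (b \<otimes> c))"
    unfolding p_eq
    by (simp add: tensor_of_mult b_a c_a tensor_of_scaleC_left tensor_of_scaleC_right scaleC_scaleC)
  have 2: "(b \<otimes> d) * (a \<otimes> b) = complex_of_real p *\<^sub>C ((a \<otimes> b) * (b \<otimes> d))"
    unfolding p_eq
    by (simp add: tensor_of_mult b_a d_b tensor_of_scaleC_left tensor_of_scaleC_right scaleC_scaleC)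
  have h_zero: "h r s = 0" if "N < r \<or> M < s" for r s
    using that by (auto simp: h_def gauss_eq_0)
  have prod_term: "(complex_of_real (gauss p N r) *\<^sub>C ((a \<otimes> a) ^ (N - r) * (b \<otimes> c) ^ r)) *
      (complex_of_real (gauss p M s) *\<^sub>C ((a \<otimes> b) ^ (M - s) * (b \<otimes> d) ^ s)) = h r s"
    if "r \<le> N" "s \<le> M" for r s
  proof -
    have "b ^ r * a ^ (M - s) = q ^ (r * (M - s)) *\<^sub>C (a ^ (M - s) * b ^ r)"
      by (rule quasi_commute_power[OF b_a])
    moreover have "a ^ (N - r) * b ^ r * (a ^ (M - s) * b ^ s) = a ^ (N - r) * (b ^ r * a ^ (M - s)) * b ^ s"
      by (simp only: mult.assoc)
    ultimately have "a ^ (N - r) * b ^ r * (a ^ (M - s) * b ^ s)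
        = q ^ (r * (M - s)) *\<^sub>C (a ^ (N - r) * (a ^ (M - s) * b ^ r) * b ^ s)"
      by (simp only: scaleC_mult_left scaleC_mult_right)
    also have "a ^ (N - r) * (a ^ (M - s) * b ^ r) * b ^ s = a ^ (N + M - (r + s)) * b ^ (r + s)"
    proof -
      have "N + M - (r + s) = (N - r) + (M - s)" using that by simp
      then show ?thesis by (simp only: power_add mult.assoc)
    qed
    finally show ?thesis
      by (simp only: h_def tensor_of_power tensor_of_mult scaleC_mult_left scaleC_mult_right
          tensor_of_scaleC_left scaleC_scaleC of_real_mult mult.assoc mult.left_commute)
  qed
  have "(a \<otimes> a + b \<otimes> c) ^ N * (a \<otimes> b + b \<otimes> d) ^ M = (\<Sum>r\<le>N. \<Sum>s\<le>M. h r s)"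
    unfolding q_binomial_theorem[OF 1] q_binomial_theorem[OF 2] of_real_gauss sum_product
    by (intro sum.cong refl) (simp only: prod_term atMost_iff)
  also have "\<dots> = (\<Sum>(r, s)\<in>{..N} \<times> {..M}. h r s)"
    by (rule sum.cartesian_product)
  \<comment> \<open>The rectangle is enlarged to the triangle r + s <= N + M, whose terms can be
    grouped by R = r + s; the added terms vanish by \<open>h_zero\<close>.\<close>
  also have "\<dots> = (\<Sum>(r, s)\<in>{(r, s). r + s \<le> N + M}. h r s)"
  proof (rule sum.mono_neutral_left)
    show "finite {(r, s). r + s \<le> N + M}"
      by (rule finite_subset[of _ "{..N + M} \<times> {..N + M}"]) auto
    show "\<forall>z\<in>{(r, s). r + s \<le> N + M} - {..N} \<times> {..M}. (case z of (r, s) \<Rightarrow> h r s) = 0"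
      by (force intro: h_zero)
  qed auto
  also have "\<dots> = (\<Sum>R\<le>N + M. \<Sum>r\<le>R. h r (R - r))"
    by (rule sum.triangle_reindex_eq)
  also have "\<dots> = (\<Sum>R\<le>N + M. (a ^ (N + M - R) * b ^ R) \<otimes> coeff_sum N M R)"
    by (intro sum.cong refl) (simp add: coeff_sum_def h_def tensor_of_sum_right tensor_of_scaleC_right)
  finally show ?thesis .
qed

lemma jacobi_commute:
  assumes "x * y = y * x"
  shows "jacobi n f g * y ^ m = y ^ m * jacobi n f g"
proof -
  have "x ^ k * y ^ m = y ^ m * x ^ k" for k
    by (rule commute_power[OF assms])
  then show ?thesis
    by (simp add: jacobi_def sum_distrib_left sum_distrib_right scaleC_mult_left scaleC_mult_right)
qed

lemma x_c: "x * c = c * x"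
proof -
  have "x * b\<^sup>\<star> = b\<^sup>\<star> * x"
    by (metis b_bstar mult.assoc x_def)
  then have "x * (D * b\<^sup>\<star>) = D * b\<^sup>\<star> * x"
    by (simp add: x_D mult.assoc flip: mult.assoc[of x D])
  then show ?thesis
    by (simp add: c_def scaleC_mult_left scaleC_mult_right)
qed

section \<open>The four sign cases of i + j and i - j\<close>

context
  assumes q1: "cmod q < 1"
begin

lemma p_bounds: "0 < p" "p < 1"
  using q_nz q1 by (simp_all add: abs_square_less_1)

text \<open>Case i + j <= 0, i <= j. The symmetry of Gaussian coefficients gives the weights of
  \<open>sum_b\<close> at once, and the surplus a^g comes out on the left.\<close>

lemma coeff_sum_nonpos_le:
  "coeff_sum (n + g) (n + f) n = (complex_of_real (gauss p (n + f) f) / q ^ (f * n)) *\<^sub>C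
    (a ^ g * b ^ f * jacobi n f g * D ^ n)"
proof -
  have "coeff_sum (n + g) (n + f) n = a ^ g * (\<Sum>r\<le>n. complex_of_real (gauss p (n + g) r * gauss p (n + f) (f + r)) *\<^sub>C
      q ^ (r * (f + r)) *\<^sub>C (a ^ (n - r) * c ^ r * b ^ (f + r) * d ^ (n - r)))"
    unfolding coeff_sum_def sum_distrib_left
  proof (intro sum.cong refl)
    fix r assume "r \<in> {..n}"
    then have "n + f - (n - r) = f + r" "n + g - r = g + (n - r)" "r \<le> n" by auto
    moreover from this have "gauss p (n + f) (n - r) = gauss p (n + f) (f + r)"
      using gauss_symmetric[OF p_bounds, of "n - r" "n + f"] by simp
    ultimately show "complex_of_real (gauss p (n + g) r * gauss p (n + f) (n - r)) *\<^sub>C q ^ (r * (n + f - (n - r))) *\<^sub>C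
         (a ^ (n + g - r) * c ^ r * b ^ (n + f - (n - r)) * d ^ (n - r))
       = a ^ g * (complex_of_real (gauss p (n + g) r * gauss p (n + f) (f + r)) *\<^sub>C q ^ (r * (f + r)) *\<^sub>C
         (a ^ (n - r) * c ^ r * b ^ (f + r) * d ^ (n - r)))"
      by (simp only: scaleC_mult_right power_add[of a] mult.assoc)
  qed
  then show ?thesis
    unfolding sum_b[OF q1] by (simp only: scaleC_mult_right mult.assoc)
qed

text \<open>Case i + j <= 0, i >= j. \<open>gauss p n (n + f - r)\<close> vanishes for r < f, so the
  sum starts at f; after the shift the weights are those of \<open>sum_c\<close> times the constant
  \<open>?C\<close>.\<close>

lemma coeff_sum_nonpos_ge:
  "coeff_sum (n + f + g) n (n + f) = (complex_of_real (gauss p (n + f + g) f) / cnj q ^ (f * n)) *\<^sub>C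
    (a ^ g * c ^ f * jacobi n f g * D ^ n)"
proof -
  let ?C = "complex_of_real (gauss p (n + f + g) f / gauss p (n + f) f)"
  have nz: "gauss p (n + f) f \<noteq> 0" using gauss_pos[OF p_bounds, of f "n + f"] by simp
  have "coeff_sum (n + f + g) n (n + f) = (\<Sum>r\<le>n. complex_of_real (gauss p (n + f + g) (f + r) * gauss p n (n + f - (f + r))) *\<^sub>C
      q ^ ((f + r) * (n - (n + f - (f + r)))) *\<^sub>C
      (a ^ (n + f + g - (f + r)) * c ^ (f + r) * b ^ (n - (n + f - (f + r))) * d ^ (n + f - (f + r))))"
    unfolding coeff_sum_def by (rule sum_atMost_shift_support) (auto simp: gauss_eq_0)
  also have "\<dots> = ?C *\<^sub>C (a ^ g * (\<Sum>r\<le>n. complex_of_real (gauss p (n + g) r * gauss p (n + f) (f + r)) *\<^sub>C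
      q ^ (r * (f + r)) *\<^sub>C (a ^ (n - r) * c ^ (f + r) * b ^ r * d ^ (n - r))))"
    unfolding sum_distrib_left complex_vector.scale_sum_right
  proof (intro sum.cong refl)
    fix r assume "r \<in> {..n}"
    then have r: "n + f - (f + r) = n - r" "n - (n - r) = r" "n + f + g - (f + r) = g + (n - r)" "r \<le> n" by auto
    moreover from this have "gauss p n (n - r) = gauss p n r"
      using gauss_symmetric[OF p_bounds, of r n] by simp
    moreover have "gauss p (n + f + g) (f + r) * gauss p n r
      = gauss p (n + f + g) f / gauss p (n + f) f * (gauss p (n + g) r * gauss p (n + f) (f + r))"
      using gauss_product_ratio[OF p_bounds r(4), of f g] nz by (simp add: field_simps)
    ultimately show "complex_of_real (gauss p (n + f + g) (f + r) * gauss p n (n + f - (f + r))) *\<^sub>C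
      q ^ ((f + r) * (n - (n + f - (f + r)))) *\<^sub>C
      (a ^ (n + f + g - (f + r)) * c ^ (f + r) * b ^ (n - (n + f - (f + r))) * d ^ (n + f - (f + r)))
      = ?C *\<^sub>C (a ^ g * (complex_of_real (gauss p (n + g) r * gauss p (n + f) (f + r)) *\<^sub>C q ^ (r * (f + r)) *\<^sub>C
         (a ^ (n - r) * c ^ (f + r) * b ^ r * d ^ (n - r))))"
      by (simp only: scaleC_mult_right power_add[of a] mult.assoc of_real_mult[symmetric] scaleC_scaleC[symmetric]
          mult.commute[of "f + r" r])
        (simp only: scaleC_scaleC of_real_mult mult.assoc)
  qed
  finally show ?thesis
    unfolding sum_c[OF q1] using nz by (simp add: scaleC_mult_right scaleC_scaleC mult.assoc)
qed

text \<open>Case i + j >= 0, i <= j. The surplus d^g comes out on the right; carrying its powers of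
  \<open>a\<^sup>\<star>\<close> to the left of b^f costs q^(-f g), which completes q^(-f n) to
  q^(-f (n + g)).\<close>

lemma coeff_sum_nonneg_le:
  "coeff_sum n (n + f + g) (n + g) = (complex_of_real (gauss p (n + f + g) f) / q ^ (f * (n + g))) *\<^sub>C
    (jacobi n f g * (a\<^sup>\<star>) ^ g * b ^ f * D ^ (n + g))"
proof -
  let ?C = "complex_of_real (gauss p (n + f + g) f / gauss p (n + f) f)"
  have nz: "gauss p (n + f) f \<noteq> 0" using gauss_pos[OF p_bounds, of f "n + f"] by simp
  \<comment> \<open>\<open>0 + r\<close> matches \<open>sum_atMost_shift_support\<close> with offset
    0: only the terms with r > n are cut off.\<close>
  have "coeff_sum n (n + f + g) (n + g) = (\<Sum>r\<le>n. complex_of_real (gauss p n (0 + r) * gauss p (n + f + g) (n + g - (0 + r))) *\<^sub>C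
      q ^ ((0 + r) * (n + f + g - (n + g - (0 + r)))) *\<^sub>C
      (a ^ (n - (0 + r)) * c ^ (0 + r) * b ^ (n + f + g - (n + g - (0 + r))) * d ^ (n + g - (0 + r))))"
    unfolding coeff_sum_def by (rule sum_atMost_shift_support) (auto simp: gauss_eq_0)
  also have "\<dots> = ?C *\<^sub>C ((\<Sum>r\<le>n. complex_of_real (gauss p (n + g) r * gauss p (n + f) (f + r)) *\<^sub>C
      q ^ (r * (f + r)) *\<^sub>C (a ^ (n - r) * c ^ r * b ^ (f + r) * d ^ (n - r))) * d ^ g)"
    unfolding sum_distrib_right complex_vector.scale_sum_right
  proof (intro sum.cong refl)
    fix r assume "r \<in> {..n}"
    then have r: "n + g - r = (n - r) + g" "n + f + g - (n - r + g) = f + r" "r \<le> n" by auto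
    moreover from this have "gauss p (n + f + g) (n - r + g) = gauss p (n + f + g) (f + r)"
      using gauss_symmetric[OF p_bounds, of "n - r + g" "n + f + g"] by simp
    moreover have "gauss p n r * gauss p (n + f + g) (f + r)
      = gauss p (n + f + g) f / gauss p (n + f) f * (gauss p (n + g) r * gauss p (n + f) (f + r))"
      using gauss_product_ratio[OF p_bounds r(3), of f g] nz by (simp add: field_simps)
    ultimately show "complex_of_real (gauss p n (0 + r) * gauss p (n + f + g) (n + g - (0 + r))) *\<^sub>C
      q ^ ((0 + r) * (n + f + g - (n + g - (0 + r)))) *\<^sub>C
      (a ^ (n - (0 + r)) * c ^ (0 + r) * b ^ (n + f + g - (n + g - (0 + r))) * d ^ (n + g - (0 + r)))
      = ?C *\<^sub>C ((complex_of_real (gauss p (n + g) r * gauss p (n + f) (f + r)) *\<^sub>C q ^ (r * (f + r)) *\<^sub>C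
         (a ^ (n - r) * c ^ r * b ^ (f + r) * d ^ (n - r))) * d ^ g)"
      by (simp only: add_0 scaleC_mult_left power_add[of d] mult.assoc)
        (simp only: scaleC_scaleC of_real_mult mult.assoc)
  qed
  finally have coeff_sum_eq: "coeff_sum n (n + f + g) (n + g) = \<dots>" .
  have shift: "b ^ f * jacobi n f g * D ^ n * d ^ g = inverse q ^ (f * g) *\<^sub>C (jacobi n f g * (a\<^sup>\<star>) ^ g * b ^ f * D ^ (n + g))"
  proof -
    have "b ^ f * (a\<^sup>\<star>) ^ g = inverse q ^ (f * g) *\<^sub>C ((a\<^sup>\<star>) ^ g * b ^ f)"
      by (rule quasi_commute_power[OF b_astar])
    moreover have "D ^ n * d ^ g = (a\<^sup>\<star>) ^ g * D ^ (n + g)"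
      using commute_power[OF D_astar, of n g] by (simp add: d_power(2) power_add flip: mult.assoc)
    moreover have "b ^ f * jacobi n f g = jacobi n f g * b ^ f"
      by (rule jacobi_commute[OF x_b, symmetric])
    moreover have "b ^ f * jacobi n f g * D ^ n * d ^ g = (b ^ f * jacobi n f g) * (D ^ n * d ^ g)"
      by (simp only: mult.assoc)
    moreover have "jacobi n f g * b ^ f * ((a\<^sup>\<star>) ^ g * D ^ (n + g)) = jacobi n f g * (b ^ f * (a\<^sup>\<star>) ^ g) * D ^ (n + g)"
      by (simp only: mult.assoc)
    ultimately show ?thesis
      by (simp only: mult.assoc scaleC_mult_left scaleC_mult_right)
  qed
  show ?thesis
    unfolding coeff_sum_eq sum_b[OF q1] unfolding scaleC_mult_left shift scaleC_scaleC using nz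
    by (simp add: distrib_left power_add field_simps)
qed

text \<open>Case i + j >= 0, i >= j. One Gaussian factor cuts off r > n + f, the other r < f, and
  the shifted weights are exactly those of \<open>sum_c\<close>. As before, moving c^f past the g-th
  power of \<open>a\<^sup>\<star>\<close> completes the power of cnj q.\<close>

lemma coeff_sum_nonneg_ge:
  "coeff_sum (n + f) (n + g) (n + f + g) = (complex_of_real (gauss p (n + f) f) / cnj q ^ (f * (n + g))) *\<^sub>C
    (jacobi n f g * (a\<^sup>\<star>) ^ g * c ^ f * D ^ (n + g))"
proof -
  have "coeff_sum (n + f) (n + g) (n + f + g) = (\<Sum>r\<le>n. complex_of_real (gauss p (n + f) (f + r) * gauss p (n + g) (n + f + g - (f + r))) *\<^sub>C
      q ^ ((f + r) * (n + g - (n + f + g - (f + r)))) *\<^sub>C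
      (a ^ (n + f - (f + r)) * c ^ (f + r) * b ^ (n + g - (n + f + g - (f + r))) * d ^ (n + f + g - (f + r))))"
    unfolding coeff_sum_def by (rule sum_atMost_shift_support) (auto simp: gauss_eq_0)
  also have "\<dots> = (\<Sum>r\<le>n. complex_of_real (gauss p (n + g) r * gauss p (n + f) (f + r)) *\<^sub>C
      q ^ (r * (f + r)) *\<^sub>C (a ^ (n - r) * c ^ (f + r) * b ^ r * d ^ (n - r))) * d ^ g"
    unfolding sum_distrib_right
  proof (intro sum.cong refl)
    fix r assume "r \<in> {..n}"
    then have r: "n + f + g - (f + r) = (n - r) + g" "n + g - (n - r + g) = r" "n + f - (f + r) = n - r" "r \<le> n" by auto
    moreover from this have "gauss p (n + g) (n - r + g) = gauss p (n + g) r"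
      using gauss_symmetric[OF p_bounds, of "n - r + g" "n + g"] by simp
    ultimately show "complex_of_real (gauss p (n + f) (f + r) * gauss p (n + g) (n + f + g - (f + r))) *\<^sub>C
      q ^ ((f + r) * (n + g - (n + f + g - (f + r)))) *\<^sub>C
      (a ^ (n + f - (f + r)) * c ^ (f + r) * b ^ (n + g - (n + f + g - (f + r))) * d ^ (n + f + g - (f + r)))
      = complex_of_real (gauss p (n + g) r * gauss p (n + f) (f + r)) *\<^sub>C q ^ (r * (f + r)) *\<^sub>C
         (a ^ (n - r) * c ^ (f + r) * b ^ r * d ^ (n - r)) * d ^ g"
      by (simp only: scaleC_mult_left power_add[of d] mult.assoc mult.commute[of "f + r" r]
          mult.commute[of "gauss p (n + f) (f + r)"])
  qed
  also have "\<dots> = (complex_of_real (gauss p (n + f) f) / cnj q ^ (f * n)) *\<^sub>C (c ^ f * jacobi n f g * D ^ n * d ^ g)"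
    unfolding sum_c[OF q1] by (simp add: scaleC_mult_left)
  also have "c ^ f * jacobi n f g * D ^ n * d ^ g = inverse (cnj q) ^ (f * g) *\<^sub>C (jacobi n f g * (a\<^sup>\<star>) ^ g * c ^ f * D ^ (n + g))"
  proof -
    have "c ^ f * (a\<^sup>\<star>) ^ g = inverse (cnj q) ^ (f * g) *\<^sub>C ((a\<^sup>\<star>) ^ g * c ^ f)"
      by (rule quasi_commute_power[OF c_astar])
    moreover have "D ^ n * d ^ g = (a\<^sup>\<star>) ^ g * D ^ (n + g)"
      using commute_power[OF D_astar, of n g] by (simp add: d_power(2) power_add flip: mult.assoc)
    moreover have "c ^ f * jacobi n f g = jacobi n f g * c ^ f"
      by (rule jacobi_commute[OF x_c, symmetric])
    moreover have "c ^ f * jacobi n f g * D ^ n * d ^ g = (c ^ f * jacobi n f g) * (D ^ n * d ^ g)"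
      by (simp only: mult.assoc)
    moreover have "jacobi n f g * c ^ f * ((a\<^sup>\<star>) ^ g * D ^ (n + g)) = jacobi n f g * (c ^ f * (a\<^sup>\<star>) ^ g) * D ^ (n + g)"
      by (simp only: mult.assoc)
    ultimately show ?thesis
      by (simp only: mult.assoc scaleC_mult_left scaleC_mult_right)
  qed
  finally show ?thesis
    by (simp add: scaleC_scaleC distrib_left power_add field_simps)
qed

end

end

section \<open>A representation in which b is nonzero\<close>

type_synonym vec = "(nat \<times> int) \<Rightarrow>\<^sub>0 complex"

definition ip :: "vec \<Rightarrow> vec \<Rightarrow> complex" where
  "ip v w = (\<Sum>k\<in>Poly_Mapping.keys v. Poly_Mapping.lookup v k * cnj (Poly_Mapping.lookup w k))"

definition vnorm :: "vec \<Rightarrow> real" where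
  "vnorm v = sqrt (\<Sum>k\<in>Poly_Mapping.keys v. (cmod (Poly_Mapping.lookup v k))\<^sup>2)"

lift_definition vscale :: "complex \<Rightarrow> vec \<Rightarrow> vec" is "\<lambda>c v k. c * v k"
  by (rule finite_subset) auto

lemma lookup_vscale [simp]: "Poly_Mapping.lookup (vscale c v) k = c * Poly_Mapping.lookup v k"
  by (simp add: vscale.rep_eq)

text \<open>Lets the sum run over the support of w, which stays fixed while the first argument
  varies; linearity in that argument is then termwise.\<close>

lemma ip_superset:
  assumes "finite S" "Poly_Mapping.keys v \<inter> Poly_Mapping.keys w \<subseteq> S"
  shows "ip v w = (\<Sum>k\<in>S. Poly_Mapping.lookup v k * cnj (Poly_Mapping.lookup w k))"
proof -
  have "ip v w = (\<Sum>k\<in>S \<union> Poly_Mapping.keys v. Poly_Mapping.lookup v k * cnj (Poly_Mapping.lookup w k))"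
    unfolding ip_def using assms by (intro sum.mono_neutral_left) (auto simp: in_keys_iff)
  also have "\<dots> = (\<Sum>k\<in>S. Poly_Mapping.lookup v k * cnj (Poly_Mapping.lookup w k))"
    using assms by (intro sum.mono_neutral_right) (auto simp: in_keys_iff)
  finally show ?thesis .
qed

lemma ip_add_left: "ip (u + v) w = ip u w + ip v w"
  by (simp add: ip_superset[where S = "Poly_Mapping.keys w"] lookup_add distrib_right sum.distrib)

lemma ip_vscale_left: "ip (vscale c v) w = c * ip v w"
  by (simp add: ip_superset[where S = "Poly_Mapping.keys w"] sum_distrib_left mult.assoc)

lemma ip_sym: "ip w v = cnj (ip v w)"
  by (simp add: ip_superset[where S = "Poly_Mapping.keys w"] mult.commute)

lemma ip_zero [simp]: "ip 0 w = 0"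
  by (simp add: ip_def)

lemma ip_minus_left: "ip (- v) w = - ip v w"
  using ip_add_left[of v "- v" w] by (simp add: add_eq_0_iff)

lemma ip_diff_left: "ip (u - v) w = ip u w - ip v w"
  using ip_add_left[of u "- v" w] by (simp add: ip_minus_left)

lemma ip_add_right: "ip w (u + v) = ip w u + ip w v"
  by (subst (1 2 3) ip_sym) (simp add: ip_add_left)

lemma ip_vscale_right: "ip w (vscale c v) = cnj c * ip w v"
  by (subst (1 2) ip_sym) (simp add: ip_vscale_left)

lemma vnorm_nonneg: "0 \<le> vnorm v"
  by (simp add: vnorm_def sum_nonneg)

lemma ip_self: "ip v v = complex_of_real ((vnorm v)\<^sup>2)"
  by (simp add: ip_def vnorm_def sum_nonneg flip: complex_norm_square)

lemma vnorm_eq_0: "vnorm v = 0 \<longleftrightarrow> v = 0"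
proof
  assume "vnorm v = 0"
  then have "\<forall>k\<in>Poly_Mapping.keys v. Poly_Mapping.lookup v k = 0"
    by (simp add: vnorm_def sum_nonneg_eq_0_iff)
  then show "v = 0" by (auto simp: in_keys_iff intro!: poly_mapping_eqI)
qed (simp add: vnorm_def)

lemma vnorm_superset:
  assumes "finite S" "Poly_Mapping.keys v \<subseteq> S"
  shows "vnorm v = L2_set (\<lambda>k. cmod (Poly_Mapping.lookup v k)) S"
  unfolding vnorm_def L2_set_def using assms
  by (intro arg_cong[of _ _ sqrt] sum.mono_neutral_left) (auto simp: in_keys_iff)

lemma vnorm_add: "vnorm (u + v) \<le> vnorm u + vnorm v"
proof -
  let ?S = "Poly_Mapping.keys u \<union> Poly_Mapping.keys v"
  have "vnorm (u + v) = L2_set (\<lambda>k. cmod (Poly_Mapping.lookup u k + Poly_Mapping.lookup v k)) ?S"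
    using vnorm_superset[of ?S "u + v"] Poly_Mapping.keys_add[of u v] by (simp add: lookup_add)
  also have "\<dots> \<le> L2_set (\<lambda>k. cmod (Poly_Mapping.lookup u k) + cmod (Poly_Mapping.lookup v k)) ?S"
    by (rule L2_set_mono) (auto intro: norm_triangle_ineq)
  also have "\<dots> \<le> vnorm u + vnorm v"
    using L2_set_triangle_ineq by (simp add: vnorm_superset[of ?S])
  finally show ?thesis .
qed

lemma vnorm_vscale: "vnorm (vscale c v) = cmod c * vnorm v"
proof -
  have "vnorm (vscale c v) = L2_set (\<lambda>k. cmod c * cmod (Poly_Mapping.lookup v k)) (Poly_Mapping.keys v)"
    by (subst vnorm_superset[of "Poly_Mapping.keys v"]) (auto simp: in_keys_iff norm_mult)
  also have "\<dots> = cmod c * vnorm v"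
    by (simp add: L2_set_right_distrib vnorm_superset[of "Poly_Mapping.keys v"])
  finally show ?thesis .
qed

lemma Cauchy_Schwarz_vec: "cmod (ip v w) \<le> vnorm v * vnorm w"
proof -
  let ?S = "Poly_Mapping.keys v \<union> Poly_Mapping.keys w"
  have "cmod (ip v w) \<le> (\<Sum>k\<in>?S. \<bar>cmod (Poly_Mapping.lookup v k)\<bar> * \<bar>cmod (Poly_Mapping.lookup w k)\<bar>)"
    by (subst ip_superset[of ?S]) (auto intro!: order_trans[OF norm_sum] simp: norm_mult)
  also have "\<dots> \<le> vnorm v * vnorm w"
    using L2_set_mult_ineq[of "\<lambda>k. cmod (Poly_Mapping.lookup v k)" "\<lambda>k. cmod (Poly_Mapping.lookup w k)" ?S]
    by (simp add: vnorm_superset[of ?S])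
  finally show ?thesis .
qed

lemma vec_eqI:
  assumes "\<And>w. ip u w = ip v w"
  shows "u = v"
proof -
  have "ip (u - v) (u - v) = 0" by (simp add: ip_diff_left assms)
  then show ?thesis by (simp add: ip_self vnorm_eq_0)
qed

section \<open>The *-algebra of bounded operators with adjoint\<close>

text \<open>An operator is stored together with its adjoint, which makes it automatically linear.\<close>

definition adjointable :: "(vec \<Rightarrow> vec) \<times> (vec \<Rightarrow> vec) \<Rightarrow> bool" where
  "adjointable = (\<lambda>(S, T). (\<forall>v w. ip (S v) w = ip v (T w)) \<and> (\<exists>C. \<forall>v. vnorm (S v) \<le> C * vnorm v))"

text \<open>Boundedness is demanded of S alone. For T it follows from |Tw|^2 = <S T w, w> <= C |Tw|
  |w| after cancelling |Tw|.\<close>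

lemma adjointable_swap:
  assumes "adjointable (S, T)"
  shows "adjointable (T, S)"
proof -
  obtain C where ST: "\<And>v w. ip (S v) w = ip v (T w)" and C: "\<And>v. vnorm (S v) \<le> C * vnorm v"
    using assms by (auto simp: adjointable_def)
  have "ip (T v) w = ip v (S w)" for v w
    by (subst (1 2) ip_sym) (simp add: ST)
  moreover have "vnorm (T w) \<le> C * vnorm w" for w
  proof (cases "T w = 0")
    case True
    have "0 \<le> vnorm (S w)" by (rule vnorm_nonneg)
    then have "0 \<le> C * vnorm w" using C[of w] by linarith
    then show ?thesis using True vnorm_eq_0[of "T w"] by simp
  next
    case False
    have "(vnorm (T w))\<^sup>2 = cmod (ip (S (T w)) w)"
      by (simp add: ST ip_self norm_power)
    also have "\<dots> \<le> vnorm (S (T w)) * vnorm w"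
      by (rule Cauchy_Schwarz_vec)
    also have "\<dots> \<le> C * vnorm (T w) * vnorm w"
      using C by (intro mult_right_mono) (auto simp: vnorm_nonneg)
    finally have "vnorm (T w) * vnorm (T w) \<le> vnorm (T w) * (C * vnorm w)"
      by (simp add: power2_eq_square mult_ac)
    moreover have "0 < vnorm (T w)"
      using False vnorm_eq_0[of "T w"] vnorm_nonneg[of "T w"] by linarith
    ultimately show ?thesis by simp
  qed
  ultimately show ?thesis by (auto simp: adjointable_def)
qed

lemma adjointable_linear:
  assumes "adjointable (S, T)"
  shows "S (u + v) = S u + S v" "S (vscale c v) = vscale c (S v)" "S 0 = 0" "S (- v) = - S v"
  using assms
  by (auto intro!: vec_eqI simp: adjointable_def ip_add_left ip_vscale_left ip_minus_left)

typedef adj_op = "{ST. adjointable ST}"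
  by (rule exI[of _ "(\<lambda>v. v, \<lambda>v. v)"]) (auto simp: adjointable_def intro!: exI[of _ 1])

setup_lifting type_definition_adj_op

lemma adjointable_add:
  assumes "adjointable (S, T)" "adjointable (S', T')"
  shows "adjointable (\<lambda>v. S v + S' v, \<lambda>v. T v + T' v)"
proof -
  obtain C C' where C: "\<And>v. vnorm (S v) \<le> C * vnorm v" "\<And>v. vnorm (S' v) \<le> C' * vnorm v"
    using assms by (auto simp: adjointable_def)
  have "vnorm (S v + S' v) \<le> (C + C') * vnorm v" for v
    using vnorm_add[of "S v" "S' v"] C[of v] by (simp add: algebra_simps)
  then show ?thesis
    using assms by (auto simp: adjointable_def ip_add_left ip_add_right)
qed

lemma adjointable_scale:
  assumes "adjointable (S, T)"
  shows "adjointable (\<lambda>v. vscale c (S v), \<lambda>v. vscale (cnj c) (T v))"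
proof -
  obtain C where C: "\<And>v. vnorm (S v) \<le> C * vnorm v"
    using assms by (auto simp: adjointable_def)
  have "vnorm (vscale c (S v)) \<le> (cmod c * C) * vnorm v" for v
    using mult_left_mono[OF C[of v], of "cmod c"] by (simp add: vnorm_vscale mult.assoc)
  then show ?thesis
    using assms by (auto simp: adjointable_def ip_vscale_left ip_vscale_right)
qed

lemma adjointable_comp:
  assumes "adjointable (S, T)" "adjointable (S', T')"
  shows "adjointable (\<lambda>v. S (S' v), \<lambda>v. T' (T v))"
proof -
  obtain C C' where C: "\<And>v. vnorm (S v) \<le> C * vnorm v" "\<And>v. vnorm (S' v) \<le> C' * vnorm v"
    using assms by (auto simp: adjointable_def)
  have "vnorm (S (S' v)) \<le> (\<bar>C\<bar> * C') * vnorm v" for v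
  proof -
    have "vnorm (S (S' v)) \<le> C * vnorm (S' v)" by (rule C)
    also have "\<dots> \<le> \<bar>C\<bar> * vnorm (S' v)" by (intro mult_right_mono) (auto simp: vnorm_nonneg)
    also have "\<dots> \<le> \<bar>C\<bar> * (C' * vnorm v)" by (intro mult_left_mono C) simp
    finally show ?thesis by (simp add: mult.assoc)
  qed
  then show ?thesis
    using assms by (auto simp: adjointable_def)
qed

lemma vscale_simps:
  "vscale c (u + v) = vscale c u + vscale c v"
  "vscale (c + c') v = vscale c v + vscale c' v"
  "vscale c (vscale c' v) = vscale (c * c') v"
  "vscale 1 v = v" "vscale (- 1) v = - v"
  by (auto intro!: poly_mapping_eqI simp: lookup_add algebra_simps)

instantiation adj_op :: complex_star_algebra
begin

lift_definition zero_adj_op :: adj_op is "(\<lambda>v. 0, \<lambda>v. 0)"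
  by (auto simp: adjointable_def ip_sym[of _ 0] vnorm_def intro!: exI[of _ 0])
lift_definition one_adj_op :: adj_op is "(\<lambda>v. v, \<lambda>v. v)"
  by (auto simp: adjointable_def intro!: exI[of _ 1])
lift_definition plus_adj_op :: "adj_op \<Rightarrow> adj_op \<Rightarrow> adj_op"
  is "\<lambda>(S, T) (S', T'). (\<lambda>v. S v + S' v, \<lambda>v. T v + T' v)"
  by (auto intro: adjointable_add)
lift_definition scaleC_adj_op :: "complex \<Rightarrow> adj_op \<Rightarrow> adj_op"
  is "\<lambda>c (S, T). (\<lambda>v. vscale c (S v), \<lambda>v. vscale (cnj c) (T v))"
  by (auto intro: adjointable_scale)
lift_definition uminus_adj_op :: "adj_op \<Rightarrow> adj_op"
  is "\<lambda>(S, T). (\<lambda>v. - S v, \<lambda>v. - T v)"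
  using adjointable_scale[of _ _ "- 1"] by (auto simp: vscale_simps)
lift_definition times_adj_op :: "adj_op \<Rightarrow> adj_op \<Rightarrow> adj_op"
  is "\<lambda>(S, T) (S', T'). (\<lambda>v. S (S' v), \<lambda>v. T' (T v))"
  by (auto intro: adjointable_comp)
lift_definition star_adj_op :: "adj_op \<Rightarrow> adj_op" is "\<lambda>(S, T). (T, S)"
  by (auto intro: adjointable_swap)
definition minus_adj_op :: "adj_op \<Rightarrow> adj_op \<Rightarrow> adj_op" where
  "minus_adj_op X Y = X + - Y"

instance
proof
  fix X Y Z :: adj_op and c c' :: complex
  show "X + Y + Z = X + (Y + Z)" by transfer (auto simp: add.assoc)
  show "X + Y = Y + X" by transfer (auto simp: add.commute)
  show "0 + X = X" by transfer auto
  show "- X + X = 0" by transfer auto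
  show "X - Y = X + - Y" by (rule minus_adj_op_def)
  show "X * Y * Z = X * (Y * Z)" by transfer auto
  show "(X + Y) * Z = X * Z + Y * Z"
    by transfer (auto simp: adjointable_linear(1)[OF adjointable_swap])
  show "X * (Y + Z) = X * Y + X * Z" by transfer (auto simp: adjointable_linear(1))
  show "1 * X = X" by transfer auto
  show "X * 1 = X" by transfer auto
  show "c *\<^sub>C (X + Y) = c *\<^sub>C X + c *\<^sub>C Y" by transfer (auto simp: vscale_simps)
  show "(c + c') *\<^sub>C X = c *\<^sub>C X + c' *\<^sub>C X" by transfer (auto simp: vscale_simps)
  show "c *\<^sub>C c' *\<^sub>C X = (c * c') *\<^sub>C X" by transfer (auto simp: vscale_simps)
  show "1 *\<^sub>C X = X" by transfer (auto simp: vscale_simps)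
  show "(c *\<^sub>C X) * Y = c *\<^sub>C (X * Y)"
    by transfer (auto simp: adjointable_linear(2)[OF adjointable_swap])
  show "X * (c *\<^sub>C Y) = c *\<^sub>C (X * Y)" by transfer (auto simp: adjointable_linear(2))
  show "(X + Y)\<^sup>\<star> = X\<^sup>\<star> + Y\<^sup>\<star>" by transfer auto
  show "(c *\<^sub>C X)\<^sup>\<star> = cnj c *\<^sub>C X\<^sup>\<star>" by transfer auto
  show "(X * Y)\<^sup>\<star> = Y\<^sup>\<star> * X\<^sup>\<star>" by transfer auto
  show "X\<^sup>\<star>\<^sup>\<star> = X" by transfer auto
qed

end

section \<open>Operator norm and C*-identity\<close>

definition app :: "adj_op \<Rightarrow> vec \<Rightarrow> vec" where "app X = fst (Rep_adj_op X)"

lemma app_simps: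
  "app 0 v = 0" "app 1 v = v" "app (X + Y) v = app X v + app Y v"
  "app (c *\<^sub>C X) v = vscale c (app X v)" "app (X * Y) v = app X (app Y v)"
  by (simp_all add: app_def zero_adj_op.rep_eq one_adj_op.rep_eq plus_adj_op.rep_eq
      scaleC_adj_op.rep_eq times_adj_op.rep_eq case_prod_beta)

lemma adjointable_app: "adjointable (app X, app (X\<^sup>\<star>))"
  using Rep_adj_op[of X] by (simp add: app_def star_adj_op.rep_eq case_prod_beta)

lemmas app_linear = adjointable_linear[OF adjointable_app]

lemma ip_app: "ip (app X v) w = ip v (app (X\<^sup>\<star>) w)"
  using adjointable_app by (auto simp: adjointable_def)

text \<open>An element is a pair of maps, but nondegeneracy of the inner product lets the first
  component determine the second.\<close>

lemma adj_op_eqI: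
  assumes "\<And>v. app X v = app Y v"
  shows "X = Y"
proof -
  have "app (X\<^sup>\<star>) w = app (Y\<^sup>\<star>) w" for w
    by (rule vec_eqI, subst (1 2) ip_sym) (simp add: assms flip: ip_app)
  with assms have "app X = app Y" "app (X\<^sup>\<star>) = app (Y\<^sup>\<star>)" by blast+
  then have "Rep_adj_op X = Rep_adj_op Y"
    by (simp add: app_def star_adj_op.rep_eq case_prod_beta prod_eq_iff)
  then show ?thesis by (simp add: Rep_adj_op_inject)
qed

text \<open>At v = 0 the quotient is 0/0 = 0, so the zero vector leaves the supremum unchanged and
  witnesses that it is nonnegative.\<close>

definition opnorm :: "adj_op \<Rightarrow> real" where
  "opnorm X = (SUP v. vnorm (app X v) / vnorm v)"

lemma bdd_opnorm: "bdd_above (range (\<lambda>v. vnorm (app X v) / vnorm v))"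
proof -
  have "\<exists>C. \<forall>v. vnorm (app X v) \<le> C * vnorm v"
    using adjointable_app[of X] by (simp add: adjointable_def)
  then obtain C where C: "\<And>v. vnorm (app X v) \<le> C * vnorm v" by blast
  have "vnorm (app X v) / vnorm v \<le> \<bar>C\<bar>" for v
  proof (cases "v = 0")
    case False
    then have "0 < vnorm v" using vnorm_eq_0 vnorm_nonneg[of v] by (metis less_eq_real_def)
    moreover have "vnorm (app X v) \<le> \<bar>C\<bar> * vnorm v"
      using C[of v] vnorm_nonneg[of v] by (meson abs_ge_self mult_right_mono order_trans)
    ultimately show ?thesis by (simp add: divide_le_eq)
  qed (simp add: vnorm_def)
  then show ?thesis by (auto intro!: bdd_aboveI2)
qed

lemma vnorm_app: "vnorm (app X v) \<le> opnorm X * vnorm v"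
proof (cases "v = 0")
  case True
  then show ?thesis by (simp add: app_linear vnorm_def)
next
  case False
  then have "0 < vnorm v" using vnorm_eq_0 vnorm_nonneg[of v] by (metis less_eq_real_def)
  moreover have "vnorm (app X v) / vnorm v \<le> opnorm X"
    unfolding opnorm_def by (rule cSUP_upper[OF UNIV_I bdd_opnorm])
  ultimately show ?thesis by (simp add: divide_le_eq)
qed

lemma opnorm_least:
  assumes "\<And>v. vnorm (app X v) \<le> C * vnorm v" "0 \<le> C"
  shows "opnorm X \<le> C"
  unfolding opnorm_def
proof (rule cSUP_least)
  show "vnorm (app X v) / vnorm v \<le> C" for v
    using assms vnorm_nonneg[of v] by (cases "vnorm v = 0") (simp_all add: divide_le_eq)
qed simp

lemma opnorm_nonneg: "0 \<le> opnorm X"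
proof -
  have "vnorm (app X 0) / vnorm 0 \<le> opnorm X"
    unfolding opnorm_def by (rule cSUP_upper[OF UNIV_I bdd_opnorm])
  then show ?thesis by (simp add: vnorm_def)
qed

lemma opnorm_mult: "opnorm (X * Y) \<le> opnorm X * opnorm Y"
proof (rule opnorm_least)
  fix v
  have "vnorm (app (X * Y) v) \<le> opnorm X * vnorm (app Y v)"
    by (simp add: app_simps vnorm_app)
  also have "\<dots> \<le> opnorm X * (opnorm Y * vnorm v)"
    by (intro mult_left_mono vnorm_app opnorm_nonneg)
  finally show "vnorm (app (X * Y) v) \<le> opnorm X * opnorm Y * vnorm v"
    by (simp add: mult.assoc)
qed (simp add: opnorm_nonneg)

text \<open>The nontrivial half of the C*-identity, by Cauchy-Schwarz. The other half follows from
  submultiplicativity once an operator and its adjoint have equal norm, which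
  \<open>opnorm_star_le\<close> derives from this half.\<close>

lemma opnorm_le_star: "(opnorm X)\<^sup>2 \<le> opnorm (X\<^sup>\<star> * X)"
proof -
  have "opnorm X \<le> sqrt (opnorm (X\<^sup>\<star> * X))"
  proof (rule opnorm_least)
    fix v
    have "(vnorm (app X v))\<^sup>2 = cmod (ip v (app (X\<^sup>\<star> * X) v))"
      by (simp add: app_simps ip_self norm_power flip: ip_app)
    also have "\<dots> \<le> vnorm v * vnorm (app (X\<^sup>\<star> * X) v)"
      by (rule Cauchy_Schwarz_vec)
    also have "\<dots> \<le> vnorm v * (opnorm (X\<^sup>\<star> * X) * vnorm v)"
      by (intro mult_left_mono vnorm_app vnorm_nonneg)
    also have "\<dots> = (sqrt (opnorm (X\<^sup>\<star> * X)) * vnorm v)\<^sup>2"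
      by (simp add: power_mult_distrib opnorm_nonneg power2_eq_square)
    finally show "vnorm (app X v) \<le> sqrt (opnorm (X\<^sup>\<star> * X)) * vnorm v"
      by (rule power2_le_imp_le) (simp add: opnorm_nonneg vnorm_nonneg)
  qed (simp add: opnorm_nonneg)
  then show ?thesis
    using power_mono[OF _ opnorm_nonneg, of X "sqrt (opnorm (X\<^sup>\<star> * X))" 2] by (simp add: opnorm_nonneg)
qed

lemma opnorm_star_le: "opnorm X \<le> opnorm (X\<^sup>\<star>)"
proof (cases "opnorm X = 0")
  case False
  have "opnorm X * opnorm X \<le> opnorm (X\<^sup>\<star>) * opnorm X"
    using opnorm_le_star[of X] opnorm_mult[of "X\<^sup>\<star>" X] by (simp add: power2_eq_square)
  with False show ?thesis using opnorm_nonneg[of X] by simp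
qed (simp add: opnorm_nonneg)

lemma cstar_seminorm_opnorm: "cstar_seminorm (\<lambda>z. opnorm (free_eval a b D z))"
proof -
  have add: "opnorm (X + Y) \<le> opnorm X + opnorm Y" for X Y
  proof (rule opnorm_least)
    fix v
    show "vnorm (app (X + Y) v) \<le> (opnorm X + opnorm Y) * vnorm v"
      using vnorm_add[of "app X v" "app Y v"] vnorm_app[of X v] vnorm_app[of Y v]
      by (simp add: app_simps distrib_right)
  qed (simp add: opnorm_nonneg)
  have scale_le: "opnorm (c *\<^sub>C X) \<le> cmod c * opnorm X" for c X
  proof (rule opnorm_least)
    fix v
    show "vnorm (app (c *\<^sub>C X) v) \<le> cmod c * opnorm X * vnorm v"
      using mult_left_mono[OF vnorm_app[of X v], of "cmod c"]
      by (simp add: app_simps vnorm_vscale mult.assoc)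
  qed (simp add: opnorm_nonneg)
  have scale: "opnorm (c *\<^sub>C X) = cmod c * opnorm X" for c X
  proof (cases "c = 0")
    case True
    then show ?thesis using scale_le[of c X] opnorm_nonneg[of "c *\<^sub>C X"] by simp
  next
    case False
    have "opnorm X \<le> cmod (inverse c) * opnorm (c *\<^sub>C X)"
      using scale_le[of "inverse c" "c *\<^sub>C X"] False by (simp add: scaleC_scaleC scaleC_one)
    then have "cmod c * opnorm X \<le> opnorm (c *\<^sub>C X)"
      using False by (simp add: norm_divide field_simps)
    with scale_le[of c X] show ?thesis by simp
  qed
  have "opnorm (X\<^sup>\<star>) = opnorm X" for X
    using opnorm_star_le[of X] opnorm_star_le[of "X\<^sup>\<star>"] by (simp add: star_star)
  then have "opnorm (X\<^sup>\<star> * X) = (opnorm X)\<^sup>2" for X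
    using opnorm_mult[of "X\<^sup>\<star>" X] opnorm_le_star[of X] by (simp add: power2_eq_square)
  then show ?thesis
    unfolding cstar_seminorm_def by (simp add: free_eval_simps opnorm_nonneg add scale opnorm_mult)
qed

section \<open>Weighted shifts and the representation of the relations\<close>

lift_definition wop :: "(nat \<times> int \<Rightarrow> complex) \<Rightarrow> (nat \<times> int \<Rightarrow> nat \<times> int) \<Rightarrow> vec \<Rightarrow> vec"
  is "\<lambda>w \<pi> v x. if inj_on \<pi> {x. w x \<noteq> 0} then w x * v (\<pi> x) else 0"
proof -
  fix w :: "nat \<times> int \<Rightarrow> complex" and \<pi> :: "nat \<times> int \<Rightarrow> nat \<times> int" and v :: "nat \<times> int \<Rightarrow> complex"
  assume fin: "finite {x. v x \<noteq> 0}"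
  \<comment> \<open>If \<pi> were not injective on the support of w, the pulled-back vector could
    have infinite support. The guard makes the definition total, and \<open>lookup_wop\<close>
    removes it for a \<open>shift_pair\<close>.\<close>
  show "finite {x. (if inj_on \<pi> {x. w x \<noteq> 0} then w x * v (\<pi> x) else 0) \<noteq> 0}"
  proof (cases "inj_on \<pi> {x. w x \<noteq> 0}")
    case True
    have "inj_on \<pi> {x. w x * v (\<pi> x) \<noteq> 0}"
      by (rule inj_on_subset[OF True]) auto
    moreover have "finite (\<pi> ` {x. w x * v (\<pi> x) \<noteq> 0})"
      by (rule finite_subset[OF _ fin]) auto
    ultimately show ?thesis using True finite_imageD by auto
  qed simp
qed

definition weighted_shift where
  "weighted_shift w \<pi> w' \<sigma> = Abs_adj_op (wop w \<pi>, wop w' \<sigma>)"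

text \<open>\<pi> and \<sigma> invert each other on the supports of the weights and the weights are
  conjugate, which makes the two operators adjoint; the bound by 1 makes them contractions.\<close>

definition shift_pair :: "(nat \<times> int \<Rightarrow> complex) \<Rightarrow> (nat \<times> int \<Rightarrow> nat \<times> int) \<Rightarrow>
    (nat \<times> int \<Rightarrow> complex) \<Rightarrow> (nat \<times> int \<Rightarrow> nat \<times> int) \<Rightarrow> bool" where
  "shift_pair w \<pi> w' \<sigma> \<longleftrightarrow>
     (\<forall>x. w x \<noteq> 0 \<longrightarrow> \<sigma> (\<pi> x) = x \<and> w' (\<pi> x) = cnj (w x)) \<and>
     (\<forall>y. w' y \<noteq> 0 \<longrightarrow> \<pi> (\<sigma> y) = y \<and> w (\<sigma> y) = cnj (w' y)) \<and> (\<forall>x. cmod (w x) \<le> 1)"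

lemma shift_pairD:
  assumes "shift_pair w \<pi> w' \<sigma>"
  shows "w x \<noteq> 0 \<Longrightarrow> \<sigma> (\<pi> x) = x" "w' y \<noteq> 0 \<Longrightarrow> \<pi> (\<sigma> y) = y"
    "cmod (w x) \<le> 1"
  using assms unfolding shift_pair_def by blast+

lemma lookup_wop:
  assumes "shift_pair w \<pi> w' \<sigma>"
  shows "Poly_Mapping.lookup (wop w \<pi> v) x = w x * Poly_Mapping.lookup v (\<pi> x)"
    and "Poly_Mapping.lookup (wop w' \<sigma> v) x = w' x * Poly_Mapping.lookup v (\<sigma> x)"
proof -
  have "inj_on \<pi> {x. w x \<noteq> 0}"
    by (rule inj_on_inverseI, rule shift_pairD(1)[OF assms], simp)
  moreover have "inj_on \<sigma> {x. w' x \<noteq> 0}"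
    by (rule inj_on_inverseI, rule shift_pairD(2)[OF assms], simp)
  ultimately show "Poly_Mapping.lookup (wop w \<pi> v) x = w x * Poly_Mapping.lookup v (\<pi> x)"
    "Poly_Mapping.lookup (wop w' \<sigma> v) x = w' x * Poly_Mapping.lookup v (\<sigma> x)"
    by (simp_all add: wop.rep_eq)
qed

lemma adjointable_wop:
  assumes sp: "shift_pair w \<pi> w' \<sigma>"
  shows "adjointable (wop w \<pi>, wop w' \<sigma>)"
proof -
  have "ip (wop w \<pi> v) u = ip v (wop w' \<sigma> u)" for v u
  proof -
    have "ip (wop w \<pi> v) u = (\<Sum>x\<in>{x \<in> Poly_Mapping.keys u. w x \<noteq> 0 \<and> \<pi> x \<in> Poly_Mapping.keys v}.
        w x * Poly_Mapping.lookup v (\<pi> x) * cnj (Poly_Mapping.lookup u x))"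
      by (subst ip_superset[of "{x \<in> Poly_Mapping.keys u. w x \<noteq> 0 \<and> \<pi> x \<in> Poly_Mapping.keys v}"])
        (auto simp: lookup_wop[OF sp] in_keys_iff)
    also have "\<dots> = (\<Sum>y\<in>{y \<in> Poly_Mapping.keys v. w' y \<noteq> 0 \<and> \<sigma> y \<in> Poly_Mapping.keys u}.
        Poly_Mapping.lookup v y * cnj (w' y * Poly_Mapping.lookup u (\<sigma> y)))"
      using sp by (intro sum.reindex_bij_witness[of _ \<sigma> \<pi>]) (auto simp: shift_pair_def)
    also have "\<dots> = ip v (wop w' \<sigma> u)"
      by (subst ip_superset[of "{y \<in> Poly_Mapping.keys v. w' y \<noteq> 0 \<and> \<sigma> y \<in> Poly_Mapping.keys u}"])
        (auto simp: lookup_wop[OF sp] in_keys_iff)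
    finally show ?thesis .
  qed
  moreover have "vnorm (wop w \<pi> v) \<le> 1 * vnorm v" for v
  proof -
    let ?K = "Poly_Mapping.keys (wop w \<pi> v)"
    have K: "w x \<noteq> 0" "Poly_Mapping.lookup v (\<pi> x) \<noteq> 0" if "x \<in> ?K" for x
      using that by (auto simp: in_keys_iff lookup_wop[OF sp])
    have inj: "inj_on \<pi> ?K"
      using shift_pairD(1)[OF sp K(1)] by (rule inj_on_inverseI)
    have "(\<Sum>x\<in>?K. (cmod (Poly_Mapping.lookup (wop w \<pi> v) x))\<^sup>2) \<le> (\<Sum>x\<in>?K. (cmod (Poly_Mapping.lookup v (\<pi> x)))\<^sup>2)"
    proof (intro sum_mono power_mono)
      fix x
      have "cmod (w x) * cmod (Poly_Mapping.lookup v (\<pi> x)) \<le> 1 * cmod (Poly_Mapping.lookup v (\<pi> x))"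
        by (intro mult_right_mono shift_pairD(3)[OF sp]) simp
      then show "cmod (Poly_Mapping.lookup (wop w \<pi> v) x) \<le> cmod (Poly_Mapping.lookup v (\<pi> x))"
        by (simp add: lookup_wop[OF sp] norm_mult)
    qed simp
    also have "\<dots> = (\<Sum>y\<in>\<pi> ` ?K. (cmod (Poly_Mapping.lookup v y))\<^sup>2)"
      by (simp add: sum.reindex[OF inj])
    also have "\<dots> \<le> (\<Sum>y\<in>Poly_Mapping.keys v. (cmod (Poly_Mapping.lookup v y))\<^sup>2)"
      by (rule sum_mono2) (auto simp: in_keys_iff dest: K)
    finally show ?thesis by (simp add: vnorm_def)
  qed
  ultimately show ?thesis unfolding adjointable_def prod.case by blast
qed

lemma lookup_app_weighted_shift:
  assumes "shift_pair w \<pi> w' \<sigma>"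
  shows "Poly_Mapping.lookup (app (weighted_shift w \<pi> w' \<sigma>) v) x = w x * Poly_Mapping.lookup v (\<pi> x)"
    and "Poly_Mapping.lookup (app ((weighted_shift w \<pi> w' \<sigma>)\<^sup>\<star>) v) x = w' x * Poly_Mapping.lookup v (\<sigma> x)"
  using adjointable_wop[OF assms] lookup_wop[OF assms]
  by (simp_all add: weighted_shift_def app_def star_adj_op.rep_eq Abs_adj_op_inverse)

text \<open>Since \<open>wop\<close> pulls back along its map, \<open>k - 1\<close> raises the
  index: e(k,s) goes to sqrt(1 - p^(k+1)) e(k+1,s). The truncation of \<open>k - 1\<close> at k = 0
  is harmless because the weight 1 - p^0 vanishes there.\<close>

definition op_a :: "complex \<Rightarrow> adj_op" where
  "op_a q = weighted_shift (\<lambda>(k, s). complex_of_real (sqrt (1 - (cmod q)\<^sup>2 ^ k))) (\<lambda>(k, s). (k - 1, s))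
     (\<lambda>(k, s). complex_of_real (sqrt (1 - (cmod q)\<^sup>2 ^ Suc k))) (\<lambda>(k, s). (Suc k, s))"

text \<open>The modulus |q|^k yields b b* = p^k on e(k,s). The phase (q / cnj q)^s changes by q /
  cnj q when D shifts s, which is the relation between b and D.\<close>

definition op_b :: "complex \<Rightarrow> adj_op" where
  "op_b q = weighted_shift (\<lambda>(k, s). q ^ k * (q / cnj q) powi s) id
     (\<lambda>(k, s). cnj (q ^ k * (q / cnj q) powi s)) id"

text \<open>The index s runs over all integers so that this shift is unitary.\<close>

definition op_D :: adj_op where
  "op_D = weighted_shift (\<lambda>_. 1) (\<lambda>(k, s). (k, s - 1)) (\<lambda>_. 1) (\<lambda>(k, s). (k, s + 1))"

context
  fixes q :: complex
  assumes q0: "0 < cmod q" and q1: "cmod q < 1"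
begin

lemma cmod_phase: "cmod ((q / cnj q) powi s) = 1"
  using q0 by (simp add: norm_power_int norm_divide)

lemma shift_pairs:
  "shift_pair (\<lambda>(k, s). complex_of_real (sqrt (1 - (cmod q)\<^sup>2 ^ k))) (\<lambda>(k, s). (k - 1, s))
     (\<lambda>(k, s). complex_of_real (sqrt (1 - (cmod q)\<^sup>2 ^ Suc k))) (\<lambda>(k, s). (Suc k, s))"
  "shift_pair (\<lambda>(k, s). q ^ k * (q / cnj q) powi s) id (\<lambda>(k, s). cnj (q ^ k * (q / cnj q) powi s)) id"
  "shift_pair (\<lambda>_. 1) (\<lambda>(k, s). (k, s - 1)) (\<lambda>_. 1) (\<lambda>(k, s). (k, s + 1))"
proof -
  have *: "(cmod q)\<^sup>2 ^ k \<le> 1" for k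
    using q0 q1 by (intro power_le_one) (simp_all add: power_le_one)
  have k0: "k > 0" if "(cmod q)\<^sup>2 ^ k \<noteq> 1" for k
    using that by (cases k) auto
  show "shift_pair (\<lambda>(k, s). complex_of_real (sqrt (1 - (cmod q)\<^sup>2 ^ k))) (\<lambda>(k, s). (k - 1, s))
     (\<lambda>(k, s). complex_of_real (sqrt (1 - (cmod q)\<^sup>2 ^ Suc k))) (\<lambda>(k, s). (Suc k, s))"
    using * k0 by (auto simp: shift_pair_def simp del: power_Suc)
  show "shift_pair (\<lambda>(k, s). q ^ k * (q / cnj q) powi s) id (\<lambda>(k, s). cnj (q ^ k * (q / cnj q) powi s)) id"
    using q0 q1 by (auto simp: shift_pair_def norm_mult cmod_phase norm_power power_le_one)
  show "shift_pair (\<lambda>_. 1) (\<lambda>(k, s). (k, s - 1)) (\<lambda>_. 1) (\<lambda>(k, s). (k, s + 1))"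
    by (auto simp: shift_pair_def)
qed

lemma lookup_ops:
  "Poly_Mapping.lookup (app (op_a q) v) (k, s) = sqrt (1 - (cmod q)\<^sup>2 ^ k) * Poly_Mapping.lookup v (k - 1, s)"
  "Poly_Mapping.lookup (app ((op_a q)\<^sup>\<star>) v) (k, s) = sqrt (1 - (cmod q)\<^sup>2 ^ Suc k) * Poly_Mapping.lookup v (Suc k, s)"
  "Poly_Mapping.lookup (app (op_b q) v) (k, s) = q ^ k * (q / cnj q) powi s * Poly_Mapping.lookup v (k, s)"
  "Poly_Mapping.lookup (app ((op_b q)\<^sup>\<star>) v) (k, s) = cnj (q ^ k * (q / cnj q) powi s) * Poly_Mapping.lookup v (k, s)"
  "Poly_Mapping.lookup (app op_D v) (k, s) = Poly_Mapping.lookup v (k, s - 1)"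
  "Poly_Mapping.lookup (app (op_D\<^sup>\<star>) v) (k, s) = Poly_Mapping.lookup v (k, s + 1)"
  unfolding op_a_def op_b_def op_D_def
  by (simp_all only: lookup_app_weighted_shift[OF shift_pairs(1)] lookup_app_weighted_shift[OF shift_pairs(2)]
      lookup_app_weighted_shift[OF shift_pairs(3)] prod.case id_apply mult_1_left)

lemma op_relators: "\<forall>r\<in>Uq2_relators q (op_a q) (op_b q) op_D. r = 0"
proof -
  let ?p = "(cmod q)\<^sup>2"
  have q_nz: "q \<noteq> 0" using q0 by auto
  have p_le: "?p ^ k \<le> 1" for k
    using q0 q1 by (intro power_le_one) (simp_all add: power_le_one)
  have sq: "complex_of_real (sqrt (1 - ?p ^ k)) * complex_of_real (sqrt (1 - ?p ^ k)) = 1 - of_real ?p ^ k" for k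
  proof -
    have "complex_of_real (sqrt (1 - ?p ^ k)) * complex_of_real (sqrt (1 - ?p ^ k))
      = complex_of_real (sqrt (1 - ?p ^ k) * sqrt (1 - ?p ^ k))" by (simp only: of_real_mult)
    also have "sqrt (1 - ?p ^ k) * sqrt (1 - ?p ^ k) = 1 - ?p ^ k"
      using p_le by (intro real_sqrt_mult_self[THEN trans]) simp
    finally show ?thesis by simp
  qed
  have bb: "q ^ k * (q / cnj q) powi s * cnj (q ^ k * (q / cnj q) powi s) = of_real ?p ^ k" for k s
  proof -
    have "q ^ k * (q / cnj q) powi s * cnj (q ^ k * (q / cnj q) powi s)
      = complex_of_real ((cmod (q ^ k * (q / cnj q) powi s))\<^sup>2)"
      by (rule complex_norm_square[symmetric])
    also have "(cmod (q ^ k * (q / cnj q) powi s))\<^sup>2 = ?p ^ k"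
      by (simp add: norm_mult cmod_phase norm_power flip: power_mult) (simp add: mult.commute)
    finally show ?thesis by simp
  qed
  have sub: "app (X - Y) v = app X v - app Y v" for X Y v
    using app_simps(3)[of "X - Y" Y v] by (simp add: algebra_simps)
  have pq: "(complex_of_real (cmod q))\<^sup>2 = q * cnj q"
    using complex_norm_square[of q] by simp
  have phase: "(q / cnj q) powi s = (q / cnj q) * (q / cnj q) powi (s - 1)" for s
    using power_int_add_1'[of "q / cnj q" "s - 1"] q_nz by simp
  have 1: "op_b q * op_a q - q *\<^sub>C (op_a q * op_b q) = 0"
  proof (rule adj_op_eqI, rule poly_mapping_eqI)
    fix v x
    show "Poly_Mapping.lookup (app (op_b q * op_a q - q *\<^sub>C (op_a q * op_b q)) v) x = Poly_Mapping.lookup (app 0 v) x"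
    proof (cases x)
      case (Pair k s)
      then show ?thesis
        \<comment> \<open>k = 0 is separate because \<open>k - 1\<close> truncates there; both
          products vanish with the weight of a.\<close>
        by (cases k) (simp_all add: sub app_simps lookup_minus lookup_ops)
    qed
  qed
  have 2: "(op_a q)\<^sup>\<star> * op_b q - q *\<^sub>C (op_b q * (op_a q)\<^sup>\<star>) = 0"
    by (rule adj_op_eqI, rule poly_mapping_eqI) (auto simp: sub app_simps lookup_minus lookup_ops)
  have 3: "op_b q * (op_b q)\<^sup>\<star> - (op_b q)\<^sup>\<star> * op_b q = 0"
    by (rule adj_op_eqI, rule poly_mapping_eqI) (auto simp: sub app_simps lookup_minus lookup_ops)
  have 4: "op_a q * (op_a q)\<^sup>\<star> + op_b q * (op_b q)\<^sup>\<star> - 1 = 0"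
  proof (rule adj_op_eqI, rule poly_mapping_eqI)
    fix v x
    show "Poly_Mapping.lookup (app (op_a q * (op_a q)\<^sup>\<star> + op_b q * (op_b q)\<^sup>\<star> - 1) v) x = Poly_Mapping.lookup (app 0 v) x"
    proof (cases x)
      case (Pair k s)
      have "Poly_Mapping.lookup (app (op_a q * (op_a q)\<^sup>\<star> + op_b q * (op_b q)\<^sup>\<star> - 1) v) x
        = (complex_of_real (sqrt (1 - ?p ^ k)) * complex_of_real (sqrt (1 - ?p ^ k))
          + q ^ k * (q / cnj q) powi s * cnj (q ^ k * (q / cnj q) powi s) - 1) * Poly_Mapping.lookup v x"
        by (cases k) (simp_all only: Pair sub app_simps lookup_minus lookup_add lookup_ops, simp_all add: algebra_simps)
      then show ?thesis by (simp only: sq bb) (simp add: app_simps)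
    qed
  qed
  have 5: "op_a q * op_D - op_D * op_a q = 0"
    by (rule adj_op_eqI, rule poly_mapping_eqI) (auto simp: sub app_simps lookup_minus lookup_ops)
  have 6: "op_b q * op_D - (q\<^sup>2 / (complex_of_real (cmod q))\<^sup>2) *\<^sub>C (op_D * op_b q) = 0"
  proof (rule adj_op_eqI, rule poly_mapping_eqI)
    fix v x
    show "Poly_Mapping.lookup (app (op_b q * op_D - (q\<^sup>2 / (complex_of_real (cmod q))\<^sup>2) *\<^sub>C (op_D * op_b q)) v) x
      = Poly_Mapping.lookup (app 0 v) x"
    proof (cases x)
      case (Pair k s)
      have "q\<^sup>2 / (complex_of_real (cmod q))\<^sup>2 = q / cnj q"
        using q_nz by (simp only: pq) (simp add: power2_eq_square)
      then show ?thesis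
        by (simp only: Pair sub app_simps lookup_minus lookup_ops lookup_vscale phase[of s]) simp
    qed
  qed
  have 7: "op_D * op_D\<^sup>\<star> - 1 = 0" "op_D\<^sup>\<star> * op_D - 1 = 0"
    by (rule adj_op_eqI, rule poly_mapping_eqI, auto simp: sub app_simps lookup_minus lookup_ops)+
  have 8: "(op_a q)\<^sup>\<star> * op_a q + (complex_of_real (cmod q))\<^sup>2 *\<^sub>C ((op_b q)\<^sup>\<star> * op_b q) - 1 = 0"
  proof (rule adj_op_eqI, rule poly_mapping_eqI)
    fix v x
    show "Poly_Mapping.lookup (app ((op_a q)\<^sup>\<star> * op_a q + (complex_of_real (cmod q))\<^sup>2 *\<^sub>C ((op_b q)\<^sup>\<star> * op_b q) - 1) v) x
      = Poly_Mapping.lookup (app 0 v) x"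
    proof (cases x)
      case (Pair k s)
      have "Poly_Mapping.lookup (app ((op_a q)\<^sup>\<star> * op_a q + (complex_of_real (cmod q))\<^sup>2 *\<^sub>C ((op_b q)\<^sup>\<star> * op_b q) - 1) v) x
        = (complex_of_real (sqrt (1 - ?p ^ Suc k)) * complex_of_real (sqrt (1 - ?p ^ Suc k))
          + (complex_of_real (cmod q))\<^sup>2 * (q ^ k * (q / cnj q) powi s * cnj (q ^ k * (q / cnj q) powi s)) - 1) * Poly_Mapping.lookup v x"
        by (simp only: Pair sub app_simps lookup_minus lookup_add lookup_ops lookup_vscale diff_Suc_1) (simp add: algebra_simps)
      then show ?thesis by (simp only: sq bb) (simp add: app_simps)
    qed
  qed
  show ?thesis
    unfolding Uq2_relators_def using 1 2 3 4 5 6 7 8 by simp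
qed

text \<open>b fixes e(0,0), where both its weight q^0 and its phase are 1. Each a then raises k with
  a weight sqrt(1 - p^(k+1)), which is nonzero as p < 1.\<close>

lemma op_monomial:
  "\<exists>\<alpha>. \<alpha> \<noteq> 0 \<and> app (op_a q ^ k * op_b q ^ m) (Poly_Mapping.single (0, 0) 1) = vscale \<alpha> (Poly_Mapping.single (k, 0) 1)"
proof -
  let ?p = "(cmod q)\<^sup>2"
  have b: "app (op_b q ^ m) (Poly_Mapping.single (0, 0) 1) = Poly_Mapping.single (0, 0) 1"
  proof (induction m)
    case (Suc m)
    have "app (op_b q) (Poly_Mapping.single (0, 0) 1) = Poly_Mapping.single (0, 0) 1"
      by (rule poly_mapping_eqI) (auto simp: lookup_ops lookup_single when_def split: if_splits)
    then show ?case using Suc by (simp add: app_simps)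
  qed (simp add: app_simps)
  have "\<exists>\<alpha>. \<alpha> \<noteq> 0 \<and> app (op_a q ^ k) (Poly_Mapping.single (0, 0) 1) = vscale \<alpha> (Poly_Mapping.single (k, 0) 1)"
  proof (induction k)
    case 0
    show ?case by (intro exI[of _ 1]) (simp add: app_simps vscale_simps)
  next
    case (Suc k)
    then obtain \<alpha> where \<alpha>: "\<alpha> \<noteq> 0"
      "app (op_a q ^ k) (Poly_Mapping.single (0, 0) 1) = vscale \<alpha> (Poly_Mapping.single (k, 0) 1)" by blast
    have "app (op_a q) (Poly_Mapping.single (k, 0) 1)
      = vscale (sqrt (1 - ?p ^ Suc k)) (Poly_Mapping.single (Suc k, 0) 1)"
    proof (rule poly_mapping_eqI)
      fix x
      show "Poly_Mapping.lookup (app (op_a q) (Poly_Mapping.single (k, 0) 1)) x =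
        Poly_Mapping.lookup (vscale (sqrt (1 - ?p ^ Suc k)) (Poly_Mapping.single (Suc k, 0) 1)) x"
      proof (cases x)
        case (Pair j s)
        then show ?thesis by (cases j) (auto simp: lookup_ops lookup_single when_def)
      qed
    qed
    then have "app (op_a q ^ Suc k) (Poly_Mapping.single (0, 0) 1)
      = vscale (\<alpha> * sqrt (1 - ?p ^ Suc k)) (Poly_Mapping.single (Suc k, 0) 1)"
      by (simp add: app_simps \<alpha>(2) app_linear vscale_simps)
    moreover have "?p ^ Suc k < 1"
      using q0 q1 by (intro power_Suc_less_one) (simp_all add: abs_square_less_1)
    ultimately show ?case
      using \<alpha>(1) by (intro exI[of _ "\<alpha> * sqrt (1 - ?p ^ Suc k)"]) auto
  qed
  with b show ?thesis by (simp add: app_simps)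
qed

lemma monomials_independent:
  fixes a b D :: "'a::cstar_algebra"
  assumes U: "universal_Uq2 q a b D"
    and 0: "(\<Sum>m\<le>n. \<gamma> m *\<^sub>C (a ^ (n - m) * b ^ m)) = 0" and m: "m \<le> n"
  shows "\<gamma> m = 0"
proof -
  let ?ev = "free_eval (op_a q) (op_b q) op_D"
  have power: "free_eval u v w (z ^ k) = free_eval u v w z ^ k" for u v w :: "'c::complex_star_algebra" and z k
    by (induction k) (simp_all add: free_eval_simps)
  have sum: "free_eval u v w (\<Sum>i\<in>I. g i) = (\<Sum>i\<in>I. free_eval u v w (g i))"
    for u v w :: "'c::complex_star_algebra" and I :: "nat set" and g
    by (induction I rule: infinite_finite_induct) (simp_all add: free_eval_simps)
  \<comment> \<open>The combination is lifted to the free algebra, since the seminorm bound in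
    \<open>universal_Uq2\<close> is stated there; its image in the C*-algebra is 0.\<close>
  define z where "z = (\<Sum>m\<le>n. \<gamma> m *\<^sub>C (gen_elem Ga ^ (n - m) * gen_elem Gb ^ m))"
  have "?ev r \<in> Uq2_relators q (op_a q) (op_b q) op_D"
    if "r \<in> Uq2_relators q (gen_elem Ga) (gen_elem Gb) (gen_elem GD)" for r
    using that unfolding Uq2_relators_def by (auto simp: free_eval_simps)
  then have "?ev r = 0" if "r \<in> Uq2_relators q (gen_elem Ga) (gen_elem Gb) (gen_elem GD)" for r
    using op_relators that by blast
  moreover have "opnorm 0 = 0"
    using opnorm_least[of 0 0] opnorm_nonneg[of 0] by (simp add: app_simps vnorm_def)
  ultimately have "\<forall>r\<in>Uq2_relators q (gen_elem Ga) (gen_elem Gb) (gen_elem GD). opnorm (?ev r) = 0"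
    by simp
  then have "opnorm (?ev z) \<le> norm (free_eval a b D z)"
    using U cstar_seminorm_opnorm[of "op_a q" "op_b q" op_D] unfolding universal_Uq2_def by blast
  also have "free_eval a b D z = 0"
    using 0 by (simp add: z_def sum power free_eval_simps)
  finally have "opnorm (?ev z) \<le> 0" by simp
  then have "vnorm (app (?ev z) v) \<le> 0" for v
    using vnorm_app[of "?ev z" v] mult_right_mono[of "opnorm (?ev z)" 0 "vnorm v"] vnorm_nonneg[of v] by simp
  then have null: "app (?ev z) v = 0" for v
    using vnorm_nonneg[of "app (?ev z) v"] vnorm_eq_0[of "app (?ev z) v"] by (simp add: order_antisym)
  have app_sum: "app (\<Sum>i\<in>I. g i) v = (\<Sum>i\<in>I. app (g i) v)" for I :: "nat set" and g v
    by (induction I rule: infinite_finite_induct) (simp_all add: app_simps)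
  have lookup_sum: "Poly_Mapping.lookup (\<Sum>i\<in>I. g i) x = (\<Sum>i\<in>I. Poly_Mapping.lookup (g i :: vec) x)"
    for I :: "nat set" and g x
    by (induction I rule: infinite_finite_induct) (simp_all add: lookup_add)
  obtain \<alpha> where \<alpha>: "\<And>k m. \<alpha> k m \<noteq> 0"
    "\<And>k m. app (op_a q ^ k * op_b q ^ m) (Poly_Mapping.single (0, 0) 1) = vscale (\<alpha> k m) (Poly_Mapping.single (k, 0) 1)"
    using op_monomial by metis
  \<comment> \<open>The entry at (n - m, 0) isolates the index m, because the numbers n - i are
    distinct for i <= n.\<close>
  have "0 = Poly_Mapping.lookup (app (?ev z) (Poly_Mapping.single (0, 0) 1)) (n - m, 0)"
    by (simp add: null)
  also have "\<dots> = (\<Sum>i\<le>n. \<gamma> i * (\<alpha> (n - i) i * (if n - i = n - m then 1 else 0)))"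
    by (simp only: z_def sum power free_eval_simps app_sum lookup_sum app_simps(4) \<alpha>(2) lookup_vscale
        lookup_single when_def prod.inject simp_thms)
  also have "\<dots> = (\<Sum>i\<le>n. if i = m then \<gamma> m * \<alpha> (n - m) m else 0)"
    using m by (intro sum.cong) auto
  also have "\<dots> = \<gamma> m * \<alpha> (n - m) m"
    using m by simp
  finally show ?thesis using \<alpha>(1) by simp
qed

end

section \<open>Identification of the matrix coefficients\<close>

lemma mem_I_set_iff:
  assumes "l = real n / 2"
  shows "i \<in> I_set l \<longleftrightarrow> (\<exists>R\<le>n. i = real R - l)"
  using assms by (auto simp: I_set_def)

lemma nat_floor_real [simp]: "nat \<lfloor>real n\<rfloor> = n"
  by simp

lemma little_qJacobi_eq_sum:
  fixes z :: "'a::cstar_algebra"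
  shows "little_qJacobi n (real f) (real g) s z
    = (\<Sum>k\<le>n. complex_of_real (qJacobi_coeff s n f g k) *\<^sub>C z ^ k)"
  unfolding little_qJacobi_def
  by (intro sum.cong refl) (simp add: qJacobi_coeff_def scaleR_scaleC scaleC_power scaleC_scaleC)

context Uq2_relations
begin

lemma upow_D: "D ^ n * upow D k = upow D (int n + k)"
proof -
  \<comment> \<open>For negative k, \<open>upow D k\<close> is a power of the adjoint, and
    \<open>D * D\<^sup>\<star> = 1\<close> cancels pairs from the middle.\<close>
  have 1: "D ^ n * (D\<^sup>\<star>) ^ m = (if m \<le> n then D ^ (n - m) else (D\<^sup>\<star>) ^ (m - n))" for n m
  proof (induction n arbitrary: m)
    case (Suc n)
    show ?case
    proof (cases m)
      case m: (Suc m')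
      have "D ^ Suc n * (D\<^sup>\<star>) ^ m = D ^ n * (D * D\<^sup>\<star>) * (D\<^sup>\<star>) ^ m'"
        by (simp add: m mult.assoc power_commutes[of D, symmetric])
      then show ?thesis using Suc[of m'] m by (simp add: D_Dstar)
    qed simp
  qed simp
  show ?thesis
  proof (cases "0 \<le> k")
    case True
    then show ?thesis by (simp add: upow_def nat_add_distrib power_add)
  next
    case False
    then show ?thesis using 1[of n "nat (- k)"]
      by (auto simp: upow_def nat_diff_distrib' intro!: arg_cong2[of _ _ _ _ "(^)"])
  qed
qed

text \<open>Both \<open>comult_monomial\<close> and the defining property of t expand \<Delta> of
  the basis vector with index j = M - l over the same independent monomials, so the second legs
  agree. Dividing by the positive normalisation of the vector with index R - l gives the
  formula.\<close>

lemma matrix_coeff_eq: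
  fixes \<Delta> :: "'a \<Rightarrow> ('a, 'a) tensor" and t :: "real \<Rightarrow> real \<Rightarrow> 'a"
  assumes q1: "cmod q < 1"
    and indep: "\<forall>n \<gamma>. (\<Sum>m\<le>n. \<gamma> m *\<^sub>C (a ^ (n - m) * b ^ m)) = 0 \<longrightarrow> (\<forall>m\<le>n. \<gamma> m = 0)"
    and \<Delta>: "is_comultiplication q a b D \<Delta>"
    and t: "is_matrix_coeffs q a b D \<Delta> l t"
    and l: "l = real (N + M) / 2" and R: "R \<le> N + M"
  shows "t (real R - l) (real M - l)
    = complex_of_real (sqrt_binom q l (real M - l) / sqrt_binom q l (real R - l)) *\<^sub>C coeff_sum N M R"
proof -
  let ?n = "N + M"
  let ?s = "\<lambda>m. sqrt_binom q l (real m - l)"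
  have s_pos: "0 < ?s m" if "m \<le> ?n" for m
  proof -
    have "2 * l = real ?n" "l + (real m - l) = real m" using l by simp_all
    then show ?thesis
      using gauss_pos[OF p_bounds[OF q1] that] gauss_eq_qbinom[OF p_bounds[OF q1] that]
      by (simp only: sqrt_binom_def nat_floor_real real_sqrt_gt_0_iff)
  qed
  have V: "V_basis q a b l (real m - l) = complex_of_real (?s m) *\<^sub>C (a ^ (?n - m) * b ^ m)" if "m \<le> ?n" for m
  proof -
    have "l - (real m - l) = real (?n - m)" using that l by (simp add: of_nat_diff)
    then show ?thesis by (simp add: V_basis_def)
  qed
  have bij: "bij_betw (\<lambda>m. real m - l) {..?n} (I_set l)"
    using l by (auto simp: bij_betw_def inj_on_def mem_I_set_iff[OF l])
  have M: "real M - l \<in> I_set l"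
    using mem_I_set_iff[OF l] by auto
  \<comment> \<open>The minus sign in \<Delta> a is moved into the second leg as the scalar -1,
    where it becomes part of \<open>c\<close>.\<close>
  have O: "star_hom_on (O_Uq2 a b D) \<Delta>" and
    \<Delta>_gen: "\<Delta> a = a \<otimes> a + b \<otimes> c" "\<Delta> b = a \<otimes> b + b \<otimes> d"
    using \<Delta> tensor_of_scaleC_right[of b "- 1" "cnj q *\<^sub>C (D * b\<^sup>\<star>)"]
    by (simp_all add: is_comultiplication_def c_def d_def tensor_of_scaleC_right scaleC_one)
  have O_mult: "u * v \<in> O_Uq2 a b D" if "u \<in> O_Uq2 a b D" "v \<in> O_Uq2 a b D" for u v
    using that by (auto simp flip: range_free_eval free_eval_mult)
  have O_one: "1 \<in> O_Uq2 a b D" 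
    unfolding range_free_eval[symmetric] by (metis free_eval_one rangeI)
  have O_scale: "r *\<^sub>C u \<in> O_Uq2 a b D" if "u \<in> O_Uq2 a b D" for r u
    using that by (auto simp flip: range_free_eval free_eval_scaleC)
  have O_power: "u ^ k \<in> O_Uq2 a b D" if "u \<in> O_Uq2 a b D" for u k
    using that by (induction k) (auto simp: O_one O_mult)
  have \<Delta>_power: "\<Delta> (u ^ k) = \<Delta> u ^ k" if "u \<in> O_Uq2 a b D" for u k
    using that O O_power[OF that] by (induction k) (auto simp: star_hom_on_def)
  have ab: "a \<in> O_Uq2 a b D" "b \<in> O_Uq2 a b D"
    unfolding range_free_eval[symmetric] by (metis free_eval_gen rangeI)+
  have "\<Delta> (V_basis q a b l (real M - l)) = complex_of_real (?s M) *\<^sub>C (\<Delta> a ^ N * \<Delta> b ^ M)"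
  proof -
    have "\<Delta> (complex_of_real (?s M) *\<^sub>C (a ^ N * b ^ M)) = complex_of_real (?s M) *\<^sub>C (\<Delta> (a ^ N) * \<Delta> (b ^ M))"
      using O ab by (simp add: star_hom_on_def O_power O_mult)
    then show ?thesis by (simp add: V \<Delta>_power ab)
  qed
  also have "\<dots> = (\<Sum>m\<le>?n. (a ^ (?n - m) * b ^ m) \<otimes> (complex_of_real (?s M) *\<^sub>C coeff_sum N M m))"
    by (simp add: \<Delta>_gen comult_monomial complex_vector.scale_sum_right tensor_of_scaleC_right)
  finally have 1: "\<Delta> (V_basis q a b l (real M - l))
    = (\<Sum>m\<le>?n. (a ^ (?n - m) * b ^ m) \<otimes> (complex_of_real (?s M) *\<^sub>C coeff_sum N M m))" .
  have "\<Delta> (V_basis q a b l (real M - l)) = (\<Sum>i\<in>I_set l. V_basis q a b l i \<otimes> t i (real M - l))"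
    using t M by (simp add: is_matrix_coeffs_def)
  also have "\<dots> = (\<Sum>m\<le>?n. V_basis q a b l (real m - l) \<otimes> t (real m - l) (real M - l))"
    by (rule sum.reindex_bij_betw[OF bij, symmetric])
  also have "\<dots> = (\<Sum>m\<le>?n. (a ^ (?n - m) * b ^ m) \<otimes> (complex_of_real (?s m) *\<^sub>C t (real m - l) (real M - l)))"
    by (intro sum.cong refl) (simp add: V tensor_of_scaleC_left tensor_of_scaleC_right)
  finally have 2: "\<Delta> (V_basis q a b l (real M - l))
    = (\<Sum>m\<le>?n. (a ^ (?n - m) * b ^ m) \<otimes> (complex_of_real (?s m) *\<^sub>C t (real m - l) (real M - l)))" .
  have "complex_of_real (?s R) *\<^sub>C t (real R - l) (real M - l) = complex_of_real (?s M) *\<^sub>C coeff_sum N M R"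
  proof (rule tensor_coeffs_unique[where I = "{..?n}" and f = "\<lambda>m. a ^ (?n - m) * b ^ m"
        and t = "\<lambda>m. complex_of_real (?s m) *\<^sub>C t (real m - l) (real M - l)"])
    show "\<And>\<gamma>. (\<Sum>m\<le>?n. \<gamma> m *\<^sub>C (a ^ (?n - m) * b ^ m)) = 0 \<Longrightarrow> \<forall>m\<in>{..?n}. \<gamma> m = 0"
      using indep by blast
    show "(\<Sum>m\<le>?n. (a ^ (?n - m) * b ^ m) \<otimes> (complex_of_real (?s m) *\<^sub>C t (real m - l) (real M - l)))
      = (\<Sum>m\<le>?n. (a ^ (?n - m) * b ^ m) \<otimes> (complex_of_real (?s M) *\<^sub>C coeff_sum N M m))"
      using 1 2 by simp
  qed (use R in simp_all)
  then have "inverse (complex_of_real (?s R)) *\<^sub>C complex_of_real (?s R) *\<^sub>C t (real R - l) (real M - l)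
    = inverse (complex_of_real (?s R)) *\<^sub>C complex_of_real (?s M) *\<^sub>C coeff_sum N M R" by simp
  then show ?thesis
    using s_pos[OF R] by (simp add: scaleC_scaleC scaleC_one divide_inverse mult.commute)
qed

end

text \<open>The exponents (i - j)(l + i) and (j - i)(l + j) become -f m with natural f and m, so the
  floor rounds nothing.\<close>

lemma power_int_minus_floor: "s powi \<lfloor>- (real f) * real m\<rfloor> = inverse (s ^ (f * m))" for s :: complex
proof -
  have "- (real f) * real m = real_of_int (- int (f * m))" by simp
  then have "\<lfloor>- (real f) * real m\<rfloor> = - int (f * m)" by (simp only: floor_of_int)
  then show ?thesis by (simp only: power_int_minus power_int_of_nat)
qed

theorem theorem4p18:
  fixes q :: complex and a b D c :: "'a::cstar_algebra"
    and \<Delta> :: "'a \<Rightarrow> ('a, 'a) tensor" and t :: "real \<Rightarrow> real \<Rightarrow> 'a"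
    and l i j :: real and k :: int
  assumes "0 < cmod q" and "cmod q < 1"
    and "universal_Uq2 q a b D"
    and "is_comultiplication q a b D \<Delta>"
    and "l \<in> half_nats" and "i \<in> I_set l" and "j \<in> I_set l"
    and "is_matrix_coeffs q a b D \<Delta> l t"
    and "c = - (cnj q *\<^sub>C (D * b\<^sup>\<star>))"
  shows "(i + j \<le> 0 \<and> i \<ge> j \<longrightarrow>
      t i j * upow D k =
        (cnj q powi \<lfloor>(j - i) * (l + j)\<rfloor> *
          complex_of_real ((sqrt_binom q l j / sqrt_binom q l i) * qbinom (nat_of (l - j)) (nat_of (i - j)) ((cmod q)\<^sup>2))) *\<^sub>C
        (a ^ nat_of (- (i + j)) * c ^ nat_of (i - j) *
         little_qJacobi (nat_of (l + j)) (i - j) (- i - j) ((cmod q)\<^sup>2) (b * b\<^sup>\<star>) *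
         upow D (\<lfloor>l + j\<rfloor> + k))) \<and>
    (i + j \<le> 0 \<and> i \<le> j \<longrightarrow>
      t i j * upow D k =
        (q powi \<lfloor>(i - j) * (l + i)\<rfloor> *
          complex_of_real ((sqrt_binom q l j / sqrt_binom q l i) * qbinom (nat_of (l + j)) (nat_of (j - i)) ((cmod q)\<^sup>2))) *\<^sub>C
        (a ^ nat_of (- (i + j)) * b ^ nat_of (j - i) *
         little_qJacobi (nat_of (l + i)) (j - i) (- i - j) ((cmod q)\<^sup>2) (b * b\<^sup>\<star>) *
         upow D (\<lfloor>l + i\<rfloor> + k))) \<and>
    (i + j \<ge> 0 \<and> i \<le> j \<longrightarrow>
      t i j * upow D k =
        (q powi \<lfloor>(i - j) * (l + i)\<rfloor> *
          complex_of_real ((sqrt_binom q l j / sqrt_binom q l i) * qbinom (nat_of (l + j)) (nat_of (j - i)) ((cmod q)\<^sup>2))) *\<^sub>C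
        (little_qJacobi (nat_of (l - j)) (j - i) (i + j) ((cmod q)\<^sup>2) (b * b\<^sup>\<star>) *
         (a\<^sup>\<star>) ^ nat_of (i + j) * b ^ nat_of (j - i) *
         upow D (\<lfloor>l + i\<rfloor> + k))) \<and>
    (i + j \<ge> 0 \<and> i \<ge> j \<longrightarrow>
      t i j * upow D k =
        (cnj q powi \<lfloor>(j - i) * (l + j)\<rfloor> *
          complex_of_real ((sqrt_binom q l j / sqrt_binom q l i) * qbinom (nat_of (l - j)) (nat_of (i - j)) ((cmod q)\<^sup>2))) *\<^sub>C
        (little_qJacobi (nat_of (l - i)) (i - j) (i + j) ((cmod q)\<^sup>2) (b * b\<^sup>\<star>) *
         (a\<^sup>\<star>) ^ nat_of (i + j) * c ^ nat_of (i - j) *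
         upow D (\<lfloor>l + j\<rfloor> + k)))"
proof -
  interpret U: Uq2_relations q a b D
    using assms(1,3) by unfold_locales (auto simp: universal_Uq2_def)
  obtain m where l: "l = real m / 2"
    using assms(5) by (auto simp: half_nats_def)
  obtain M where M: "M \<le> m" "j = real M - l" using assms(7) mem_I_set_iff[OF l] by auto
  obtain R where R: "R \<le> m" "i = real R - l" using assms(6) mem_I_set_iff[OF l] by auto
  define N where "N = m - M"
  have m: "m = N + M" using M by (simp add: N_def)
  have c: "U.c = c" by (simp add: U.c_def assms(9))
  have gauss: "gauss ((cmod q)\<^sup>2) u v = qbinom u v ((cmod q)\<^sup>2)" if "v \<le> u" for u v
    using gauss_eq_qbinom[OF U.p_bounds[OF assms(2)] that] .
  have jacobi: "U.jacobi n f g = little_qJacobi n (real f) (real g) ((cmod q)\<^sup>2) (b * b\<^sup>\<star>)" for n f g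
    by (simp add: U.jacobi_def U.x_def little_qJacobi_eq_sum)
  have t: "t i j * upow D k = complex_of_real (sqrt_binom q l j / sqrt_binom q l i) *\<^sub>C (U.coeff_sum N M R * upow D k)"
  proof -
    have "\<forall>n \<gamma>. (\<Sum>m\<le>n. \<gamma> m *\<^sub>C (a ^ (n - m) * b ^ m)) = 0 \<longrightarrow> (\<forall>m\<le>n. \<gamma> m = 0)"
      using monomials_independent[OF assms(1-3)] by blast
    from U.matrix_coeff_eq[OF assms(2) this assms(4,8) l[unfolded m] R(1)[unfolded m]] show ?thesis
      by (simp only: M(2) R(2) scaleC_mult_left)
  qed
  have lj: "l + j = real M" "l - j = real N" and li: "l + i = real R" "l - i = real (N + M - R)"
    using l m M R by (simp_all add: of_nat_diff)
  \<comment> \<open>One normalisation for all four cases: s is q or cnj q, u is l + j or l - j, and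
    X is what stands to the left of the power of D.\<close>
  have A: "t i j * upow D k = (s powi \<lfloor>- (real f) * real e\<rfloor> *
        complex_of_real (sqrt_binom q l j / sqrt_binom q l i * qbinom u f ((cmod q)\<^sup>2))) *\<^sub>C (X * upow D (int e' + k))"
    if coeff_sum: "U.coeff_sum N M R = (complex_of_real (gauss ((cmod q)\<^sup>2) u f) / s ^ (f * e)) *\<^sub>C (X * D ^ e')" and "f \<le> u"
    for s f e e' u X
    unfolding t coeff_sum power_int_minus_floor using gauss[OF \<open>f \<le> u\<close>]
    by (simp add: scaleC_mult_left scaleC_scaleC mult.assoc U.upow_D divide_inverse mult.left_commute mult.commute)
  show ?thesis
  proof (intro conjI impI)
    assume ij: "i + j \<le> 0 \<and> i \<ge> j"
    \<comment> \<open>f = i - j, g = -(i + j) and the degree l + j = M are natural numbers here;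
      \<open>e\<close> expresses R and N through them.\<close>
    define f g where "f = R - M" and "g = N - R"
    have "real R + real M \<le> real m" "real M \<le> real R" using ij M R l by auto
    then have e: "R = M + f" "N = M + f + g" using m by (auto simp: f_def g_def)
    have r: "i - j = real f" "j - i = - real f" "- (i + j) = real g" "- i - j = real g"
      using M R l m e by auto
    show "t i j * upow D k =
        (cnj q powi \<lfloor>(j - i) * (l + j)\<rfloor> *
          complex_of_real ((sqrt_binom q l j / sqrt_binom q l i) * qbinom (nat_of (l - j)) (nat_of (i - j)) ((cmod q)\<^sup>2))) *\<^sub>C
        (a ^ nat_of (- (i + j)) * c ^ nat_of (i - j) *
         little_qJacobi (nat_of (l + j)) (i - j) (- i - j) ((cmod q)\<^sup>2) (b * b\<^sup>\<star>) *
         upow D (\<lfloor>l + j\<rfloor> + k))"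
      using A[OF U.coeff_sum_nonpos_ge[OF assms(2), of M f g, folded e(2), folded e(1)]] e(2)
      by (simp only: r lj jacobi c nat_floor_real floor_of_nat nat_int le_add1 add.assoc trans_le_add2)
  next
    assume ij: "i + j \<le> 0 \<and> i \<le> j"
    define f g where "f = M - R" and "g = N - R"
    have "real R + real M \<le> real m" "real R \<le> real M" using ij M R l by auto
    then have e: "M = R + f" "N = R + g" using m by (auto simp: f_def g_def)
    have r: "j - i = real f" "i - j = - real f" "- (i + j) = real g" "- i - j = real g"
      using M R l m e by auto
    show "t i j * upow D k =
        (q powi \<lfloor>(i - j) * (l + i)\<rfloor> *
          complex_of_real ((sqrt_binom q l j / sqrt_binom q l i) * qbinom (nat_of (l + j)) (nat_of (j - i)) ((cmod q)\<^sup>2))) *\<^sub>C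
        (a ^ nat_of (- (i + j)) * b ^ nat_of (j - i) *
         little_qJacobi (nat_of (l + i)) (j - i) (- i - j) ((cmod q)\<^sup>2) (b * b\<^sup>\<star>) *
         upow D (\<lfloor>l + i\<rfloor> + k))"
      using A[OF U.coeff_sum_nonpos_le[OF assms(2), of R g f, folded e]] e(1)
      by (simp only: r lj li jacobi c nat_floor_real floor_of_nat nat_int le_add1 le_add2 add.assoc trans_le_add2)
  next
    assume ij: "i + j \<ge> 0 \<and> i \<le> j"
    define f g where "f = M - R" and "g = R - N"
    have "real R + real M \<ge> real m" "real R \<le> real M" using ij M R l by auto
    then have e: "R = N + g" "M = N + f + g" using m by (auto simp: f_def g_def)
    have r: "j - i = real f" "i - j = - real f" "i + j = real g"
      using M R l m e by auto
    show "t i j * upow D k =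
        (q powi \<lfloor>(i - j) * (l + i)\<rfloor> *
          complex_of_real ((sqrt_binom q l j / sqrt_binom q l i) * qbinom (nat_of (l + j)) (nat_of (j - i)) ((cmod q)\<^sup>2))) *\<^sub>C
        (little_qJacobi (nat_of (l - j)) (j - i) (i + j) ((cmod q)\<^sup>2) (b * b\<^sup>\<star>) *
         (a\<^sup>\<star>) ^ nat_of (i + j) * b ^ nat_of (j - i) *
         upow D (\<lfloor>l + i\<rfloor> + k))"
      using A[OF U.coeff_sum_nonneg_le[OF assms(2), of N f g, folded e]] e(2)
      by (simp only: r lj li jacobi c nat_floor_real floor_of_nat nat_int le_add1 le_add2 add.assoc trans_le_add2)
  next
    assume ij: "i + j \<ge> 0 \<and> i \<ge> j"
    \<comment> \<open>The degree l - i is none of N, M, R, so it gets its own name and all three are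
      expressed through n, f, g.\<close>
    define f g n where "f = R - M" and "g = R - N" and "n = N + M - R"
    have "real R + real M \<ge> real m" "real M \<le> real R" using ij M R l by auto
    then have e: "N = n + f" "M = n + g" "R = n + f + g" using m R by (auto simp: f_def g_def n_def)
    have r: "i - j = real f" "j - i = - real f" "i + j = real g"
      using M R l m e by auto
    have ln: "l - i = real n" using li(2) e by simp
    show "t i j * upow D k =
        (cnj q powi \<lfloor>(j - i) * (l + j)\<rfloor> *
          complex_of_real ((sqrt_binom q l j / sqrt_binom q l i) * qbinom (nat_of (l - j)) (nat_of (i - j)) ((cmod q)\<^sup>2))) *\<^sub>C
        (little_qJacobi (nat_of (l - i)) (i - j) (i + j) ((cmod q)\<^sup>2) (b * b\<^sup>\<star>) *
         (a\<^sup>\<star>) ^ nat_of (i + j) * c ^ nat_of (i - j) *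
         upow D (\<lfloor>l + j\<rfloor> + k))"
      using A[OF U.coeff_sum_nonneg_ge[OF assms(2), of n f g, folded e]] e(1)
      by (simp only: r ln lj jacobi c nat_floor_real floor_of_nat nat_int le_add1 le_add2 add.assoc trans_le_add2)
  qed
qed

end
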